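(* Let $K$ be a compact connected Lie group, with maximal torus $T$, $\mathfrak{t}=\mathrm{Lie}(T)$, positive root system $\Delta^+\subset\mathfrak{t}^*$ and closed positive Weyl chamber $\mathfrak{t}^*_{\geq 0}$. If $\lambda\in\rho^K+\mathfrak{t}^*_{\geq0}$ and $\mu\in\mathfrak{t}^*$, then $$\|\lambda-\mu\|\geq\|\rho^{K_\mu}\|.$$ Equality holds if and only if $\mu$ is dominant (i.e. $\mu\in\mathfrak{t}^*_{\geq0}$) and $\lambda-\rho(\lambda)=\mu-\rho(\mu)$.
   Context: Fix a $K$-invariant Euclidean inner product on $\mathfrak{k}=\mathrm{Lie}(K)$, used to identify $\mathfrak{k}\simeq\mathfrak{k}^*$; $(\cdot,\cdot)$ and $\|\cdot\|$ denote the inner product and norm on $\mathfrak{k}^*$. The space $\mathfrak{t}^*$ is embedded in $\mathfrak{k}^*$ as the $T$-invariant elements. Roots are elements $\alpha\in\mathfrak{t}^*$ (the character of $T$ is $e^{i\alpha}$), $\Delta$ is the root system, $H_\alpha\in\mathfrak{t}$ the coroot ($\langle\alpha,H_\alpha\rangle=2$), and $\mathfrak{t}^*_{\geq0}=\{\xi\in\mathfrak{t}^*:\langle\xi,H_\alpha\rangle\geq0\ \forall\alpha\in\Delta^+\}$. $\rho^K=\frac12\sum_{\alpha\in\Delta^+}\alpha$. For $\mu\in\mathfrak{t}^*$: $K_\mu$ is the stabilizer of $\mu$ in $K$; $\rho^{K_\mu}=\frac12\sum_{\alpha\in\Delta^+,(\alpha,\mu)=0}\alpha$ (the $\rho$-element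 of $K_\mu$ for the induced positive system); $\rho(\mu)=\frac12\sum_{\alpha\in\Delta,(\alpha,\mu)>0}\alpha$. *)

theory Defs
  imports "HOL-Analysis.Analysis" "HOL-Algebra.Group"
begin

section \<open>Smooth maps between subsets of Euclidean spaces\<close>

text \<open>\<open>Ck_on k f U\<close> is meant for open \<open>U\<close> only. Continuity of all directional derivatives of
  order at most \<open>k\<close>, iterated over \<open>k\<close>, gives the usual class of \<open>k\<close> times continuously
  differentiable maps.\<close>

fun Ck_on :: "nat \<Rightarrow> ('a::euclidean_space \<Rightarrow> 'b::euclidean_space) \<Rightarrow> 'a set \<Rightarrow> bool" where
  "Ck_on 0 f U \<longleftrightarrow> continuous_on U f"
| "Ck_on (Suc k) f U \<longleftrightarrow>
     f differentiable_on U \<and> (\<forall>v. Ck_on k (\<lambda>x. frechet_derivative f (at x) v) U)"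

text \<open>Smoothness on an arbitrary subset means local extendability to a smooth map on an open
  set of the ambient space. Below, the subsets are open in a linear subspace \<open>E\<close> (or in
  \<open>E \<times> E\<close>), where this is smoothness in the usual sense.\<close>

definition smooth_map_on :: "'a::euclidean_space set \<Rightarrow> ('a \<Rightarrow> 'b::euclidean_space) \<Rightarrow> bool" where
  "smooth_map_on S f \<longleftrightarrow>
     (\<forall>x\<in>S. \<exists>U F. open U \<and> x \<in> U \<and> (\<forall>k. Ck_on k F U) \<and> (\<forall>y\<in>U \<inter> S. F y = f y))"


section \<open>Lie groups\<close>

text \<open>The manifold is modelled on a linear subspace \<open>model\<close> of a Euclidean space rather than on
  the whole type, so that every dimension, including 0, occurs. A chart is a pair of a domain and
  a coordinate map; values of the coordinate map outside of the domain are irrelevant.\<close>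

record ('g, 'e) lie_data = "'g monoid" +
  topol :: "'g topology"
  model :: "'e set"
  atlas :: "('g set \<times> ('g \<Rightarrow> 'e)) set"

abbreviation chart_inv :: "'g set \<times> ('g \<Rightarrow> 'e) \<Rightarrow> 'e \<Rightarrow> 'g" where
  "chart_inv c \<equiv> inv_into (fst c) (snd c)"

definition smooth_manifold :: "('g, 'e::euclidean_space) lie_data \<Rightarrow> bool" where
  "smooth_manifold K \<longleftrightarrow>
     Hausdorff_space (topol K) \<and>
     (\<exists>B. countable B \<and> openin (topol K) = arbitrary union_of (\<lambda>V. V \<in> B)) \<and>
     subspace (model K) \<and>
     (\<Union>(fst ` atlas K) = topspace (topol K)) \<and>
     (\<forall>(U, \<phi>)\<in>atlas K.
        openin (topol K) U \<and> openin (top_of_set (model K)) (\<phi> ` U) \<and>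
        homeomorphic_map (subtopology (topol K) U) (top_of_set (\<phi> ` U)) \<phi>) \<and>
     (\<forall>c\<in>atlas K. \<forall>d\<in>atlas K.
        smooth_map_on (snd c ` (fst c \<inter> fst d)) (\<lambda>x. snd d (chart_inv c x)))"

definition lie_group :: "('g, 'e::euclidean_space) lie_data \<Rightarrow> bool" where
  "lie_group K \<longleftrightarrow>
     group K \<and> topspace (topol K) = carrier K \<and> smooth_manifold K \<and>
     continuous_map (prod_topology (topol K) (topol K)) (topol K) (\<lambda>(g, h). g \<otimes>\<^bsub>K\<^esub> h) \<and>
     continuous_map (topol K) (topol K) (\<lambda>g. inv\<^bsub>K\<^esub> g) \<and>
     (\<forall>a\<in>atlas K. \<forall>b\<in>atlas K. \<forall>c\<in>atlas K.
        smooth_map_on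
          {(x, y). x \<in> snd a ` fst a \<and> y \<in> snd b ` fst b \<and>
                   chart_inv a x \<otimes>\<^bsub>K\<^esub> chart_inv b y \<in> fst c}
          (\<lambda>(x, y). snd c (chart_inv a x \<otimes>\<^bsub>K\<^esub> chart_inv b y))) \<and>
     (\<forall>a\<in>atlas K. \<forall>b\<in>atlas K.
        smooth_map_on
          {x \<in> snd a ` fst a. inv\<^bsub>K\<^esub> (chart_inv a x) \<in> fst b}
          (\<lambda>x. snd b (inv\<^bsub>K\<^esub> (chart_inv a x))))"

definition compact_connected_lie_group :: "('g, 'e::euclidean_space) lie_data \<Rightarrow> bool" where
  "compact_connected_lie_group K \<longleftrightarrow>
     lie_group K \<and> compact_space (topol K) \<and> connected_space (topol K)"


section \<open>Lie algebra, adjoint action, maximal tori\<close>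

text \<open>A chart \<open>c\<close> around the identity identifies \<open>Lie(K)\<close>, the tangent space at the identity,
  with \<open>model K\<close>.\<close>

definition chart_at_one :: "('g, 'e) lie_data \<Rightarrow> 'g set \<times> ('g \<Rightarrow> 'e) \<Rightarrow> bool" where
  "chart_at_one K c \<longleftrightarrow> c \<in> atlas K \<and> \<one>\<^bsub>K\<^esub> \<in> fst c"

text \<open>The differential at the identity of conjugation by \<open>g\<close>, applied to \<open>v\<close>.\<close>

definition Ad ::
  "('g, 'e::euclidean_space) lie_data \<Rightarrow> 'g set \<times> ('g \<Rightarrow> 'e) \<Rightarrow> 'g \<Rightarrow> 'e \<Rightarrow> 'e" where
  "Ad K c g v =
     vector_derivative
       (\<lambda>s. snd c (g \<otimes>\<^bsub>K\<^esub> chart_inv c (snd c \<one>\<^bsub>K\<^esub> + s *\<^sub>R v) \<otimes>\<^bsub>K\<^esub> inv\<^bsub>K\<^esub> g)) (at 0)"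

definition one_parameter_subgroup ::
  "('g, 'e::euclidean_space) lie_data \<Rightarrow> 'g set \<times> ('g \<Rightarrow> 'e) \<Rightarrow> 'e \<Rightarrow> (real \<Rightarrow> 'g) \<Rightarrow> bool" where
  "one_parameter_subgroup K c v \<gamma> \<longleftrightarrow>
     continuous_map euclideanreal (topol K) \<gamma> \<and>
     (\<forall>s t. \<gamma> (s + t) = \<gamma> s \<otimes>\<^bsub>K\<^esub> \<gamma> t) \<and>
     ((\<lambda>s. snd c (\<gamma> s)) has_vector_derivative v) (at 0)"

definition lie_exp ::
  "('g, 'e::euclidean_space) lie_data \<Rightarrow> 'g set \<times> ('g \<Rightarrow> 'e) \<Rightarrow> 'e \<Rightarrow> 'g" where
  "lie_exp K c v = (THE \<gamma>. one_parameter_subgroup K c v \<gamma>) 1"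

text \<open>A torus in a compact Lie group is a compact connected abelian Lie subgroup. By Cartan's
  theorem a compact subgroup is automatically a Lie subgroup.\<close>

definition torus_in :: "('g, 'e) lie_data \<Rightarrow> 'g set \<Rightarrow> bool" where
  "torus_in K T \<longleftrightarrow>
     subgroup T K \<and> compactin (topol K) T \<and> connectedin (topol K) T \<and>
     (\<forall>s\<in>T. \<forall>t\<in>T. s \<otimes>\<^bsub>K\<^esub> t = t \<otimes>\<^bsub>K\<^esub> s)"

definition maximal_torus :: "('g, 'e) lie_data \<Rightarrow> 'g set \<Rightarrow> bool" where
  "maximal_torus K T \<longleftrightarrow> torus_in K T \<and> (\<forall>T'. torus_in K T' \<and> T \<subseteq> T' \<longrightarrow> T' = T)"

definition lie_subalgebra_of ::
  "('g, 'e::euclidean_space) lie_data \<Rightarrow> 'g set \<times> ('g \<Rightarrow> 'e) \<Rightarrow> 'g set \<Rightarrow> 'e set" where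
  "lie_subalgebra_of K c T = {v \<in> model K. \<forall>s. lie_exp K c (s *\<^sub>R v) \<in> T}"

definition invariant_inner_product ::
  "('g, 'e::euclidean_space) lie_data \<Rightarrow> 'g set \<times> ('g \<Rightarrow> 'e) \<Rightarrow> ('e \<Rightarrow> 'e \<Rightarrow> real) \<Rightarrow> bool" where
  "invariant_inner_product K c ip \<longleftrightarrow>
     (\<forall>x\<in>model K. \<forall>y\<in>model K. ip x y = ip y x) \<and>
     (\<forall>x\<in>model K. \<forall>y\<in>model K. \<forall>z\<in>model K. ip (x + y) z = ip x z + ip y z) \<and>
     (\<forall>r. \<forall>x\<in>model K. \<forall>y\<in>model K. ip (r *\<^sub>R x) y = r * ip x y) \<and>
     (\<forall>x\<in>model K. x \<noteq> 0 \<longrightarrow> ip x x > 0) \<and>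
     (\<forall>g\<in>carrier K. \<forall>x\<in>model K. \<forall>y\<in>model K. ip (Ad K c g x) (Ad K c g y) = ip x y)"

definition ip_norm :: "('e \<Rightarrow> 'e \<Rightarrow> real) \<Rightarrow> 'e \<Rightarrow> real" where
  "ip_norm ip x = sqrt (ip x x)"


section \<open>Roots\<close>

text \<open>The dual of \<open>Lie(K)\<close> is identified with \<open>Lie(K)\<close> by means of the invariant inner product
  \<open>ip\<close>. So the value of \<open>\<xi>\<close> at \<open>H\<close> is \<open>ip \<xi> H\<close>, the coadjoint action is \<open>Ad\<close>, and the dual of
  \<open>Lie(T)\<close> is embedded as the space of \<open>T\<close>-invariant elements.\<close>

definition torus_dual ::
  "('g, 'e::euclidean_space) lie_data \<Rightarrow> 'g set \<times> ('g \<Rightarrow> 'e) \<Rightarrow> 'g set \<Rightarrow> 'e set" where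
  "torus_dual K c T = {\<xi> \<in> model K. \<forall>t\<in>T. Ad K c t \<xi> = \<xi>}"

text \<open>The complexified Lie algebra consists of the pairs \<open>(X, Y)\<close>, standing for \<open>X + \<i> Y\<close>.\<close>

definition scaleC_pair :: "complex \<Rightarrow> 'e::real_vector \<times> 'e \<Rightarrow> 'e \<times> 'e" where
  "scaleC_pair z Z =
     (Re z *\<^sub>R fst Z - Im z *\<^sub>R snd Z, Im z *\<^sub>R fst Z + Re z *\<^sub>R snd Z)"

definition roots ::
  "('g, 'e::euclidean_space) lie_data \<Rightarrow> 'g set \<times> ('g \<Rightarrow> 'e) \<Rightarrow> 'g set \<Rightarrow>
   ('e \<Rightarrow> 'e \<Rightarrow> real) \<Rightarrow> 'e set" where
  "roots K c T ip =
     {\<alpha> \<in> torus_dual K c T. \<alpha> \<noteq> 0 \<and>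
        (\<exists>Z\<in>model K \<times> model K. Z \<noteq> 0 \<and>
           (\<forall>H\<in>lie_subalgebra_of K c T.
              map_prod (Ad K c (lie_exp K c H)) (Ad K c (lie_exp K c H)) Z =
                scaleC_pair (exp (\<i> * complex_of_real (ip \<alpha> H))) Z))}"

definition positive_system ::
  "('g, 'e::euclidean_space) lie_data \<Rightarrow> 'g set \<times> ('g \<Rightarrow> 'e) \<Rightarrow> 'g set \<Rightarrow>
   ('e \<Rightarrow> 'e \<Rightarrow> real) \<Rightarrow> 'e set \<Rightarrow> bool" where
  "positive_system K c T ip P \<longleftrightarrow>
     (\<exists>H\<in>lie_subalgebra_of K c T.
        (\<forall>\<alpha>\<in>roots K c T ip. ip \<alpha> H \<noteq> 0) \<and> P = {\<alpha> \<in> roots K c T ip. ip \<alpha> H > 0})"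

definition coroot :: "('e \<Rightarrow> 'e \<Rightarrow> real) \<Rightarrow> 'e::real_vector \<Rightarrow> 'e" where
  "coroot ip \<alpha> = (2 / ip \<alpha> \<alpha>) *\<^sub>R \<alpha>"

definition weyl_chamber ::
  "('g, 'e::euclidean_space) lie_data \<Rightarrow> 'g set \<times> ('g \<Rightarrow> 'e) \<Rightarrow> 'g set \<Rightarrow>
   ('e \<Rightarrow> 'e \<Rightarrow> real) \<Rightarrow> 'e set \<Rightarrow> 'e set" where
  "weyl_chamber K c T ip P = {\<xi> \<in> torus_dual K c T. \<forall>\<alpha>\<in>P. ip \<xi> (coroot ip \<alpha>) \<ge> 0}"

definition half_sum :: "'e::real_vector set \<Rightarrow> 'e" where
  "half_sum A = (1/2) *\<^sub>R (\<Sum>\<alpha>\<in>A. \<alpha>)"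

text \<open>The rho-element of the stabilizer of \<open>\<mu>\<close>, for the positive system induced by \<open>P\<close>.\<close>

definition rho_stabilizer :: "('e \<Rightarrow> 'e \<Rightarrow> real) \<Rightarrow> 'e::real_vector set \<Rightarrow> 'e \<Rightarrow> 'e" where
  "rho_stabilizer ip P \<mu> = half_sum {\<alpha> \<in> P. ip \<alpha> \<mu> = 0}"

text \<open>Here \<open>R\<close> is the full root system.\<close>

definition rho_at :: "('e \<Rightarrow> 'e \<Rightarrow> real) \<Rightarrow> 'e::real_vector set \<Rightarrow> 'e \<Rightarrow> 'e" where
  "rho_at ip R \<mu> = half_sum {\<alpha> \<in> R. ip \<alpha> \<mu> > 0}"

end

theory Submission
  imports Defs
begin

text \<open>Only two properties of the root system \<open>R\<close> matter: it is finite, and it is stable under the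
  reflections in its elements. Let \<open>\<beta>\<close> be a positive root orthogonal to \<open>\<mu>\<close>. The reflection in \<open>\<beta>\<close>
  preserves \<open>(\<gamma>, \<mu>)\<close> and sends positive roots \<open>\<gamma>\<close> with \<open>(\<gamma>, \<beta>) < 0\<close> to positive roots, so the sum of
  \<open>(\<gamma>, \<beta>)\<close> over the positive roots \<open>\<gamma>\<close> not orthogonal to \<open>\<mu>\<close> is nonnegative. Hence
  \<open>(\<lambda> - \<mu>, \<rho>') \<ge> (\<rho>', \<rho>')\<close>, where \<open>\<rho>'\<close> is the rho-element of the stabilizer of \<open>\<mu>\<close>, and the
  inequality is Cauchy-Schwarz. Equality forces \<open>\<lambda> - \<mu> = \<rho>'\<close>, and then the sum of the positive roots
  that are negative on \<open>\<mu>\<close> pairs nonnegatively with \<open>\<mu>\<close>, so there are none.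

  The reflection in a root \<open>\<alpha>\<close> is induced by \<open>Ad g\<close> for a \<open>g = exp X\<close> with \<open>X\<close> in the real root space.
  This needs one-parameter subgroups, which are obtained as limits of powers \<open>(v / 2^n)^(s 2^n)\<close> in a
  chart, the bracket as the derivative of \<open>Ad\<close>, and the fact that the centralizer of \<open>Lie(T)\<close> is
  \<open>Lie(T)\<close>, which comes from the maximality of \<open>T\<close> and \<open>T\<close> being generated by \<open>exp (Lie(T))\<close>.\<close>

section \<open>Finite sets stable under reflections\<close>

text \<open>Roots are defined through \<open>Ad\<close> and \<open>lie_exp\<close>, and
  \<open>lie_exp\<close> through a unique one-parameter subgroup, so even the reflections rest on
  the smoothness of multiplication in charts. The analysis draws on one estimate: in coordinates
  centred at the identity a product is x + y up to a multiple of norm x * norm y, also in difference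
  form. Iterated, it shows that k-th powers are Lipschitz with constant 3k as long as k steps stay
  small. This stability bound yields the convergence of dyadic powers, the uniqueness of
  one-parameter subgroups and the Lipschitz continuity of \<open>lie_exp\<close>.

  The centralizer statement serves one purpose. For a root vector X + iY the bracket of X and Y is
  visibly fixed by exp (Lie(T)), but it has to be fixed by all of T before the inner product can
  identify it as a multiple of \<alpha>. The bracket with X then preserves the plane spanned by
  \<alpha> and Y, where Ad (exp (s X)) is a rotation in suitably scaled coordinates, and a half turn
  reverses \<alpha>.\<close>

locale subspace_ip =
  fixes V :: "'e::real_vector set" and ip :: "'e \<Rightarrow> 'e \<Rightarrow> real"
  assumes subspace_V: "subspace V"
    and ip_sym: "\<And>x y. x \<in> V \<Longrightarrow> y \<in> V \<Longrightarrow> ip x y = ip y x"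
    and ip_add_left: "\<And>x y z. x \<in> V \<Longrightarrow> y \<in> V \<Longrightarrow> z \<in> V \<Longrightarrow> ip (x + y) z = ip x z + ip y z"
    and ip_scale_left: "\<And>r x y. x \<in> V \<Longrightarrow> y \<in> V \<Longrightarrow> ip (r *\<^sub>R x) y = r * ip x y"
    and ip_pos: "\<And>x. x \<in> V \<Longrightarrow> x \<noteq> 0 \<Longrightarrow> ip x x > 0"
begin

lemmas V_closed = subspace_0[OF subspace_V] subspace_add[OF subspace_V] subspace_scale[OF subspace_V]
  subspace_diff[OF subspace_V] subspace_neg[OF subspace_V]

lemma sum_in_V: "(\<And>a. a \<in> A \<Longrightarrow> f a \<in> V) \<Longrightarrow> sum f A \<in> V"
  by (rule subspace_sum[OF subspace_V])

lemma half_sum_in_V: "A \<subseteq> V \<Longrightarrow> half_sum A \<in> V"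
  unfolding half_sum_def by (intro V_closed sum_in_V) auto

lemma ip_add_right: "x \<in> V \<Longrightarrow> y \<in> V \<Longrightarrow> z \<in> V \<Longrightarrow> ip z (x + y) = ip z x + ip z y"
  by (metis ip_add_left ip_sym V_closed(2))

lemma ip_scale_right: "x \<in> V \<Longrightarrow> y \<in> V \<Longrightarrow> ip y (r *\<^sub>R x) = r * ip y x"
  by (metis ip_scale_left ip_sym V_closed(3))

lemma ip_zero_left [simp]: "y \<in> V \<Longrightarrow> ip 0 y = 0"
  using ip_scale_left[of 0 y 0] V_closed(1) by simp

lemma ip_minus_left: "x \<in> V \<Longrightarrow> y \<in> V \<Longrightarrow> ip (- x) y = - ip x y"
  using ip_scale_left[of x y "-1"] by simp

lemma ip_minus_right: "x \<in> V \<Longrightarrow> y \<in> V \<Longrightarrow> ip x (- y) = - ip x y"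
  using ip_scale_right[of y x "-1"] by simp

lemma ip_diff_left: "x \<in> V \<Longrightarrow> y \<in> V \<Longrightarrow> z \<in> V \<Longrightarrow> ip (x - y) z = ip x z - ip y z"
  using ip_add_left[of x "- y" z] ip_minus_left V_closed(5) by simp

lemma ip_diff_right: "x \<in> V \<Longrightarrow> y \<in> V \<Longrightarrow> z \<in> V \<Longrightarrow> ip z (x - y) = ip z x - ip z y"
  using ip_add_right[of x "- y" z] ip_minus_right V_closed(5) by simp

lemmas ip_bilinear = ip_add_left ip_add_right ip_scale_left ip_scale_right ip_minus_left
  ip_minus_right ip_diff_left ip_diff_right

lemma ip_sum_left: "(\<And>a. a \<in> A \<Longrightarrow> f a \<in> V) \<Longrightarrow> z \<in> V \<Longrightarrow> ip (sum f A) z = (\<Sum>a\<in>A. ip (f a) z)"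
  by (induction A rule: infinite_finite_induct) (auto simp: ip_add_left sum_in_V)

lemma ip_half_sum_left: "A \<subseteq> V \<Longrightarrow> z \<in> V \<Longrightarrow> 2 * ip (half_sum A) z = (\<Sum>a\<in>A. ip a z)"
  unfolding half_sum_def
  by (subst ip_scale_left; simp add: sum_in_V subset_iff) (subst ip_sum_left; auto)

lemma ip_half_sum_right: "A \<subseteq> V \<Longrightarrow> z \<in> V \<Longrightarrow> 2 * ip z (half_sum A) = (\<Sum>a\<in>A. ip z a)"
proof -
  assume *: "A \<subseteq> V" "z \<in> V"
  have "(\<Sum>a\<in>A. ip z a) = (\<Sum>a\<in>A. ip a z)"
    using * ip_sym by (intro sum.cong) auto
  then show ?thesis using ip_half_sum_left[OF *] ip_sym[OF half_sum_in_V[OF *(1)] *(2)] by simp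
qed

lemma ip_nonneg: "x \<in> V \<Longrightarrow> ip x x \<ge> 0"
  using ip_pos[of x] V_closed(1) by (cases "x = 0") auto

lemma ip_self_eq_0: "x \<in> V \<Longrightarrow> ip x x = 0 \<longleftrightarrow> x = 0"
  using ip_pos[of x] V_closed(1) by (cases "x = 0") auto

text \<open>Pairing a vanishing combination with one of its members isolates that coefficient. It
  bounds the number of roots, since root vectors of different roots are orthogonal.\<close>

lemma independent_if_orthogonal:
  assumes S: "S \<subseteq> V" "0 \<notin> S" and orth: "\<And>x y. x \<in> S \<Longrightarrow> y \<in> S \<Longrightarrow> x \<noteq> y \<Longrightarrow> ip x y = 0"
  shows "independent S"
  unfolding dependent_explicit
proof clarify
  fix t u v assume t: "finite t" "t \<subseteq> S" and sum0: "(\<Sum>v\<in>t. u v *\<^sub>R v) = 0" and v: "v \<in> t" "u v \<noteq> (0::real)"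
  have vS: "v \<in> S" "v \<in> V" "v \<noteq> 0" using t v S by auto
  have "0 = ip (\<Sum>w\<in>t. u w *\<^sub>R w) v" unfolding sum0 using vS by simp
  also have "\<dots> = (\<Sum>w\<in>t. ip (u w *\<^sub>R w) v)"
    by (rule ip_sum_left) (use t S vS V_closed in auto)
  also have "\<dots> = (\<Sum>w\<in>t. if w = v then u v * ip v v else 0)"
  proof (rule sum.cong[OF refl])
    fix w assume "w \<in> t"
    then have "w \<in> S" "w \<in> V" using t S by auto
    then show "ip (u w *\<^sub>R w) v = (if w = v then u v * ip v v else 0)"
      using orth[OF _ vS(1), of w] vS by (simp add: ip_scale_left)
  qed
  also have "\<dots> = u v * ip v v" using t v by (simp add: sum.delta)
  finally show False using v ip_pos[OF vS(2,3)] by simp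
qed

definition reflect :: "'e \<Rightarrow> 'e \<Rightarrow> 'e" where
  "reflect \<beta> \<gamma> = \<gamma> - (2 * ip \<gamma> \<beta> / ip \<beta> \<beta>) *\<^sub>R \<beta>"

lemma ip_reflect_self:
  assumes "\<beta> \<in> V" "\<gamma> \<in> V" "\<beta> \<noteq> 0"
  shows "ip (reflect \<beta> \<gamma>) \<beta> = - ip \<gamma> \<beta>"
  using assms ip_pos[of \<beta>] by (simp add: reflect_def ip_bilinear V_closed)

lemma reflect_reflect:
  assumes "\<beta> \<in> V" "\<gamma> \<in> V" "\<beta> \<noteq> 0"
  shows "reflect \<beta> (reflect \<beta> \<gamma>) = \<gamma>"
  using ip_reflect_self[OF assms] unfolding reflect_def[of \<beta> "reflect \<beta> \<gamma>"]
  by (simp add: reflect_def)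

lemma ip_reflect_adjoint:
  assumes "\<beta> \<in> V" "\<gamma> \<in> V" "\<delta> \<in> V"
  shows "ip (reflect \<beta> \<gamma>) \<delta> = ip \<gamma> (reflect \<beta> \<delta>)"
  using assms ip_sym[of \<beta> \<delta>] by (simp add: reflect_def ip_bilinear V_closed)

text \<open>The reflection in \<open>\<beta>\<close> pairs the negative terms of the sum with some of the positive ones.\<close>

lemma sum_ip_nonneg:
  assumes A: "finite A" "A \<subseteq> V" and \<beta>: "\<beta> \<in> V" "\<beta> \<noteq> 0"
    and refl: "\<And>\<gamma>. \<gamma> \<in> A \<Longrightarrow> ip \<gamma> \<beta> < 0 \<Longrightarrow> reflect \<beta> \<gamma> \<in> A"
  shows "(\<Sum>\<gamma>\<in>A. ip \<gamma> \<beta>) \<ge> 0"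
proof -
  define N where "N = {\<gamma>\<in>A. ip \<gamma> \<beta> < 0}"
  have N: "finite N" "N \<subseteq> V" using A by (auto simp: N_def)
  have inj: "inj_on (reflect \<beta>) N"
    by (rule inj_on_inverseI[where g = "reflect \<beta>"]) (use N \<beta> reflect_reflect in auto)
  have sub: "reflect \<beta> ` N \<subseteq> A - N"
    using refl N \<beta> by (force simp: N_def ip_reflect_self)
  have "- (\<Sum>\<gamma>\<in>N. ip \<gamma> \<beta>) = (\<Sum>\<gamma>\<in>N. ip (reflect \<beta> \<gamma>) \<beta>)"
    using N \<beta> by (subst sum_negf[symmetric], intro sum.cong) (auto simp: ip_reflect_self)
  also have "\<dots> = (\<Sum>\<gamma>\<in>reflect \<beta> ` N. ip \<gamma> \<beta>)"
    by (simp add: sum.reindex[OF inj])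
  also have "\<dots> \<le> (\<Sum>\<gamma>\<in>A - N. ip \<gamma> \<beta>)"
    using A sub by (intro sum_mono2) (auto simp: N_def)
  finally show ?thesis
    using sum.subset_diff[of N A "\<lambda>\<gamma>. ip \<gamma> \<beta>"] A by (auto simp: N_def)
qed

end

section \<open>Positive systems of a finite reflection-stable set, and the norm inequality\<close>

locale reflection_system = subspace_ip V ip
  for V :: "'e::real_vector set" and ip :: "'e \<Rightarrow> 'e \<Rightarrow> real" +
  fixes R P :: "'e set" and h :: 'e
  assumes finite_R: "finite R" and R_sub: "R \<subseteq> V" and zero_notin_R: "0 \<notin> R"
    and reflect_R: "\<And>\<beta> \<gamma>. \<beta> \<in> R \<Longrightarrow> \<gamma> \<in> R \<Longrightarrow> reflect \<beta> \<gamma> \<in> R"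
    and h_in_V: "h \<in> V" and regular: "\<And>\<beta>. \<beta> \<in> R \<Longrightarrow> ip \<beta> h \<noteq> 0"
    and P_eq: "P = {\<beta> \<in> R. ip \<beta> h > 0}"
begin

lemma R_V: "\<beta> \<in> R \<Longrightarrow> \<beta> \<in> V" using R_sub by auto

lemma P_R: "\<beta> \<in> P \<Longrightarrow> \<beta> \<in> R" by (simp add: P_eq)

lemma P_V: "\<beta> \<in> P \<Longrightarrow> \<beta> \<in> V" by (simp add: P_R R_V)

lemma P_nonzero: "\<beta> \<in> P \<Longrightarrow> \<beta> \<noteq> 0" using P_R zero_notin_R by blast

lemma finite_P: "finite P" using finite_R by (simp add: P_eq)

lemma uminus_R: assumes "\<beta> \<in> R" shows "- \<beta> \<in> R"
proof -
  have "\<beta> \<noteq> 0" using assms zero_notin_R by auto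
  then have "reflect \<beta> \<beta> = - \<beta>"
    using ip_pos[of \<beta>] R_V[OF assms] by (simp add: reflect_def scaleR_2)
  then show ?thesis using reflect_R[OF assms assms] by simp
qed

lemma R_cases: "\<beta> \<in> R \<Longrightarrow> \<beta> \<in> P \<or> - \<beta> \<in> P"
  using regular[of \<beta>] by (auto simp: P_eq uminus_R ip_minus_left R_V h_in_V not_less)

lemma uminus_notin_P: "\<beta> \<in> P \<Longrightarrow> - \<beta> \<notin> P"
  by (auto simp: P_eq ip_minus_left R_V h_in_V)

text \<open>The reflection adds a nonnegative multiple of \<beta> when the pairing is negative, so
  the value on \<open>h\<close> can only grow. As \<beta> need not be simple, the sign condition is
  essential: \<beta> itself is sent to its negative.\<close>

lemma reflect_P:
  assumes "\<beta> \<in> P" "\<gamma> \<in> P" "ip \<gamma> \<beta> < 0"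
  shows "reflect \<beta> \<gamma> \<in> P"
proof -
  have "ip (reflect \<beta> \<gamma>) h = ip \<gamma> h - 2 * ip \<gamma> \<beta> / ip \<beta> \<beta> * ip \<beta> h"
    using assms by (simp add: reflect_def ip_bilinear V_closed P_V h_in_V)
  moreover have "2 * ip \<gamma> \<beta> / ip \<beta> \<beta> * ip \<beta> h \<le> 0"
    using assms ip_pos[of \<beta>] P_V[of \<beta>] P_nonzero[of \<beta>]
    by (auto simp: P_eq mult_le_0_iff divide_le_0_iff)
  moreover have "ip \<gamma> h > 0" using assms(2) by (simp add: P_eq)
  ultimately have "ip (reflect \<beta> \<gamma>) h > 0" by linarith
  then show ?thesis using reflect_R[OF P_R P_R, OF assms(1,2)] by (simp add: P_eq)
qed

text \<open>A reflection in a vector orthogonal to \<mu> preserves the pairing with \<mu>, so every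
  condition \<open>Q\<close> on that value cuts out a set to which \<open>sum_ip_nonneg\<close>
  applies. It is used with \<open>Q\<close> meaning positive and with \<open>Q\<close> meaning
  negative.\<close>

lemma sum_ip_orthogonal_nonneg:
  assumes "\<beta> \<in> P" "\<mu> \<in> V" "ip \<beta> \<mu> = 0"
  shows "(\<Sum>\<gamma>\<in>{\<gamma>\<in>P. Q (ip \<gamma> \<mu>)}. ip \<gamma> \<beta>) \<ge> 0"
proof (rule sum_ip_nonneg)
  fix \<gamma> assume \<gamma>: "\<gamma> \<in> {\<gamma>\<in>P. Q (ip \<gamma> \<mu>)}" "ip \<gamma> \<beta> < 0"
  have "ip (reflect \<beta> \<gamma>) \<mu> = ip \<gamma> \<mu>"
    using \<gamma> assms by (simp add: reflect_def ip_bilinear V_closed P_V)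
  then show "reflect \<beta> \<gamma> \<in> {\<gamma>\<in>P. Q (ip \<gamma> \<mu>)}" using \<gamma> assms reflect_P by auto
qed (use finite_P P_V P_nonzero assms in auto)

text \<open>Applied to all of \<open>P\<close>, \<open>sum_ip_nonneg\<close> would only give a weak
  inequality. Removing \<beta> keeps the hypothesis intact, because only the negative of \<beta> is
  reflected to \<beta> and it is not in \<open>P\<close>; the removed term, the square of the norm
  of \<beta>, makes the inequality strict.\<close>

lemma ip_half_sum_P_pos:
  assumes "\<beta> \<in> P"
  shows "ip (half_sum P) \<beta> > 0"
proof -
  have "(\<Sum>\<gamma>\<in>P - {\<beta>}. ip \<gamma> \<beta>) \<ge> 0"
  proof (rule sum_ip_nonneg)
    fix \<gamma> assume \<gamma>: "\<gamma> \<in> P - {\<beta>}" "ip \<gamma> \<beta> < 0"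
    have "reflect \<beta> \<gamma> \<noteq> \<beta>"
    proof
      assume eq: "reflect \<beta> \<gamma> = \<beta>"
      have "\<gamma> = reflect \<beta> \<beta>"
        using reflect_reflect[of \<beta> \<gamma>] eq \<gamma> assms P_V P_nonzero by auto
      also have "\<dots> = - \<beta>"
        using ip_pos[of \<beta>] P_V[of \<beta>] P_nonzero assms by (simp add: reflect_def scaleR_2)
      finally show False using uminus_notin_P[OF assms] \<gamma> by auto
    qed
    then show "reflect \<beta> \<gamma> \<in> P - {\<beta>}" using reflect_P assms \<gamma> by auto
  qed (use finite_P P_V P_nonzero assms in auto)
  then have "(\<Sum>\<gamma>\<in>P. ip \<gamma> \<beta>) \<ge> ip \<beta> \<beta>"
    using sum.remove[OF finite_P assms, of "\<lambda>\<gamma>. ip \<gamma> \<beta>"] by simp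
  moreover have "ip \<beta> \<beta> > 0" using ip_pos P_V P_nonzero assms by auto
  ultimately show ?thesis
    using ip_half_sum_left[of P \<beta>] P_V assms subsetI[of P V] by auto
qed

lemma half_sum_diff:
  assumes "A \<subseteq> B" "finite B"
  shows "half_sum B - half_sum A = half_sum (B - A)"
  using sum_diff[of B A "\<lambda>x. x"] assms by (simp add: half_sum_def scaleR_diff_right)

text \<open>A root that is positive on a dominant \<mu> cannot have its negative in
  \<open>P\<close>, so the roots counted on the left are the positive roots outside the
  stabilizer.\<close>

lemma rho_at_dominant:
  assumes "\<mu> \<in> V" "\<And>\<beta>. \<beta> \<in> P \<Longrightarrow> ip \<mu> \<beta> \<ge> 0"
  shows "rho_at ip R \<mu> = half_sum P - rho_stabilizer ip P \<mu>"
proof -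
  have "{\<beta> \<in> R. ip \<beta> \<mu> > 0} = P - {\<beta> \<in> P. ip \<beta> \<mu> = 0}"
  proof (intro equalityI subsetI)
    fix \<beta> assume \<beta>: "\<beta> \<in> {\<beta> \<in> R. ip \<beta> \<mu> > 0}"
    have "- \<beta> \<notin> P"
      using \<beta> assms(2)[of "- \<beta>"] ip_sym[of \<beta> \<mu>] by (auto simp: ip_minus_right R_V assms)
    then show "\<beta> \<in> P - {\<beta> \<in> P. ip \<beta> \<mu> = 0}" using \<beta> R_cases by auto
  next
    fix \<beta> assume \<beta>: "\<beta> \<in> P - {\<beta> \<in> P. ip \<beta> \<mu> = 0}"
    then have "ip \<beta> \<mu> \<ge> 0" using assms ip_sym[of \<beta> \<mu>] P_V by auto
    then show "\<beta> \<in> {\<beta> \<in> R. ip \<beta> \<mu> > 0}" using \<beta> P_R by auto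
  qed
  then show ?thesis
    unfolding rho_at_def rho_stabilizer_def by (subst half_sum_diff) (auto simp: finite_P)
qed

text \<open>Cauchy-Schwarz takes the form of an identity. With \<open>d = \<nu> - \<mu>\<close> and
  \<open>r\<close> the rho-element of the stabilizer, orthogonality of \<mu> and \<open>r\<close>
  shows that \<open>ip d d - ip r r\<close> is the squared norm of \<open>d - r\<close> plus twice
  the sum of the pairings of \<open>r\<close> with \<xi>, \<open>half_sum pos\<close> and
  \<open>half_sum neg\<close>. All these terms are nonnegative, so in the equality case each of them
  vanishes.\<close>

theorem norm_shifted_dominant_ge:
  assumes \<xi>: "\<xi> \<in> V" "\<And>\<beta>. \<beta> \<in> P \<Longrightarrow> ip \<xi> \<beta> \<ge> 0"
    and \<mu>: "\<mu> \<in> V" and nu: "\<nu> = half_sum P + \<xi>"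
  shows "ip_norm ip (\<nu> - \<mu>) \<ge> ip_norm ip (rho_stabilizer ip P \<mu>)"
    and "ip_norm ip (\<nu> - \<mu>) = ip_norm ip (rho_stabilizer ip P \<mu>) \<longleftrightarrow>
       (\<forall>\<beta>\<in>P. ip \<mu> \<beta> \<ge> 0) \<and> \<nu> - rho_at ip R \<nu> = \<mu> - rho_at ip R \<mu>"
proof -
  define \<Phi> where "\<Phi> = {\<beta> \<in> P. ip \<beta> \<mu> = 0}"
  define r where "r = half_sum \<Phi>"
  define d where "d = \<nu> - \<mu>"
  define pos where "pos = {\<beta> \<in> P. ip \<beta> \<mu> > 0}"
  define neg where "neg = {\<beta> \<in> P. ip \<beta> \<mu> < 0}"
  have subs: "\<Phi> \<subseteq> V" "pos \<subseteq> V" "neg \<subseteq> V" "P \<subseteq> V" "finite \<Phi>" "finite pos" "finite neg"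
    using P_V finite_P by (auto simp: \<Phi>_def pos_def neg_def)
  have r_eq: "rho_stabilizer ip P \<mu> = r" by (simp add: r_def \<Phi>_def rho_stabilizer_def)
  have rho: "half_sum P = r + half_sum pos + half_sum neg"
  proof -
    have "P = \<Phi> \<union> (pos \<union> neg)" by (auto simp: \<Phi>_def pos_def neg_def)
    moreover have "\<Phi> \<inter> (pos \<union> neg) = {}" "pos \<inter> neg = {}" by (auto simp: \<Phi>_def pos_def neg_def)
    ultimately have "(\<Sum>\<alpha>\<in>P. \<alpha>) = \<Sum>\<Phi> + (\<Sum>pos + \<Sum>neg)"
      using subs by (simp add: sum.union_disjoint)
    then show ?thesis by (simp add: half_sum_def r_def scaleR_add_right)
  qed
  have inV: "r \<in> V" "half_sum pos \<in> V" "half_sum neg \<in> V" "half_sum P \<in> V" "\<nu> \<in> V" "d \<in> V"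
    using subs half_sum_in_V \<xi> \<mu> by (auto simp: r_def nu d_def intro!: V_closed)
  have ip_r: "ip x r \<ge> 0" if "x \<in> V" "\<And>\<beta>. \<beta> \<in> \<Phi> \<Longrightarrow> ip x \<beta> \<ge> 0" for x
    using ip_half_sum_right[of \<Phi> x] that subs sum_nonneg[of \<Phi> "ip x"] by (auto simp: r_def)
  have pos_r: "ip (half_sum pos) r \<ge> 0"
  proof (rule ip_r)
    fix \<beta> assume "\<beta> \<in> \<Phi>"
    then have "\<beta> \<in> P" "ip \<beta> \<mu> = 0" by (auto simp: \<Phi>_def)
    then have "(\<Sum>\<gamma>\<in>pos. ip \<gamma> \<beta>) \<ge> 0"
      using sum_ip_orthogonal_nonneg[OF _ \<mu>, of \<beta> "\<lambda>x. x > 0"] by (simp add: pos_def)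
    then show "ip (half_sum pos) \<beta> \<ge> 0"
      using ip_half_sum_left[OF subs(2) P_V[OF \<open>\<beta> \<in> P\<close>]] by simp
  qed (use inV in simp)
  have neg_r: "ip (half_sum neg) r \<ge> 0"
  proof (rule ip_r)
    fix \<beta> assume "\<beta> \<in> \<Phi>"
    then have "\<beta> \<in> P" "ip \<beta> \<mu> = 0" by (auto simp: \<Phi>_def)
    then have "(\<Sum>\<gamma>\<in>neg. ip \<gamma> \<beta>) \<ge> 0"
      using sum_ip_orthogonal_nonneg[OF _ \<mu>, of \<beta> "\<lambda>x. x < 0"] by (simp add: neg_def)
    then show "ip (half_sum neg) \<beta> \<ge> 0"
      using ip_half_sum_left[OF subs(3) P_V[OF \<open>\<beta> \<in> P\<close>]] by simp
  qed (use inV in simp)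
  have \<xi>_r: "ip \<xi> r \<ge> 0"
    using \<xi> by (intro ip_r) (auto simp: \<Phi>_def)
  have \<mu>_r: "ip \<mu> r = 0"
  proof -
    have "ip \<mu> \<beta> = 0" if "\<beta> \<in> \<Phi>" for \<beta>
      using that ip_sym[of \<beta> \<mu>] \<mu> P_V by (auto simp: \<Phi>_def)
    then show ?thesis
      using ip_half_sum_right[of \<Phi> \<mu>] subs \<mu> by (auto simp: r_def)
  qed
  have d_r: "ip d r = ip \<xi> r + ip r r + ip (half_sum pos) r + ip (half_sum neg) r"
    using inV \<xi> \<mu> \<mu>_r by (simp add: d_def nu rho ip_bilinear V_closed)
  have expand: "ip (d - r) (d - r) = ip d d - 2 * ip d r + ip r r"
    using inV ip_sym[of d r] by (simp add: ip_bilinear V_closed)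
  have sq: "ip d d \<ge> ip r r"
    using expand ip_nonneg[of "d - r"] inV d_r pos_r neg_r \<xi>_r V_closed by fastforce
  then show "ip_norm ip (\<nu> - \<mu>) \<ge> ip_norm ip (rho_stabilizer ip P \<mu>)"
    by (simp add: r_eq d_def ip_norm_def)
  have \<nu>_pos: "ip \<nu> \<beta> > 0" if "\<beta> \<in> P" for \<beta>
    using ip_half_sum_P_pos[OF that] \<xi> P_V[OF that] that inV by (simp add: nu ip_bilinear add_pos_nonneg)
  \<comment> \<open>\<nu> is strictly dominant, hence no root is orthogonal to it and its stabilizer
    contributes nothing.\<close>
  have \<nu>_rho: "rho_at ip R \<nu> = half_sum P"
  proof -
    have "{\<beta> \<in> P. ip \<beta> \<nu> = 0} = {}"
      using \<nu>_pos ip_sym[OF _ inV(5)] P_V by fastforce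
    then have "rho_stabilizer ip P \<nu> = 0"
      unfolding rho_stabilizer_def by (simp only:) (simp add: half_sum_def)
    moreover have "rho_at ip R \<nu> = half_sum P - rho_stabilizer ip P \<nu>"
      using \<nu>_pos inV by (intro rho_at_dominant) (auto simp: less_imp_le)
    ultimately show ?thesis by simp
  qed
  have "ip d d = ip r r \<longleftrightarrow>
       (\<forall>\<beta>\<in>P. ip \<mu> \<beta> \<ge> 0) \<and> \<nu> - rho_at ip R \<nu> = \<mu> - rho_at ip R \<mu>"
  proof
    assume eq: "ip d d = ip r r"
    have "ip (d - r) (d - r) = 0"
      using expand eq ip_nonneg[of "d - r"] inV d_r pos_r neg_r \<xi>_r V_closed by fastforce
    then have d_eq: "d = r" using ip_self_eq_0[of "d - r"] inV V_closed by auto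
    then have zero: "ip (half_sum neg) r = 0"
      using d_r pos_r neg_r \<xi>_r by simp
    \<comment> \<open>In the pairing of \<open>\<mu> = \<xi> + half_sum P - r\<close> with
      \<open>half_sum neg\<close>, the fact \<open>zero\<close> removes the only term that could be
      negative.\<close>
    have "neg = {}"
    proof (rule ccontr)
      assume ne: "neg \<noteq> {}"
      have "ip \<mu> (half_sum neg) = ip \<xi> (half_sum neg) + ip (half_sum P) (half_sum neg) - ip r (half_sum neg)"
      proof -
        have "\<mu> = \<xi> + half_sum P - r" using d_eq by (simp add: d_def nu algebra_simps)
        then show ?thesis using inV \<xi> by (simp add: ip_bilinear V_closed)
      qed
      moreover have "2 * ip \<xi> (half_sum neg) \<ge> 0"
        using \<xi> subs by (subst ip_half_sum_right) (auto simp: neg_def intro!: sum_nonneg)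
      moreover have "2 * ip (half_sum P) (half_sum neg) \<ge> 0"
        using ip_half_sum_P_pos subs inV
        by (subst ip_half_sum_right) (auto simp: neg_def less_imp_le intro!: sum_nonneg)
      moreover have "2 * ip \<mu> (half_sum neg) < 0"
      proof -
        have "(\<Sum>\<beta>\<in>neg. ip \<mu> \<beta>) < (\<Sum>\<beta>\<in>neg. 0)"
          using ne subs ip_sym[OF _ \<mu>] by (intro sum_strict_mono) (auto simp: neg_def subset_iff P_V)
        then show ?thesis using subs \<mu> by (simp add: ip_half_sum_right)
      qed
      ultimately show False using zero ip_sym[of r "half_sum neg"] inV by simp
    qed
    then have dom: "\<forall>\<beta>\<in>P. ip \<mu> \<beta> \<ge> 0"
      using ip_sym[OF _ \<mu>] P_V by (fastforce simp: neg_def)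
    then have "rho_at ip R \<mu> = half_sum P - r"
      using rho_at_dominant \<mu> r_eq by simp
    then show "(\<forall>\<beta>\<in>P. ip \<mu> \<beta> \<ge> 0) \<and> \<nu> - rho_at ip R \<nu> = \<mu> - rho_at ip R \<mu>"
      using dom d_eq unfolding \<nu>_rho by (simp add: d_def algebra_simps)
  next
    assume *: "(\<forall>\<beta>\<in>P. ip \<mu> \<beta> \<ge> 0) \<and> \<nu> - rho_at ip R \<nu> = \<mu> - rho_at ip R \<mu>"
    then have "rho_at ip R \<mu> = half_sum P - r"
      using rho_at_dominant \<mu> r_eq by simp
    moreover have "\<nu> - half_sum P = \<mu> - rho_at ip R \<mu>" using * \<nu>_rho by simp
    ultimately have "\<nu> - half_sum P = \<mu> - (half_sum P - r)" by simp
    then have "d = r" by (simp add: d_def algebra_simps)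
    then show "ip d d = ip r r" by simp
  qed
  then show "ip_norm ip (\<nu> - \<mu>) = ip_norm ip (rho_stabilizer ip P \<mu>) \<longleftrightarrow>
       (\<forall>\<beta>\<in>P. ip \<mu> \<beta> \<ge> 0) \<and> \<nu> - rho_at ip R \<nu> = \<mu> - rho_at ip R \<mu>"
    using ip_nonneg inV by (simp add: r_eq d_def ip_norm_def)
qed

end

section \<open>Differential calculus\<close>

lemma norm_linear_le_Basis:
  fixes L :: "'a::euclidean_space \<Rightarrow> 'b::real_normed_vector"
  assumes "linear L" "\<And>w. w \<in> Basis \<Longrightarrow> norm (L w) \<le> b w"
  shows "norm (L x) \<le> (\<Sum>w\<in>Basis. b w) * norm x"
proof -
  have "L x = (\<Sum>w\<in>Basis. (x \<bullet> w) *\<^sub>R L w)"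
    using assms(1) by (metis (no_types, lifting) euclidean_representation linear_scale linear_sum sum.cong)
  also have "norm \<dots> \<le> (\<Sum>w\<in>Basis. norm ((x \<bullet> w) *\<^sub>R L w))" by (rule norm_sum)
  also have "\<dots> \<le> (\<Sum>w\<in>Basis. norm x * b w)"
    by (intro sum_mono) (auto intro!: mult_mono assms Basis_le_norm)
  finally show ?thesis by (simp add: sum_distrib_left mult.commute)
qed

text \<open>For a fixed direction \<open>v\<close> the map z to D z v has continuous partial
  derivatives, bounded on the compact ball by a constant that depends on \<open>v\<close>. Linearity
  in \<open>v\<close> and a finite basis turn these into one constant.\<close>

lemma Ck_on_2_lipschitz_derivative:
  fixes F :: "'a::euclidean_space \<Rightarrow> 'b::euclidean_space"
  assumes F: "Ck_on 2 F U" and U: "open U" "cball p r \<subseteq> U"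
  obtains B where "B \<ge> 0"
    "\<And>z z' v. z \<in> cball p r \<Longrightarrow> z' \<in> cball p r \<Longrightarrow>
      norm (frechet_derivative F (at z) v - frechet_derivative F (at z') v) \<le> B * norm (z - z') * norm v"
proof -
  define D where "D z = frechet_derivative F (at z)" for z
  define G where "G v z = frechet_derivative (\<lambda>z. D z v) (at z)" for v z
  have C1: "Ck_on (Suc 0) (\<lambda>z. D z v) U" for v
    using F by (simp add: numeral_2_eq_2 D_def)
  have G: "((\<lambda>z. D z v) has_derivative G v z) (at z)" if "z \<in> U" for v z
    using C1[of v] that U unfolding G_def
    by (auto simp: differentiable_on_eq_differentiable_at frechet_derivative_works)
  have linD: "linear (D z)" if "z \<in> U" for z
    using F U that unfolding D_def
    by (auto simp: numeral_2_eq_2 differentiable_on_eq_differentiable_at linear_frechet_derivative)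
  have "\<exists>b. \<forall>z\<in>cball p r. norm (G v z w) \<le> b" for v w
  proof -
    have "continuous_on (cball p r) (\<lambda>z. G v z w)"
      using C1[of v] U unfolding G_def by (auto intro: continuous_on_subset)
    then have "bounded ((\<lambda>z. G v z w) ` cball p r)"
      by (intro compact_imp_bounded compact_continuous_image) auto
    then show ?thesis by (auto simp: bounded_iff)
  qed
  then obtain b where b: "\<And>v w z. z \<in> cball p r \<Longrightarrow> norm (G v z w) \<le> b v w" by metis
  have D_lip: "norm (D z v - D z' v) \<le> (\<Sum>w\<in>Basis. b v w) * norm (z - z')"
    if z: "z \<in> cball p r" "z' \<in> cball p r" for v z z'
  proof (rule differentiable_bound[OF convex_cball[of p r] _ _ z])
    fix y assume y: "y \<in> cball p r"
    then have yU: "y \<in> U" using U by auto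
    show "((\<lambda>z. D z v) has_derivative G v y) (at y within cball p r)"
      using G[OF yU] has_derivative_at_withinI by blast
    show "onorm (G v y) \<le> (\<Sum>w\<in>Basis. b v w)"
      using G[OF yU] by (intro onorm_le norm_linear_le_Basis b[OF y]) (rule has_derivative_linear)
  qed
  define B where "B = \<bar>\<Sum>v\<in>Basis. \<Sum>w\<in>Basis. b v w\<bar>"
  show ?thesis
  proof
    fix z z' v assume z: "z \<in> cball p r" "z' \<in> cball p r"
    have "linear (\<lambda>v. D z v - D z' v)"
      using linD z U by (intro linear_compose_sub) auto
    then have "norm (D z v - D z' v) \<le> (\<Sum>v\<in>Basis. (\<Sum>w\<in>Basis. b v w) * norm (z - z')) * norm v"
      by (rule norm_linear_le_Basis) (use D_lip[OF z] in auto)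
    also have "\<dots> \<le> B * norm (z - z') * norm v"
      by (intro mult_right_mono) (auto simp: B_def sum_distrib_right[symmetric] intro!: mult_right_mono)
    finally show "norm (frechet_derivative F (at z) v - frechet_derivative F (at z') v) \<le> B * norm (z - z') * norm v"
      by (simp add: D_def)
  qed (simp add: B_def)
qed

text \<open>Collects the second-order consequences of smoothness used later. The Lipschitz bound on
  the derivative controls products near the identity; the differentiability of the derivative at the
  base point is what makes the bracket exist.\<close>

lemma smooth_map_onE:
  fixes f :: "'a::euclidean_space \<Rightarrow> 'b::euclidean_space"
  assumes "smooth_map_on S f" "p \<in> S"
  obtains r F D B where "r > 0" "B \<ge> 0"
    "\<And>z. z \<in> S \<Longrightarrow> dist p z \<le> r \<Longrightarrow> F z = f z"
    "\<And>z. dist p z \<le> r \<Longrightarrow> (F has_derivative D z) (at z)"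
    "\<And>z z' v. dist p z \<le> r \<Longrightarrow> dist p z' \<le> r \<Longrightarrow> norm (D z v - D z' v) \<le> B * norm (z - z') * norm v"
    "\<And>v. (\<lambda>z. D z v) differentiable (at p)"
proof -
  obtain U F where U: "open U" "p \<in> U" and F: "\<And>k. Ck_on k F U" "\<And>y. y \<in> U \<inter> S \<Longrightarrow> F y = f y"
    using assms unfolding smooth_map_on_def by metis
  obtain r where r: "r > 0" "cball p r \<subseteq> U"
    using U open_contains_cball by blast
  obtain B where B: "B \<ge> 0" "\<And>z z' v. z \<in> cball p r \<Longrightarrow> z' \<in> cball p r \<Longrightarrow>
      norm (frechet_derivative F (at z) v - frechet_derivative F (at z') v) \<le> B * norm (z - z') * norm v"
    using Ck_on_2_lipschitz_derivative[OF F(1) U(1) r(2)] by metis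
  have C2: "Ck_on (Suc (Suc 0)) F U" using F(1)[of 2] by (simp add: numeral_2_eq_2)
  show ?thesis
  proof (rule that[OF r(1) B(1), of F "\<lambda>z. frechet_derivative F (at z)"])
    show "F z = f z" if "z \<in> S" "dist p z \<le> r" for z using F(2) r that by auto
    show "(F has_derivative frechet_derivative F (at z)) (at z)" if "dist p z \<le> r" for z
      using C2 U r that
      by (auto simp: differentiable_on_eq_differentiable_at frechet_derivative_works[symmetric])
    show "(\<lambda>z. frechet_derivative F (at z) v) differentiable (at p)" for v
      using C2 U by (auto simp: differentiable_on_eq_differentiable_at)
  qed (use B in auto)
qed

lemma smooth_map_on_has_derivative:
  fixes f :: "'a::euclidean_space \<Rightarrow> 'b::euclidean_space"
  assumes "smooth_map_on S f" "p \<in> S"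
  obtains D where "(f has_derivative D) (at p within S)"
proof -
  obtain r F D where r: "r > 0" and F: "\<And>z. z \<in> S \<Longrightarrow> dist p z \<le> r \<Longrightarrow> F z = f z"
    "\<And>z. dist p z \<le> r \<Longrightarrow> (F has_derivative D z) (at z)"
    using smooth_map_onE[OF assms] by metis
  have "(F has_derivative D p) (at p within S)"
    using F(2)[of p] r by (auto intro: has_derivative_at_withinI)
  then have "(f has_derivative D p) (at p within S)"
    by (rule has_derivative_transform_within[OF _ r]) (use assms F(1) in \<open>auto simp: dist_commute\<close>)
  then show ?thesis by (rule that)
qed

lemma convergent_if_geometric:
  fixes y :: "nat \<Rightarrow> 'a::banach"
  assumes "\<And>n. n \<ge> N \<Longrightarrow> norm (y (Suc n) - y n) \<le> M * (1/2) ^ n"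
  shows "convergent y"
proof -
  have "summable (\<lambda>n. M * (1/2 :: real) ^ n)" by (intro summable_mult summable_geometric) simp
  then have "summable (\<lambda>n. y (Suc n) - y n)"
    by (rule summable_comparison_test'[where N = N]) (use assms in auto)
  then obtain l where "(\<lambda>n. \<Sum>i<n. y (Suc i) - y i) \<longlonglongrightarrow> l"
    unfolding summable_def sums_def by blast
  then have "(\<lambda>n. y n - y 0) \<longlonglongrightarrow> l" by (simp add: sum_lessThan_telescope)
  from tendsto_add[OF this tendsto_const[of "y 0"]] show ?thesis
    by (auto simp: convergent_def)
qed

lemma floor_mult_power2_bounds:
  fixes s :: real
  shows "\<lfloor>s * 2 ^ Suc n\<rfloor> = 2 * \<lfloor>s * 2 ^ n\<rfloor> \<or> \<lfloor>s * 2 ^ Suc n\<rfloor> = 2 * \<lfloor>s * 2 ^ n\<rfloor> + 1"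
proof -
  have e: "s * 2 ^ Suc n = 2 * (s * 2 ^ n)" by simp
  show ?thesis unfolding e by linarith
qed

text \<open>Maps that are controlled only on the model space become linear maps of the ambient space
  after composition with such a projection, and can then be differentiated through.\<close>

lemma linear_projection_exists:
  fixes S :: "'a::euclidean_space set"
  assumes "subspace S"
  obtains p where "bounded_linear p" "\<And>x. x \<in> S \<Longrightarrow> p x = x" "\<And>x. p x \<in> S"
proof -
  obtain B where B: "B \<subseteq> S" "independent B" "S \<subseteq> span B" using basis_exists[of S] by metis
  obtain p where p: "linear p" "\<forall>x\<in>B. p x = id x" "range p = span (id ` B)"
    using linear_independent_extend_subspace[OF B(2), of id] by metis
  have S: "span B = S" using B assms by (metis span_minimal subset_antisym)
  have "p x = x" if "x \<in> S" for x
    using linear_eq_on[OF p(1) linear_id, of x B] p(2) that S by auto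
  moreover have "p x \<in> S" for x using p(3) S by auto
  ultimately show ?thesis using that p(1) linear_conv_bounded_linear by blast
qed

text \<open>Projecting the curve to \<open>S\<close> changes nothing near \<open>t\<close>, so
  uniqueness of the derivative shows that \<open>v\<close> equals its own projection.\<close>

lemma derivative_in_subspace:
  fixes f :: "real \<Rightarrow> 'a::euclidean_space"
  assumes S: "subspace S" and f: "(f has_vector_derivative v) (at t)"
    and d: "d > 0" "\<And>s. \<bar>s - t\<bar> < d \<Longrightarrow> f s \<in> S"
  shows "v \<in> S"
proof -
  obtain p where p: "bounded_linear p" "\<And>x. x \<in> S \<Longrightarrow> p x = x" "\<And>x. p x \<in> S"
    using linear_projection_exists[OF S] by metis
  have "((\<lambda>s. p (f s)) has_vector_derivative p v) (at t)"
    using bounded_linear.has_vector_derivative[OF p(1) f] .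
  then have "(f has_vector_derivative p v) (at t)"
    by (rule has_vector_derivative_transform_within_open[where S = "ball t d"])
      (use d p in \<open>auto simp: dist_real_def abs_minus_commute\<close>)
  then have "v = p v" using f vector_derivative_unique_at by blast
  then show ?thesis using p(3) by metis
qed

lemma has_derivative_zero_quadratic:
  fixes f :: "'a::real_normed_vector \<Rightarrow> 'b::real_normed_vector"
  assumes "d > 0" and f: "\<And>x. x \<in> S \<Longrightarrow> norm x < d \<Longrightarrow> norm (f x) \<le> M * (norm x)\<^sup>2" and "0 \<in> S"
  shows "(f has_derivative (\<lambda>_. 0)) (at 0 within S)"
proof -
  have f0: "f 0 = 0" using f[of 0] assms by simp
  show ?thesis
    unfolding has_derivative_within
  proof (intro conjI)
    show "((\<lambda>y. (1 / norm (y - 0)) *\<^sub>R (f y - (f 0 + 0))) \<longlongrightarrow> 0) (at 0 within S)"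
    proof (rule Lim_null_comparison[where g = "\<lambda>y. M * norm y"])
      have "eventually (\<lambda>y. y \<in> S \<and> norm y < d) (at 0 within S)"
        using assms(1) by (auto simp: eventually_at intro!: exI[of _ d])
      then show "\<forall>\<^sub>F y in at 0 within S. norm ((1 / norm (y - 0)) *\<^sub>R (f y - (f 0 + 0))) \<le> M * norm y"
      proof eventually_elim
        case (elim y)
        have "norm (f y) / norm y \<le> M * (norm y)\<^sup>2 / norm y"
          using f[of y] elim by (intro divide_right_mono) auto
        also have "\<dots> = M * norm y" by (simp add: power2_eq_square)
        finally show ?case by (simp add: f0)
      qed
      show "((\<lambda>y. M * norm y) \<longlongrightarrow> 0) (at 0 within S)" by (auto intro!: tendsto_eq_intros)
    qed
  qed (rule bounded_linear_zero)
qed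

section \<open>The group near the identity\<close>

locale lie_chart =
  fixes K :: "('g, 'e::euclidean_space) lie_data" (structure)
    and c :: "'g set \<times> ('g \<Rightarrow> 'e)"
  assumes lie: "lie_group K" and chart: "chart_at_one K c"
begin

abbreviation "V \<equiv> model K"

sublocale group K using lie by (simp add: lie_group_def)

lemma topspace_eq: "topspace (topol K) = carrier K"
  and manifold: "smooth_manifold K"
  and mult_continuous: "continuous_map (prod_topology (topol K) (topol K)) (topol K) (\<lambda>(g, h). g \<otimes> h)"
  and inv_continuous: "continuous_map (topol K) (topol K) (\<lambda>g. inv g)"
  using lie by (simp_all add: lie_group_def)

lemma hausdorff: "Hausdorff_space (topol K)"
  and subspace_V: "subspace V"
  using manifold by (simp_all add: smooth_manifold_def)

lemmas V_0 = subspace_0[OF subspace_V] and V_add = subspace_add[OF subspace_V]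
  and V_scale = subspace_scale[OF subspace_V] and V_diff = subspace_diff[OF subspace_V]
  and V_neg = subspace_neg[OF subspace_V]

lemma c_atlas: "c \<in> atlas K" and one_in_chart: "\<one> \<in> fst c"
  using chart by (simp_all add: chart_at_one_def)

lemma atlasD:
  assumes "d \<in> atlas K"
  shows "openin (topol K) (fst d)" "openin (top_of_set V) (snd d ` fst d)"
    "homeomorphic_map (subtopology (topol K) (fst d)) (top_of_set (snd d ` fst d)) (snd d)"
  using manifold assms unfolding smooth_manifold_def by (auto simp: case_prod_beta)

lemma atlas_carrier: "d \<in> atlas K \<Longrightarrow> fst d \<subseteq> carrier K"
  using openin_subset[OF atlasD(1)] by (simp add: topspace_eq)

lemma atlas_inj: assumes "d \<in> atlas K" shows "inj_on (snd d) (fst d)"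
  using homeomorphic_imp_injective_map[OF atlasD(3)[OF assms]] atlas_carrier[OF assms]
  by (simp add: topspace_subtopology topspace_eq Int_absorb1)

lemma chart_inv_eq: "d \<in> atlas K \<Longrightarrow> g \<in> fst d \<Longrightarrow> chart_inv d (snd d g) = g"
  by (simp add: atlas_inj)

lemma chart_exists: assumes "g \<in> carrier K" obtains d where "d \<in> atlas K" "g \<in> fst d"
  using manifold assms unfolding smooth_manifold_def topspace_eq by blast

lemma chart_image_V: "d \<in> atlas K \<Longrightarrow> snd d ` fst d \<subseteq> V"
  using openin_imp_subset[OF atlasD(2)] .

text \<open>The chart translated so that the identity has coordinate 0, with \<open>psi\<close> as
  its inverse near 0. Despite its name, \<open>lg\<close> is in general not the inverse of
  \<open>lie_exp\<close>; the two agree to first order.\<close>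

definition lg :: "'g \<Rightarrow> 'e" where "lg g = snd c g - snd c \<one>"
definition psi :: "'e \<Rightarrow> 'g" where "psi x = chart_inv c (snd c \<one> + x)"

lemma base_V: "snd c \<one> \<in> V"
  using chart_image_V[OF c_atlas] one_in_chart by auto

lemma lg_V: "g \<in> fst c \<Longrightarrow> lg g \<in> V"
  unfolding lg_def using chart_image_V[OF c_atlas] base_V subspace_V by (auto intro!: subspace_diff)

lemma lg_one [simp]: "lg \<one> = 0" by (simp add: lg_def)

lemma psi_zero [simp]: "psi 0 = \<one>"
  by (simp add: psi_def chart_inv_eq c_atlas one_in_chart)

lemma psi_lg: "g \<in> fst c \<Longrightarrow> psi (lg g) = g"
  by (simp add: psi_def lg_def chart_inv_eq c_atlas)

lemma chart_radius_exists: "\<exists>r>0. \<forall>x\<in>V. norm x < r \<longrightarrow> snd c \<one> + x \<in> snd c ` fst c"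
proof -
  obtain r where r: "r > 0" "\<And>y. y \<in> V \<Longrightarrow> dist y (snd c \<one>) < r \<Longrightarrow> y \<in> snd c ` fst c"
    using atlasD(2)[OF c_atlas] one_in_chart unfolding openin_euclidean_subtopology_iff by blast
  show ?thesis
  proof (intro exI[of _ r] conjI ballI impI)
    fix x assume "x \<in> V" "norm x < r"
    then show "snd c \<one> + x \<in> snd c ` fst c"
      using r(2)[of "snd c \<one> + x"] base_V subspace_V by (auto simp: dist_norm intro: subspace_add)
  qed (use r in auto)
qed

definition rad where "rad = (SOME r. r > 0 \<and> (\<forall>x\<in>V. norm x < r \<longrightarrow> snd c \<one> + x \<in> snd c ` fst c))"

lemma rad_pos: "rad > 0" and rad_chart: "x \<in> V \<Longrightarrow> norm x < rad \<Longrightarrow> snd c \<one> + x \<in> snd c ` fst c"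
proof -
  have "rad > 0 \<and> (\<forall>x\<in>V. norm x < rad \<longrightarrow> snd c \<one> + x \<in> snd c ` fst c)"
    unfolding rad_def using chart_radius_exists by (rule someI_ex)
  then show "rad > 0" "x \<in> V \<Longrightarrow> norm x < rad \<Longrightarrow> snd c \<one> + x \<in> snd c ` fst c" by auto
qed

lemma psi_chart: "x \<in> V \<Longrightarrow> norm x < rad \<Longrightarrow> psi x \<in> fst c"
  unfolding psi_def using rad_chart inv_into_into by metis

lemma lg_psi: "x \<in> V \<Longrightarrow> norm x < rad \<Longrightarrow> lg (psi x) = x"
  using f_inv_into_f[OF rad_chart, of x] by (simp add: lg_def psi_def)

lemma chart_carrier: "g \<in> fst c \<Longrightarrow> g \<in> carrier K"
  using atlas_carrier[OF c_atlas] by auto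

lemma psi_carrier: "x \<in> V \<Longrightarrow> norm x < rad \<Longrightarrow> psi x \<in> carrier K"
  using psi_chart chart_carrier by blast

lemma lg_inj: "g \<in> fst c \<Longrightarrow> h \<in> fst c \<Longrightarrow> lg g = lg h \<Longrightarrow> g = h"
  using psi_lg by metis

lemma psi_continuous: "continuous_map (top_of_set (V \<inter> ball 0 rad)) (topol K) psi"
proof -
  have "homeomorphic_map (subtopology (topol K) (fst c)) (top_of_set (snd c ` fst c)) (snd c)"
    using atlasD(3)[OF c_atlas] .
  then obtain g where g: "homeomorphic_maps (subtopology (topol K) (fst c)) (top_of_set (snd c ` fst c)) (snd c) g"
    using homeomorphic_map_maps by blast
  have c1: "continuous_map (top_of_set (snd c ` fst c)) (topol K) g"
    using g by (auto simp: homeomorphic_maps_def continuous_map_in_subtopology)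
  have "continuous_map (top_of_set (V \<inter> ball 0 rad)) (top_of_set (snd c ` fst c)) ((+) (snd c \<one>))"
    using rad_chart by (auto simp: continuous_map_in_subtopology intro!: continuous_intros)
  from continuous_map_compose[OF this c1]
  have c2: "continuous_map (top_of_set (V \<inter> ball 0 rad)) (topol K) (g \<circ> (+) (snd c \<one>))" .
  show ?thesis
  proof (rule continuous_map_eq[OF c2])
    fix x assume "x \<in> topspace (top_of_set (V \<inter> ball 0 rad))"
    then have "snd c \<one> + x \<in> snd c ` fst c" using rad_chart by auto
    then obtain h where h: "h \<in> fst c" "snd c h = snd c \<one> + x" by (metis imageE)
    then have "g (snd c h) = h"
      using g chart_carrier[OF h(1)] unfolding homeomorphic_maps_def topspace_subtopology topspace_eq
      by blast
    moreover have "psi x = h" using h chart_inv_eq[OF c_atlas h(1)] by (simp add: psi_def)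
    ultimately show "(g \<circ> (+) (snd c \<one>)) x = psi x" using h by simp
  qed
qed

lemma psi_nbhd:
  assumes "openin (topol K) N" "\<one> \<in> N"
  obtains d where "d > 0" "d \<le> rad" "\<And>x. x \<in> V \<Longrightarrow> norm x < d \<Longrightarrow> psi x \<in> N"
proof -
  have "openin (top_of_set (V \<inter> ball 0 rad)) {x \<in> V \<inter> ball 0 rad. psi x \<in> N}"
    using openin_continuous_map_preimage[OF psi_continuous assms(1)] by simp
  moreover have "0 \<in> {x \<in> V \<inter> ball 0 rad. psi x \<in> N}"
    using V_0 rad_pos assms(2) by simp
  ultimately obtain d where d: "d > 0"
    "\<And>x. x \<in> V \<inter> ball 0 rad \<Longrightarrow> dist x 0 < d \<Longrightarrow> x \<in> {x \<in> V \<inter> ball 0 rad. psi x \<in> N}"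
    unfolding openin_euclidean_subtopology_iff by blast
  show ?thesis
    by (rule that[of "min d rad"]) (use d rad_pos in auto)
qed

lemma lg_continuous: "continuous_map (subtopology (topol K) (fst c)) euclidean lg"
proof -
  have "continuous_map (subtopology (topol K) (fst c)) (top_of_set (snd c ` fst c)) (snd c)"
    using atlasD(3)[OF c_atlas] homeomorphic_imp_continuous_map by blast
  then have "continuous_map (subtopology (topol K) (fst c)) euclidean (snd c)"
    by (simp add: continuous_map_in_subtopology)
  then show ?thesis
    unfolding lg_def by (intro continuous_intros) auto
qed

lemma openin_lg_preimage:
  assumes "open W"
  shows "openin (topol K) {g \<in> fst c. lg g \<in> W}"
proof -
  have "openin (subtopology (topol K) (fst c)) {g \<in> topspace (subtopology (topol K) (fst c)). lg g \<in> W}"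
    by (rule openin_continuous_map_preimage[OF lg_continuous]) (use assms in simp)
  moreover have "topspace (subtopology (topol K) (fst c)) = fst c"
    using chart_carrier by (auto simp: topspace_eq)
  ultimately have "openin (subtopology (topol K) (fst c)) {g \<in> fst c. lg g \<in> W}"
    by (simp only:)
  then show ?thesis
    using openin_trans_full[OF _ atlasD(1)[OF c_atlas]] by blast
qed

lemma mult_nbhd:
  assumes "openin (topol K) N" "g \<in> carrier K" "h \<in> carrier K" "g \<otimes> h \<in> N"
  obtains A B where "openin (topol K) A" "openin (topol K) B" "g \<in> A" "h \<in> B"
    "\<And>a b. a \<in> A \<Longrightarrow> b \<in> B \<Longrightarrow> a \<otimes> b \<in> N"
proof -
  have "openin (prod_topology (topol K) (topol K))
      {z \<in> topspace (prod_topology (topol K) (topol K)). (case z of (g, h) \<Rightarrow> g \<otimes> h) \<in> N}"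
    by (rule openin_continuous_map_preimage[OF mult_continuous assms(1)])
  then show ?thesis
    using assms that unfolding openin_prod_topology_alt by (fastforce simp: topspace_eq)
qed

lemma mult_in_chart_near_one:
  obtains d where "d > 0" "d \<le> rad"
    "\<And>x y. x \<in> V \<Longrightarrow> y \<in> V \<Longrightarrow> norm x < d \<Longrightarrow> norm y < d \<Longrightarrow> psi x \<otimes> psi y \<in> fst c"
proof -
  obtain A B where A: "openin (topol K) A" "openin (topol K) B" "\<one> \<in> A" "\<one> \<in> B"
    "\<And>a b. a \<in> A \<Longrightarrow> b \<in> B \<Longrightarrow> a \<otimes> b \<in> fst c"
    using mult_nbhd[OF atlasD(1)[OF c_atlas] one_closed one_closed] one_in_chart by auto
  then obtain d where d: "d > 0" "d \<le> rad" "\<And>x. x \<in> V \<Longrightarrow> norm x < d \<Longrightarrow> psi x \<in> A \<inter> B"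
    using psi_nbhd[of "A \<inter> B"] by (metis IntI openin_Int)
  show ?thesis by (rule that[OF d(1,2)]) (use d A in auto)
qed

section \<open>Multiplication in centred coordinates\<close>

definition lmul :: "'e \<Rightarrow> 'e \<Rightarrow> 'e" where "lmul x y = lg (psi x \<otimes> psi y)"

text \<open>\<open>F\<close> extends the multiplication, in the chart \<open>c\<close> centred at the identity, to the ambient space.\<close>

lemma lmul_extension:
  obtains r F D B where "r > 0" "r \<le> rad" "B \<ge> 0"
    "\<And>x y. x \<in> V \<Longrightarrow> y \<in> V \<Longrightarrow> norm x < r \<Longrightarrow> norm y < r \<Longrightarrow>
       psi x \<otimes> psi y \<in> fst c \<and> F (x, y) = lmul x y"
    "\<And>z. norm z < 2 * r \<Longrightarrow> (F has_derivative D z) (at z)"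
    "\<And>z z' v. norm z < 2 * r \<Longrightarrow> norm z' < 2 * r \<Longrightarrow> norm (D z v - D z' v) \<le> B * norm (z - z') * norm v"
    "\<And>v. (\<lambda>z. D z v) differentiable (at (0 :: 'e \<times> 'e))"
proof -
  define S where "S = {(x, y). x \<in> snd c ` fst c \<and> y \<in> snd c ` fst c \<and>
                   chart_inv c x \<otimes> chart_inv c y \<in> fst c}"
  define p where "p = (snd c \<one>, snd c \<one>)"
  have "smooth_map_on S (\<lambda>(x, y). snd c (chart_inv c x \<otimes> chart_inv c y))"
    using lie c_atlas unfolding lie_group_def S_def by blast
  moreover have "p \<in> S" by (simp add: p_def S_def one_in_chart chart_inv_eq c_atlas)
  ultimately obtain r F D B where r: "r > 0" and B: "B \<ge> 0"
    and F: "\<And>z. z \<in> S \<Longrightarrow> dist p z \<le> r \<Longrightarrow> F z = (case z of (x, y) \<Rightarrow> snd c (chart_inv c x \<otimes> chart_inv c y))"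
    and D: "\<And>z. dist p z \<le> r \<Longrightarrow> (F has_derivative D z) (at z)"
    and lip: "\<And>z z' v. dist p z \<le> r \<Longrightarrow> dist p z' \<le> r \<Longrightarrow> norm (D z v - D z' v) \<le> B * norm (z - z') * norm v"
    and D2: "\<And>v. (\<lambda>z. D z v) differentiable (at p)"
    by (rule smooth_map_onE) blast
  obtain d where d: "d > 0" "d \<le> rad"
    "\<And>x y. x \<in> V \<Longrightarrow> y \<in> V \<Longrightarrow> norm x < d \<Longrightarrow> norm y < d \<Longrightarrow> psi x \<otimes> psi y \<in> fst c"
    using mult_in_chart_near_one by metis
  \<comment> \<open>Two vectors of norm below \<open>s\<close> form a pair of norm below
    \<open>2 * s\<close>, and \<open>2 * s\<close> is at most \<open>r\<close>, the radius on which
    \<open>F\<close> is controlled. This explains the factor 2 in the conclusion.\<close>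
  define s where "s = min d (r / 2)"
  have dist: "dist p (p + z) \<le> r" if "norm z < 2 * s" for z
    using that by (simp add: dist_norm s_def)
  show ?thesis
  proof (rule that[of s B "\<lambda>z. F (p + z) - snd c \<one>" "\<lambda>z. D (p + z)"])
    fix x y :: 'e assume xy: "x \<in> V" "y \<in> V" "norm x < s" "norm y < s"
    have n: "norm (x, y) < 2 * s" using xy norm_Pair_le[of x y] by simp
    have U: "psi x \<otimes> psi y \<in> fst c" using d(3) xy by (simp add: s_def)
    have "p + (x, y) \<in> S"
      using U xy d(2) rad_chart by (simp add: p_def S_def psi_def[symmetric] s_def)
    then have "F (p + (x, y)) = snd c (psi x \<otimes> psi y)"
      using F[OF _ dist[OF n]] by (simp add: p_def psi_def)
    then show "psi x \<otimes> psi y \<in> fst c \<and> F (p + (x, y)) - snd c \<one> = lmul x y"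
      using U by (simp add: lmul_def lg_def)
  next
    fix z :: "'e \<times> 'e" assume z: "norm z < 2 * s"
    have "((\<lambda>z. F (p + z)) has_derivative (\<lambda>v. D (p + z) v)) (at z)"
      by (rule has_derivative_compose[where f = "\<lambda>z. p + z" and f' = "\<lambda>v. v" and g = F and g' = "D (p + z)", OF _ D[OF dist[OF z]]]) (auto intro!: derivative_eq_intros)
    then show "((\<lambda>z. F (p + z) - snd c \<one>) has_derivative D (p + z)) (at z)"
      by (auto intro!: derivative_eq_intros)
  next
    fix z z' v :: "'e \<times> 'e" assume "norm z < 2 * s" "norm z' < 2 * s"
    then show "norm (D (p + z) v - D (p + z') v) \<le> B * norm (z - z') * norm v"
      using lip[OF dist dist, of z z' v] by simp
  next
    fix v
    obtain L where L: "((\<lambda>z. D z v) has_derivative L) (at p)" using D2 unfolding differentiable_def by blast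
    have "((\<lambda>z. D (p + z) v) has_derivative (\<lambda>w. L w)) (at 0)"
      by (rule has_derivative_compose[where g = "\<lambda>z. D z v"]) (use L in \<open>auto intro!: derivative_eq_intros\<close>)
    then show "(\<lambda>z. D (p + z) v) differentiable (at 0)" unfolding differentiable_def by blast
  qed (use r d B in \<open>auto simp: s_def\<close>)
qed

lemma inv_nbhd:
  assumes "openin (topol K) N" "\<one> \<in> N"
  obtains M where "openin (topol K) M" "\<one> \<in> M" "M \<subseteq> carrier K" "\<And>g. g \<in> M \<Longrightarrow> g \<in> N \<and> inv g \<in> N"
proof -
  have "openin (topol K) {g \<in> topspace (topol K). inv g \<in> N}"
    by (rule openin_continuous_map_preimage[OF inv_continuous assms(1)])
  then have "openin (topol K) (N \<inter> {g \<in> carrier K. inv g \<in> N})"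
    using assms(1) by (auto simp: topspace_eq)
  then show ?thesis by (rule that) (use assms(2) in auto)
qed

text \<open>The quantitative form of lmul x y = x + y + O(norm x * norm y), stated for differences
  in each variable. The condition \<open>C * r \<le> 1/2\<close> lets error terms be absorbed into
  the left-hand side of an estimate.\<close>

definition mult_bound :: "real \<Rightarrow> real \<Rightarrow> bool" where
  "mult_bound r C \<longleftrightarrow> 0 < r \<and> r \<le> rad \<and> 0 \<le> C \<and> C * r \<le> 1/2 \<and>
    (\<forall>x\<in>V. \<forall>y\<in>V. norm x < r \<longrightarrow> norm y < r \<longrightarrow> psi x \<otimes> psi y \<in> fst c) \<and>
    (\<forall>x\<in>V. \<forall>x'\<in>V. \<forall>y\<in>V. norm x < r \<longrightarrow> norm x' < r \<longrightarrow> norm y < r \<longrightarrow>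
       norm (lmul x y - lmul x' y - (x - x')) \<le> C * norm y * norm (x - x')) \<and>
    (\<forall>x\<in>V. \<forall>y\<in>V. \<forall>y'\<in>V. norm x < r \<longrightarrow> norm y < r \<longrightarrow> norm y' < r \<longrightarrow>
       norm (lmul x y - lmul x y' - (y - y')) \<le> C * norm x * norm (y - y'))"

lemma lmul_0_right: "x \<in> V \<Longrightarrow> norm x < rad \<Longrightarrow> lmul x 0 = x"
  by (simp add: lmul_def psi_carrier lg_psi)

lemma lmul_0_left: "x \<in> V \<Longrightarrow> norm x < rad \<Longrightarrow> lmul 0 x = x"
  by (simp add: lmul_def psi_carrier lg_psi)

text \<open>Since F (x, 0) = x, the error in the first variable is a difference of values of the map
  x to F (x, y) - F (x, 0). Its derivative compares D at two points at distance norm y, so it is at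
  most B * norm y by the Lipschitz bound, and the mean value inequality applies. The second variable
  is symmetric.\<close>

lemma mult_bound_exists: "\<exists>r C. mult_bound r C"
proof -
  obtain r F D B where r: "r > 0" "r \<le> rad" and B: "B \<ge> 0" and
    F: "\<And>x y. x \<in> V \<Longrightarrow> y \<in> V \<Longrightarrow> norm x < r \<Longrightarrow> norm y < r \<Longrightarrow>
       psi x \<otimes> psi y \<in> fst c \<and> F (x, y) = lmul x y" and
    D: "\<And>z. norm z < 2 * r \<Longrightarrow> (F has_derivative D z) (at z)" and
    lip: "\<And>z z' v. norm z < 2 * r \<Longrightarrow> norm z' < 2 * r \<Longrightarrow> norm (D z v - D z' v) \<le> B * norm (z - z') * norm v"
    by (rule lmul_extension) blast
  define S where "S = V \<inter> ball 0 r"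
  have S: "convex S" unfolding S_def
    using subspace_imp_convex[OF subspace_V] by (intro convex_Int) auto
  have S0: "0 \<in> S" using r V_0 by (simp add: S_def)
  have nz: "norm (x, y) < 2 * r" if "x \<in> S" "y \<in> S" for x y
    using that norm_Pair_le[of x y] by (simp add: S_def)
  have left: "norm (lmul x y - lmul x' y - (x - x')) \<le> B * norm y * norm (x - x')"
    if "x \<in> S" "x' \<in> S" "y \<in> S" for x x' y
  proof -
    define h where "h x = F (x, y) - F (x, 0)" for x
    have "norm (h x - h x') \<le> (B * norm y) * norm (x - x')"
    proof (rule differentiable_bound[OF S])
      fix u assume u: "u \<in> S"
      have "((\<lambda>u. F (u, y)) has_derivative (\<lambda>v. D (u, y) (v, 0))) (at u within S)"
        by (rule has_derivative_compose[where g = F and f = "\<lambda>u. (u, y)"])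
           (use D nz u that in \<open>auto intro!: derivative_eq_intros\<close>)
      moreover have "((\<lambda>u. F (u, 0)) has_derivative (\<lambda>v. D (u, 0) (v, 0))) (at u within S)"
        by (rule has_derivative_compose[where g = F and f = "\<lambda>u. (u, 0)"])
           (use D nz u S0 in \<open>auto intro!: derivative_eq_intros\<close>)
      ultimately show "(h has_derivative (\<lambda>v. D (u, y) (v, 0) - D (u, 0) (v, 0))) (at u within S)"
        unfolding h_def by (rule has_derivative_diff)
      show "onorm (\<lambda>v. D (u, y) (v, 0) - D (u, 0) (v, 0)) \<le> B * norm y"
      proof (rule onorm_le)
        fix v
        show "norm (D (u, y) (v, 0) - D (u, 0) (v, 0)) \<le> B * norm y * norm v"
          using lip[OF nz[OF u that(3)] nz[OF u S0], of "(v, 0)"] by (simp add: norm_Pair)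
      qed
    qed (use that in auto)
    moreover have "h u = lmul u y - u" if "u \<in> S" for u
      using F[of u y] F[of u 0] that \<open>y \<in> S\<close> S0 r lmul_0_right[of u] by (simp add: h_def S_def)
    ultimately show ?thesis using that by (simp add: algebra_simps)
  qed
  have right: "norm (lmul x y - lmul x y' - (y - y')) \<le> B * norm x * norm (y - y')"
    if "y \<in> S" "y' \<in> S" "x \<in> S" for x y y'
  proof -
    define h where "h y = F (x, y) - F (0, y)" for y
    have "norm (h y - h y') \<le> (B * norm x) * norm (y - y')"
    proof (rule differentiable_bound[OF S])
      fix u assume u: "u \<in> S"
      have "((\<lambda>u. F (x, u)) has_derivative (\<lambda>v. D (x, u) (0, v))) (at u within S)"
        by (rule has_derivative_compose[where g = F and f = "\<lambda>u. (x, u)"])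
           (use D nz u that in \<open>auto intro!: derivative_eq_intros\<close>)
      moreover have "((\<lambda>u. F (0, u)) has_derivative (\<lambda>v. D (0, u) (0, v))) (at u within S)"
        by (rule has_derivative_compose[where g = F and f = "\<lambda>u. (0, u)"])
           (use D nz u S0 in \<open>auto intro!: derivative_eq_intros\<close>)
      ultimately show "(h has_derivative (\<lambda>v. D (x, u) (0, v) - D (0, u) (0, v))) (at u within S)"
        unfolding h_def by (rule has_derivative_diff)
      show "onorm (\<lambda>v. D (x, u) (0, v) - D (0, u) (0, v)) \<le> B * norm x"
      proof (rule onorm_le)
        fix v
        show "norm (D (x, u) (0, v) - D (0, u) (0, v)) \<le> B * norm x * norm v"
          using lip[OF nz[OF that(3) u] nz[OF S0 u], of "(0, v)"] by (simp add: norm_Pair)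
      qed
    qed (use that in auto)
    moreover have "h u = lmul x u - u" if "u \<in> S" for u
      using F[of x u] F[of 0 u] that \<open>x \<in> S\<close> S0 r lmul_0_left[of u] by (simp add: h_def S_def)
    ultimately show ?thesis using that by (simp add: algebra_simps)
  qed
  \<comment> \<open>Small enough for \<open>B * r' \<le> 1/2\<close>; using \<open>B + 1\<close>
    keeps the quotient meaningful when \<open>B\<close> is 0.\<close>
  define r' where "r' = min r (1 / (2 * (B + 1)))"
  have "B * r' \<le> B * (1 / (2 * (B + 1)))" unfolding r'_def using B by (intro mult_left_mono) auto
  also have "\<dots> \<le> 1 / 2" using B by (simp add: field_simps)
  finally have "B * r' \<le> 1 / 2" .
  then have "mult_bound r' B"
    unfolding mult_bound_def using r B F left right by (auto simp: r'_def S_def)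
  then show ?thesis by blast
qed

definition mrad :: real where "mrad = (SOME r. \<exists>C. mult_bound r C)"
definition mC :: real where "mC = (SOME C. mult_bound mrad C)"

lemma mult_bound: "mult_bound mrad mC"
  unfolding mC_def mrad_def using mult_bound_exists by (metis (mono_tags, lifting) someI_ex)

lemma mrad_pos: "0 < mrad" and mrad_le: "mrad \<le> rad" and mC_nonneg: "0 \<le> mC"
  and mC_mrad: "mC * mrad \<le> 1/2"
  using mult_bound by (auto simp: mult_bound_def)

lemma lmul_chart: "x \<in> V \<Longrightarrow> y \<in> V \<Longrightarrow> norm x < mrad \<Longrightarrow> norm y < mrad \<Longrightarrow> psi x \<otimes> psi y \<in> fst c"
  using mult_bound by (auto simp: mult_bound_def)

lemma lmul_left:
  "x \<in> V \<Longrightarrow> x' \<in> V \<Longrightarrow> y \<in> V \<Longrightarrow> norm x < mrad \<Longrightarrow> norm x' < mrad \<Longrightarrow> norm y < mrad \<Longrightarrow>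
     norm (lmul x y - lmul x' y - (x - x')) \<le> mC * norm y * norm (x - x')"
  using mult_bound by (auto simp: mult_bound_def)

lemma lmul_right:
  "x \<in> V \<Longrightarrow> y \<in> V \<Longrightarrow> y' \<in> V \<Longrightarrow> norm x < mrad \<Longrightarrow> norm y < mrad \<Longrightarrow> norm y' < mrad \<Longrightarrow>
     norm (lmul x y - lmul x y' - (y - y')) \<le> mC * norm x * norm (y - y')"
  using mult_bound by (auto simp: mult_bound_def)

lemma lmul_approx:
  assumes "x \<in> V" "y \<in> V" "norm x < mrad" "norm y < mrad"
  shows "norm (lmul x y - x - y) \<le> mC * norm x * norm y"
  using lmul_left[of x 0 y] assms lmul_0_left[of y] V_0 mrad_le mrad_pos
  by (simp add: algebra_simps)

lemma psi_lmul: "x \<in> V \<Longrightarrow> y \<in> V \<Longrightarrow> norm x < mrad \<Longrightarrow> norm y < mrad \<Longrightarrow> psi (lmul x y) = psi x \<otimes> psi y"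
  by (simp add: lmul_def psi_lg lmul_chart)

lemma lmul_V: "x \<in> V \<Longrightarrow> y \<in> V \<Longrightarrow> norm x < mrad \<Longrightarrow> norm y < mrad \<Longrightarrow> lmul x y \<in> V"
  by (simp add: lmul_def lg_V lmul_chart)

section \<open>Powers and inverses in centred coordinates\<close>

definition lpow :: "'e \<Rightarrow> nat \<Rightarrow> 'e" where "lpow x k = lg (psi x [^] k)"

lemma small_if_mult:
  assumes "real (Suc k) * norm x \<le> mrad / 4"
  shows "norm x < mrad" "real k * norm x \<le> mrad / 4" "norm x \<le> mrad / 4"
proof -
  have "real (Suc k) * norm x = real k * norm x + norm x" by (simp add: algebra_simps)
  moreover have "real k * norm x \<ge> 0" by simp
  ultimately show "norm x \<le> mrad / 4" "real k * norm x \<le> mrad / 4"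
    using assms norm_ge_zero[of x] by linarith+
  then show "norm x < mrad" using mrad_pos by linarith
qed

text \<open>The three claims depend on each other and share one induction: the norm bound keeps the
  k-th power in the range of the multiplication estimate, which puts the next power into the chart
  and adds an error of at most 2 * mC * k * (norm x)^2. These errors sum to the quadratic bound, and
  smallness of the total length turns that bound into the next norm bound.\<close>

lemma lpow_bounds:
  assumes x: "x \<in> V" and "real k * norm x \<le> mrad / 4"
  shows "psi x [^] k \<in> fst c \<and> norm (lpow x k - real k *\<^sub>R x) \<le> 2 * mC * (real k * norm x)\<^sup>2
    \<and> norm (lpow x k) \<le> 2 * (real k * norm x)"
  using assms(2)
proof (induction k)
  case 0
  then show ?case by (simp add: lpow_def one_in_chart)
next
  case (Suc k)
  note sm = small_if_mult[OF Suc.prems]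
  have IH: "psi x [^] k \<in> fst c" "norm (lpow x k - real k *\<^sub>R x) \<le> 2 * mC * (real k * norm x)\<^sup>2"
    "norm (lpow x k) \<le> 2 * (real k * norm x)"
    using Suc.IH sm by auto
  have l: "lpow x k \<in> V" using IH(1) lg_V by (simp add: lpow_def)
  have lk: "norm (lpow x k) < mrad" using IH(3) sm mrad_pos by linarith
  have pl: "psi (lpow x k) = psi x [^] k" using IH(1) by (simp add: lpow_def psi_lg)
  have in_c: "psi x [^] Suc k \<in> fst c"
    using lmul_chart[OF l x lk sm(1)] by (simp add: pl)
  have step: "lpow x (Suc k) = lmul (lpow x k) x"
    unfolding lmul_def pl by (simp add: lpow_def)
  have "norm (lpow x (Suc k) - real (Suc k) *\<^sub>R x)
      \<le> norm (lmul (lpow x k) x - lpow x k - x) + norm (lpow x k - real k *\<^sub>R x)"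
    using norm_triangle_ineq[of "lmul (lpow x k) x - lpow x k - x" "lpow x k - real k *\<^sub>R x"]
    by (simp add: step algebra_simps)
  also have "\<dots> \<le> mC * norm (lpow x k) * norm x + 2 * mC * (real k * norm x)\<^sup>2"
    using lmul_approx[OF l x lk sm(1)] IH(2) by linarith
  also have "mC * norm (lpow x k) * norm x \<le> mC * (2 * (real k * norm x)) * norm x"
    using IH(3) mC_nonneg by (intro mult_right_mono mult_left_mono) auto
  also have "mC * (2 * (real k * norm x)) * norm x + 2 * mC * (real k * norm x)\<^sup>2
      \<le> 2 * mC * (real (Suc k) * norm x)\<^sup>2"
  proof -
    have "real k + (real k)\<^sup>2 \<le> (real (Suc k))\<^sup>2" by (simp add: power2_eq_square algebra_simps)
    then have "2 * mC * (norm x)\<^sup>2 * (real k + (real k)\<^sup>2) \<le> 2 * mC * (norm x)\<^sup>2 * (real (Suc k))\<^sup>2"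
      using mC_nonneg by (intro mult_left_mono) auto
    then show ?thesis by (simp add: power2_eq_square algebra_simps)
  qed
  finally have quad: "norm (lpow x (Suc k) - real (Suc k) *\<^sub>R x) \<le> 2 * mC * (real (Suc k) * norm x)\<^sup>2" by simp
  have "2 * mC * (real (Suc k) * norm x)\<^sup>2 \<le> real (Suc k) * norm x"
  proof -
    define t where "t = real (Suc k) * norm x"
    have t: "0 \<le> t" "t \<le> mrad / 4" using Suc.prems by (simp_all add: t_def)
    have "mC * t \<le> mC * mrad" using t mC_nonneg mrad_pos by (intro mult_left_mono) auto
    then have "2 * (mC * t) \<le> 1" using mC_mrad by linarith
    then have "2 * (mC * t) * t \<le> 1 * t" using t by (intro mult_right_mono) auto
    then show ?thesis by (simp add: t_def power2_eq_square algebra_simps)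
  qed
  then have "norm (lpow x (Suc k)) \<le> 2 * (real (Suc k) * norm x)"
    using quad norm_triangle_ineq[of "lpow x (Suc k) - real (Suc k) *\<^sub>R x" "real (Suc k) *\<^sub>R x"] by simp
  then show ?case using in_c quad by blast
qed

lemma lpow_chart: "x \<in> V \<Longrightarrow> real k * norm x \<le> mrad / 4 \<Longrightarrow> psi x [^] k \<in> fst c"
  and lpow_quad: "x \<in> V \<Longrightarrow> real k * norm x \<le> mrad / 4 \<Longrightarrow> norm (lpow x k - real k *\<^sub>R x) \<le> 2 * mC * (real k * norm x)\<^sup>2"
  and lpow_norm: "x \<in> V \<Longrightarrow> real k * norm x \<le> mrad / 4 \<Longrightarrow> norm (lpow x k) \<le> 2 * (real k * norm x)"
  using lpow_bounds by blast+

lemma lpow_V: "x \<in> V \<Longrightarrow> real k * norm x \<le> mrad / 4 \<Longrightarrow> lpow x k \<in> V"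
  by (simp add: lpow_def lg_V lpow_chart)

lemma psi_lpow: "x \<in> V \<Longrightarrow> real k * norm x \<le> mrad / 4 \<Longrightarrow> psi (lpow x k) = psi x [^] k"
  by (simp add: lpow_def psi_lg lpow_chart)

lemma lpow_small: "x \<in> V \<Longrightarrow> real k * norm x \<le> mrad / 4 \<Longrightarrow> norm (lpow x k) < mrad"
  using lpow_norm[of x k] mrad_pos by linarith

lemma lpow_Suc: "x \<in> V \<Longrightarrow> real k * norm x \<le> mrad / 4 \<Longrightarrow> lpow x (Suc k) = lmul (lpow x k) x"
  by (simp add: lmul_def psi_lpow) (simp add: lpow_def)

lemma mC_le: "t \<le> mrad / 4 \<Longrightarrow> mC * t \<le> 1 / 8"
  using mult_left_mono[of t "mrad / 4" mC] mC_nonneg mC_mrad by simp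

text \<open>One step increases the distance of the two powers by at most (1 + 3/8 + 1/4) * norm (x -
  y): the genuine increment, the effect of multiplying different left factors by x, and the effect
  of the left factor on x - y. The sum is below 3, and this slack keeps the bound linear in k
  instead of exponential.\<close>

lemma lpow_diff:
  assumes x: "x \<in> V" "y \<in> V" and "real k * norm x \<le> mrad / 4" "real k * norm y \<le> mrad / 4"
  shows "norm (lpow x k - lpow y k) \<le> 3 * real k * norm (x - y)"
  using assms(3,4)
proof (induction k)
  case 0
  then show ?case by (simp add: lpow_def)
next
  case (Suc k)
  note smx = small_if_mult[OF Suc.prems(1)] and smy = small_if_mult[OF Suc.prems(2)]
  define d where "d = norm (lpow x k - lpow y k)"
  have IH: "d \<le> 3 * real k * norm (x - y)" using Suc.IH smx smy by (simp add: d_def)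
  note facts = lpow_V[OF x(1) smx(2)] lpow_V[OF x(2) smy(2)] lpow_small[OF x(1) smx(2)] lpow_small[OF x(2) smy(2)]
  have 1: "norm (lmul (lpow x k) x - lmul (lpow y k) x - (lpow x k - lpow y k)) \<le> mC * norm x * d"
    unfolding d_def by (rule lmul_left) (use facts x smx in auto)
  have 2: "norm (lmul (lpow y k) x - lmul (lpow y k) y - (x - y)) \<le> mC * norm (lpow y k) * norm (x - y)"
    by (rule lmul_right) (use facts x smx smy in auto)
  have "lpow x (Suc k) - lpow y (Suc k) =
      (lmul (lpow x k) x - lmul (lpow y k) x - (lpow x k - lpow y k)) +
      (lmul (lpow y k) x - lmul (lpow y k) y - (x - y)) + (lpow x k - lpow y k) + (x - y)"
    using lpow_Suc x smx smy by simp
  moreover have "norm (a + b + u + w) \<le> norm a + norm b + norm u + norm w" for a b u w :: 'e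
    by norm
  ultimately have "norm (lpow x (Suc k) - lpow y (Suc k)) \<le>
      mC * norm x * d + mC * norm (lpow y k) * norm (x - y) + d + norm (x - y)"
    using 1 2 unfolding d_def by (smt (verit))
  moreover have "mC * norm x * d \<le> 3/8 * norm (x - y)"
  proof -
    have "mC * norm x * d \<le> mC * norm x * (3 * real k * norm (x - y))"
      using IH mC_nonneg by (intro mult_left_mono) auto
    also have "\<dots> = 3 * (mC * (real k * norm x)) * norm (x - y)" by simp
    also have "\<dots> \<le> 3 * (1/8) * norm (x - y)"
      using mC_le[OF smx(2)] by (intro mult_right_mono mult_left_mono) auto
    finally show ?thesis by simp
  qed
  moreover have "mC * norm (lpow y k) * norm (x - y) \<le> 1/4 * norm (x - y)"
  proof (rule mult_right_mono)
    have "mC * norm (lpow y k) \<le> mC * (2 * (real k * norm y))"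
      using lpow_norm[OF x(2) smy(2)] mC_nonneg by (intro mult_left_mono) auto
    then show "mC * norm (lpow y k) \<le> 1/4" using mC_le[OF smy(2)] by simp
  qed simp
  ultimately have "norm (lpow x (Suc k) - lpow y (Suc k)) \<le> 3 * real k * norm (x - y) + 3 * norm (x - y)"
    using IH norm_ge_zero[of "x - y"] by linarith
  then show ?case by (simp add: algebra_simps)
qed

lemma lpow_Suc_diff:
  assumes x: "x \<in> V" and "real (Suc k) * norm x \<le> mrad / 4"
  shows "norm (lpow x (Suc k) - lpow x k) \<le> 2 * norm x"
proof -
  note sm = small_if_mult[OF assms(2)]
  have "norm (lpow x (Suc k) - lpow x k) \<le> norm (lmul (lpow x k) x - lpow x k - x) + norm x"
    unfolding lpow_Suc[OF x sm(2)] by norm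
  also have "\<dots> \<le> mC * norm (lpow x k) * norm x + norm x"
    using lmul_approx[OF lpow_V[OF x sm(2)] x lpow_small[OF x sm(2)] sm(1)] by simp
  also have "mC * norm (lpow x k) * norm x \<le> 1 * norm x"
  proof (rule mult_right_mono)
    have "mC * norm (lpow x k) \<le> mC * (2 * (real k * norm x))"
      using lpow_norm[OF x sm(2)] mC_nonneg by (intro mult_left_mono) auto
    then show "mC * norm (lpow x k) \<le> 1" using mC_le[OF sm(2)] by simp
  qed simp
  finally show ?thesis by simp
qed

text \<open>The product of an element and its inverse has coordinate 0, so x + y is bounded by a
  mixed product. Absorbing first gives norm y \<le> 2 * norm x, which turns the mixed product into a
  square.\<close>

lemma lg_inv_approx:
  assumes x: "x \<in> V" "norm x < mrad" and i: "inv (psi x) \<in> fst c" "norm (lg (inv (psi x))) < mrad"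
  shows "norm (lg (inv (psi x)) + x) \<le> 2 * mC * (norm x)\<^sup>2"
proof -
  define y where "y = lg (inv (psi x))"
  have xr: "norm x < rad" using x mrad_le by simp
  have y: "y \<in> V" "norm y < mrad" using i lg_V by (auto simp: y_def)
  have "lmul x y = 0"
    using i by (simp add: lmul_def y_def psi_lg psi_carrier x xr)
  then have 1: "norm (x + y) \<le> mC * norm x * norm y"
    using lmul_approx[OF x(1) y(1) x(2) y(2)] norm_minus_commute[of 0 "x + y"] by (simp add: diff_diff_eq)
  have "mC * norm x \<le> mC * mrad" using x mC_nonneg by (intro mult_left_mono) auto
  then have "mC * norm x * norm y \<le> 1/2 * norm y" using mC_mrad by (intro mult_right_mono) auto
  moreover have "norm y \<le> norm (x + y) + norm x" by norm
  ultimately have "norm y \<le> 2 * norm x" using 1 by linarith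
  then have "mC * norm x * norm y \<le> mC * norm x * (2 * norm x)"
    using mC_nonneg by (intro mult_left_mono) auto
  then show ?thesis using 1 by (simp add: y_def power2_eq_square algebra_simps)
qed

section \<open>One-parameter subgroups\<close>

lemma limitin_mult:
  assumes "limitin (topol K) f a F" "limitin (topol K) g b F"
  shows "limitin (topol K) (\<lambda>n. f n \<otimes> g n) (a \<otimes> b) F"
proof -
  have "limitin (prod_topology (topol K) (topol K)) (\<lambda>n. (f n, g n)) (a, b) F"
    using assms by (simp add: limitin_pairwise o_def)
  from continuous_map_limit[OF mult_continuous this] show ?thesis by (simp add: o_def)
qed

lemma limitin_inv:
  assumes "limitin (topol K) f a F"
  shows "limitin (topol K) (\<lambda>n. inv (f n)) (inv a) F"
  using continuous_map_limit[OF inv_continuous assms] by (simp add: o_def)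

lemma limitin_psi:
  assumes "(y \<longlongrightarrow> z) F" "z \<in> V" "norm z < rad" "eventually (\<lambda>n. y n \<in> V) F"
  shows "limitin (topol K) (\<lambda>n. psi (y n)) (psi z) F"
proof -
  have "eventually (\<lambda>n. norm (y n) < rad) F"
    using order_tendstoD(2)[OF tendsto_norm[OF assms(1)] assms(3)] .
  then have "limitin (top_of_set (V \<inter> ball 0 rad)) y z F"
    using assms by (auto simp: limitin_subtopology elim: eventually_elim2)
  from continuous_map_limit[OF psi_continuous this] show ?thesis by (simp add: o_def)
qed

definition dyad :: "'e \<Rightarrow> nat \<Rightarrow> 'e" where "dyad v n = (1 / 2 ^ n) *\<^sub>R v"

lemma dyad_V: "v \<in> V \<Longrightarrow> dyad v n \<in> V"
  by (simp add: dyad_def V_scale)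

lemma norm_dyad: "norm (dyad v n) = norm v / 2 ^ n" by (simp add: dyad_def)

lemma dyad_tendsto: "dyad v \<longlonglongrightarrow> 0"
proof -
  have "(\<lambda>n. (1/2 :: real) ^ n) \<longlonglongrightarrow> 0" by (rule LIMSEQ_realpow_zero) auto
  from tendsto_scaleR[OF this tendsto_const[of v]] show ?thesis
    unfolding dyad_def by (simp add: power_one_over)
qed

lemma eventually_dyad_small: "e > 0 \<Longrightarrow> eventually (\<lambda>n. norm (dyad v n) < e) sequentially"
  using order_tendstoD(2)[OF tendsto_norm[OF dyad_tendsto[of v]], of e] by simp

text \<open>The Euler approximation with step size 2^-n. The exponent is an integer so that
  \<open>s\<close> may be negative; \<open>steps\<close> is the same exponent as a natural number,
  for nonnegative \<open>s\<close>.\<close>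

definition euler :: "'e \<Rightarrow> real \<Rightarrow> nat \<Rightarrow> 'g" where
  "euler v s n = psi (dyad v n) [^] \<lfloor>s * 2 ^ n\<rfloor>"

definition steps :: "real \<Rightarrow> nat \<Rightarrow> nat" where "steps s n = nat \<lfloor>s * 2 ^ n\<rfloor>"

lemma steps_norm_le: "0 \<le> s \<Longrightarrow> real (steps s n) * norm (dyad v n) \<le> s * norm v"
proof -
  assume "0 \<le> s"
  then have "real (steps s n) \<le> s * 2 ^ n" by (simp add: steps_def)
  then have "real (steps s n) * norm (dyad v n) \<le> s * 2 ^ n * (norm v / 2 ^ n)"
    unfolding norm_dyad by (intro mult_right_mono) auto
  then show ?thesis by simp
qed

lemma steps_Suc: "0 \<le> s \<Longrightarrow> steps s (Suc n) = 2 * steps s n \<or> steps s (Suc n) = Suc (2 * steps s n)"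
proof -
  assume "0 \<le> s"
  then have "\<lfloor>s * 2 ^ n\<rfloor> \<ge> 0" by simp
  then show ?thesis using floor_mult_power2_bounds[of s n] unfolding steps_def by linarith
qed

lemma steps_scaled_tendsto:
  assumes "0 \<le> s" shows "(\<lambda>n. real (steps s n) *\<^sub>R dyad v n) \<longlonglongrightarrow> s *\<^sub>R v"
proof -
  have "(\<lambda>n. real (steps s n) / 2 ^ n - s) \<longlonglongrightarrow> 0"
  proof (rule Lim_null_comparison)
    show "\<forall>\<^sub>F n in sequentially. norm (real (steps s n) / 2 ^ n - s) \<le> (1/2) ^ n"
    proof (rule always_eventually, rule allI)
      fix n
      have "real (steps s n) = real_of_int \<lfloor>s * 2 ^ n\<rfloor>" using assms by (simp add: steps_def)
      then have "\<bar>real (steps s n) - s * 2 ^ n\<bar> \<le> 1" by linarith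
      then have "\<bar>real (steps s n) - s * 2 ^ n\<bar> / 2 ^ n \<le> 1 / 2 ^ n" by (intro divide_right_mono) auto
      moreover have "\<bar>real (steps s n) - s * 2 ^ n\<bar> / 2 ^ n = \<bar>real (steps s n) / 2 ^ n - s\<bar>"
      proof -
        have "real (steps s n) / 2 ^ n - s = (real (steps s n) - s * 2 ^ n) / 2 ^ n"
          by (simp add: diff_divide_distrib)
        then show ?thesis by simp
      qed
      ultimately show "norm (real (steps s n) / 2 ^ n - s) \<le> (1/2) ^ n"
        by (simp add: power_one_over)
    qed
    show "(\<lambda>n. (1/2 :: real) ^ n) \<longlonglongrightarrow> 0" by (rule LIMSEQ_realpow_zero) auto
  qed
  then have "(\<lambda>n. real (steps s n) / 2 ^ n) \<longlonglongrightarrow> s" by (simp add: LIM_zero_iff)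
  from tendsto_scaleR[OF this tendsto_const[of v]] show ?thesis
    by (simp add: dyad_def)
qed

text \<open>Refining the grid replaces each step 2x by two steps x. The square of
  \<open>psi x\<close> has coordinate 2x up to O((norm x)^2), and over k steps
  \<open>lpow_diff\<close> multiplies this error by 3k; as k * norm x stays bounded, the change is
  O(norm x), which decays like 2^-n. A possible odd extra step costs another 2 * norm x.\<close>

lemma lpow_dyad_convergent:
  assumes v: "v \<in> V" and s: "0 \<le> s" "s * norm v \<le> mrad / 8"
  shows "convergent (\<lambda>n. lpow (dyad v n) (steps s n))"
proof -
  obtain N where N: "\<And>n. n \<ge> N \<Longrightarrow> norm (dyad v n) < mrad / 8"
    using eventually_dyad_small[of "mrad / 8" v] mrad_pos unfolding eventually_sequentially by auto
  \<comment> \<open>Collects the two contributions below, with 2 * norm x = norm v / 2^n.\<close>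
  define M where "M = 6 * mC * (s * norm v) * norm v + norm v"
  show ?thesis
  proof (rule convergent_if_geometric[of N _ M])
    fix n assume n: "n \<ge> N"
    define x where "x = dyad v (Suc n)"
    define k where "k = steps s n"
    have x: "x \<in> V" and dn: "dyad v n = 2 *\<^sub>R x"
      using v by (simp_all add: x_def dyad_V) (simp add: dyad_def)
    have nx: "2 * norm x < mrad / 8" using N[OF n] by (simp add: dn)
    have knx: "real k * (2 * norm x) \<le> s * norm v"
      using steps_norm_le[OF s(1), of n v] by (simp add: k_def dn)
    have sm2: "real 2 * norm x \<le> mrad / 4" using nx mrad_pos by simp
    \<comment> \<open>The coordinate of a double half step, to be compared with the single full step
      \<open>dyad v n\<close>, which is 2x.\<close>
    define w where "w = lpow x 2"
    have w: "w \<in> V" "psi w = psi x [^] (2::nat)" unfolding w_def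
      using lpow_V[OF x sm2] psi_lpow[OF x sm2] by auto
    have wq: "norm (w - 2 *\<^sub>R x) \<le> 2 * mC * (2 * norm x)\<^sup>2" and wn: "norm w \<le> 2 * (2 * norm x)"
      using lpow_quad[OF x sm2] lpow_norm[OF x sm2] by (simp_all add: w_def)
    have xr: "norm x < rad" using nx mrad_le mrad_pos norm_ge_zero[of x] by linarith
    have pk: "psi x [^] (2 * k) = psi w [^] k"
      using w(2) psi_carrier[OF x xr] by (simp add: nat_pow_pow)
    have "real k * norm w \<le> real k * (2 * (2 * norm x))" using wn by (intro mult_left_mono) auto
    then have kw: "real k * norm w \<le> mrad / 4" using knx s by simp
    have "norm (lpow x (2 * k) - lpow (dyad v n) k) \<le> 3 * real k * norm (w - 2 *\<^sub>R x)"
    proof -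
      have "lpow x (2 * k) = lpow w k" by (simp add: lpow_def pk)
      moreover have "real k * norm (2 *\<^sub>R x) \<le> mrad / 4" using knx s mrad_pos by simp
      ultimately show ?thesis
        using lpow_diff[OF w(1) V_scale[OF x, of 2] kw] by (simp add: dn)
    qed
    also have "\<dots> \<le> 3 * real k * (2 * mC * (2 * norm x)\<^sup>2)" using wq by (intro mult_left_mono) auto
    also have "\<dots> = 6 * mC * (real k * (2 * norm x)) * (2 * norm x)"
      by (simp add: power2_eq_square)
    also have "\<dots> \<le> 6 * mC * (s * norm v) * (2 * norm x)"
      using knx mC_nonneg by (intro mult_right_mono mult_left_mono) auto
    finally have 1: "norm (lpow x (2 * k) - lpow (dyad v n) k) \<le> 6 * mC * (s * norm v) * (2 * norm x)" .
    have 2: "norm (lpow x (steps s (Suc n)) - lpow x (2 * k)) \<le> 2 * norm x"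
    proof (cases "steps s (Suc n) = 2 * k")
      case False
      then have eq: "steps s (Suc n) = Suc (2 * k)" using steps_Suc[OF s(1), of n] by (simp add: k_def)
      have "real (Suc (2 * k)) * norm x = real k * (2 * norm x) + norm x" by (simp add: algebra_simps)
      also have "\<dots> \<le> mrad / 4" using knx s nx norm_ge_zero[of x] by linarith
      finally show ?thesis unfolding eq by (rule lpow_Suc_diff[OF x])
    qed simp
    have "norm (lpow x (steps s (Suc n)) - lpow (dyad v n) k)
        \<le> norm (lpow x (steps s (Suc n)) - lpow x (2 * k)) + norm (lpow x (2 * k) - lpow (dyad v n) k)"
      by norm
    also have "\<dots> \<le> (6 * mC * (s * norm v) + 1) * (2 * norm x)"
      using 1 2 by (simp add: algebra_simps)
    also have "\<dots> = M * (1/2) ^ n"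
      by (simp add: M_def x_def norm_dyad power_one_over field_simps)
    finally show "norm (lpow (dyad v (Suc n)) (steps s (Suc n)) - lpow (dyad v n) (steps s n)) \<le> M * (1/2) ^ n"
      by (simp add: x_def k_def)
  qed
qed

lemma euler_limit_small:
  assumes v: "v \<in> V" and s: "0 \<le> s" "s * norm v \<le> mrad / 8"
  obtains z where "z \<in> V" "norm z \<le> 2 * (s * norm v)"
    "norm (z - s *\<^sub>R v) \<le> 2 * mC * (s * norm v)\<^sup>2"
    "(\<lambda>n. lpow (dyad v n) (steps s n)) \<longlonglongrightarrow> z"
    "limitin (topol K) (euler v s) (psi z) sequentially"
proof -
  obtain z where z: "(\<lambda>n. lpow (dyad v n) (steps s n)) \<longlonglongrightarrow> z"
    using lpow_dyad_convergent[OF assms] by (auto simp: convergent_def)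
  have sm: "real (steps s n) * norm (dyad v n) \<le> mrad / 4" for n
    using steps_norm_le[OF s(1), of n v] s mrad_pos by linarith
  have inV: "lpow (dyad v n) (steps s n) \<in> V" for n
    using lpow_V[OF dyad_V[OF v] sm] .
  have zV: "z \<in> V"
    using closed_sequentially[OF closed_subspace[OF subspace_V] _ z] inV by blast
  have b: "norm (lpow (dyad v n) (steps s n)) \<le> 2 * (s * norm v)" for n
    using lpow_norm[OF dyad_V[OF v] sm, of n] steps_norm_le[OF s(1), of n v] by linarith
  have zn: "norm z \<le> 2 * (s * norm v)"
    by (rule tendsto_upperbound[OF tendsto_norm[OF z]]) (use b in auto)
  have zq: "norm (z - s *\<^sub>R v) \<le> 2 * mC * (s * norm v)\<^sup>2"
  proof (rule tendsto_upperbound[OF tendsto_norm[OF tendsto_diff[OF z steps_scaled_tendsto[OF s(1), of v]]]])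
    have "norm (lpow (dyad v n) (steps s n) - real (steps s n) *\<^sub>R dyad v n) \<le> 2 * mC * (s * norm v)\<^sup>2" for n
    proof -
      have "(real (steps s n) * norm (dyad v n))\<^sup>2 \<le> (s * norm v)\<^sup>2"
        using steps_norm_le[OF s(1), of n v] by (intro power_mono) auto
      then have "2 * mC * (real (steps s n) * norm (dyad v n))\<^sup>2 \<le> 2 * mC * (s * norm v)\<^sup>2"
        using mC_nonneg by (intro mult_left_mono) auto
      then show ?thesis using lpow_quad[OF dyad_V[OF v] sm, of n] by linarith
    qed
    then show "\<forall>\<^sub>F n in sequentially. norm (lpow (dyad v n) (steps s n) - real (steps s n) *\<^sub>R dyad v n) \<le> 2 * mC * (s * norm v)\<^sup>2"
      by simp
  qed simp
  have zr: "norm z < rad" using zn s mrad_le mrad_pos by linarith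
  have "psi (lpow (dyad v n) (steps s n)) = euler v s n" for n
  proof -
    have "\<lfloor>s * 2 ^ n\<rfloor> = int (steps s n)" using s by (simp add: steps_def)
    then show ?thesis unfolding euler_def psi_lpow[OF dyad_V[OF v] sm] by (simp add: int_pow_int)
  qed
  then have "limitin (topol K) (euler v s) (psi z) sequentially"
    using limitin_psi[OF z zV zr] inV by simp
  then show ?thesis using that zV zn zq z by blast
qed

lemma psi_dyad_limit: "v \<in> V \<Longrightarrow> limitin (topol K) (\<lambda>n. psi (dyad v n)) \<one> sequentially"
  using limitin_psi[OF dyad_tendsto[of v]] dyad_V rad_pos V_0 by simp

lemma eventually_psi_dyad_carrier: "v \<in> V \<Longrightarrow> eventually (\<lambda>n. psi (dyad v n) \<in> carrier K) sequentially"
  using eventually_dyad_small[OF rad_pos, of v] by (auto elim!: eventually_mono intro: psi_carrier dyad_V)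

lemma limitin_psi_dyad_01:
  assumes v: "v \<in> V" and d: "\<And>n. d n = (0::int) \<or> d n = 1"
  shows "limitin (topol K) (\<lambda>n. psi (dyad v n) [^] d n) \<one> sequentially"
  unfolding limitin_def
proof (intro conjI allI impI)
  fix N assume N: "openin (topol K) N \<and> \<one> \<in> N"
  then have "eventually (\<lambda>n. psi (dyad v n) \<in> N) sequentially"
    using psi_dyad_limit[OF v] by (auto simp: limitin_def)
  then show "eventually (\<lambda>n. psi (dyad v n) [^] d n \<in> N) sequentially"
    using eventually_psi_dyad_carrier[OF v]
  proof eventually_elim
    case (elim n)
    then show ?case using d[of n] N by auto
  qed
qed (simp add: topspace_eq)

text \<open>The floor function is additive up to a defect of 0 or 1, so the Euler products multiply
  up to at most one factor \<open>psi (dyad v n)\<close>, and that factor tends to the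
  identity.\<close>

lemma euler_limit_add:
  assumes v: "v \<in> V" and l: "limitin (topol K) (euler v s) g sequentially" "limitin (topol K) (euler v t) h sequentially"
  shows "limitin (topol K) (euler v (s + t)) (g \<otimes> h) sequentially"
proof -
  define d where "d n = \<lfloor>(s + t) * 2 ^ n\<rfloor> - \<lfloor>s * 2 ^ n\<rfloor> - \<lfloor>t * 2 ^ n\<rfloor>" for n :: nat
  have d: "d n = 0 \<or> d n = 1" for n
  proof -
    have "(s + t) * 2 ^ n = s * 2 ^ n + t * 2 ^ n" by (simp add: algebra_simps)
    then show ?thesis unfolding d_def by linarith
  qed
  have gh: "g \<in> carrier K" "h \<in> carrier K" using l by (auto simp: limitin_def topspace_eq)
  have "limitin (topol K) (\<lambda>n. euler v s n \<otimes> euler v t n \<otimes> psi (dyad v n) [^] d n) (g \<otimes> h \<otimes> \<one>) sequentially"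
    by (intro limitin_mult l limitin_psi_dyad_01 v d)
  moreover have "eventually (\<lambda>n. euler v s n \<otimes> euler v t n \<otimes> psi (dyad v n) [^] d n = euler v (s + t) n) sequentially"
    using eventually_psi_dyad_carrier[OF v]
  proof eventually_elim
    case (elim n)
    have "\<lfloor>s * 2 ^ n\<rfloor> + \<lfloor>t * 2 ^ n\<rfloor> + d n = \<lfloor>(s + t) * 2 ^ n\<rfloor>" by (simp add: d_def)
    then show ?case unfolding euler_def using elim by (metis int_pow_mult)
  qed
  ultimately show ?thesis using gh by (auto elim: limitin_transform_eventually[rotated])
qed

lemma euler_limit_minus:
  assumes v: "v \<in> V" and l: "limitin (topol K) (euler v s) g sequentially"
  shows "limitin (topol K) (euler v (- s)) (inv g) sequentially"
proof -
  define d where "d n = - \<lfloor>- s * 2 ^ n\<rfloor> - \<lfloor>s * 2 ^ n\<rfloor>" for n :: nat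
  have d: "d n = 0 \<or> d n = 1" for n
    unfolding d_def mult_minus_left by linarith
  have g: "g \<in> carrier K" using l by (auto simp: limitin_def topspace_eq)
  have "limitin (topol K) (\<lambda>n. inv (euler v s n \<otimes> psi (dyad v n) [^] d n)) (inv (g \<otimes> \<one>)) sequentially"
    by (intro limitin_inv limitin_mult l limitin_psi_dyad_01 v d)
  moreover have "eventually (\<lambda>n. inv (euler v s n \<otimes> psi (dyad v n) [^] d n) = euler v (- s) n) sequentially"
    using eventually_psi_dyad_carrier[OF v]
  proof eventually_elim
    case (elim n)
    have "- (\<lfloor>s * 2 ^ n\<rfloor> + d n) = \<lfloor>- s * 2 ^ n\<rfloor>" by (simp add: d_def)
    then show ?case unfolding euler_def using elim by (metis int_pow_mult int_pow_neg)
  qed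
  ultimately show ?thesis using g by (auto elim: limitin_transform_eventually[rotated])
qed

lemma scaled_small:
  assumes "e > 0"
  obtains d where "d > 0" "\<And>s. 0 \<le> s \<Longrightarrow> s \<le> d \<Longrightarrow> s * norm v \<le> (e::real)"
proof
  have p: "norm v + 1 > 0" by (simp add: add_nonneg_pos)
  then show "e / (norm v + 1) > 0" using assms by simp
  fix s assume s: "0 \<le> s" "s \<le> e / (norm v + 1)"
  have "s * norm v \<le> e / (norm v + 1) * (norm v + 1)" using s assms p by (intro mult_mono) auto
  then show "s * norm v \<le> e" using p by simp
qed

text \<open>Convergence is known for short times only. Additivity reaches every nonnegative time by
  repetition, and inversion reaches the negative ones.\<close>

lemma euler_limit_exists:
  assumes v: "v \<in> V" shows "\<exists>g. limitin (topol K) (euler v s) g sequentially"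
proof -
  obtain s0 where s0: "s0 > 0" "\<And>s. 0 \<le> s \<Longrightarrow> s \<le> s0 \<Longrightarrow> s * norm v \<le> mrad / 8"
    using scaled_small[of "mrad / 8" v] mrad_pos by auto
  have small: "\<exists>g. limitin (topol K) (euler v s) g sequentially" if "0 \<le> s" "s \<le> s0" for s
    using euler_limit_small[OF v that(1) s0(2)[OF that]] by metis
  have mult: "\<exists>g. limitin (topol K) (euler v (real k * s)) g sequentially" if "0 \<le> s" "s \<le> s0" for k s
  proof (induction k)
    case 0 then show ?case using small[of 0] s0 by simp
  next
    case (Suc k)
    have "real (Suc k) * s = real k * s + s" by (simp add: algebra_simps)
    then show ?case using Suc euler_limit_add[OF v] small[OF that] by metis
  qed
  have pos: "\<exists>g. limitin (topol K) (euler v s) g sequentially" if s: "0 \<le> s" for s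
  proof -
    obtain k :: nat where k: "s / s0 < real k" using reals_Archimedean2 by blast
    have kp: "real k > 0" using k s s0 by (smt (verit) divide_nonneg_pos)
    have "s \<le> s0 * real k" using k s0 by (simp add: field_simps)
    then have "s / real k \<le> s0" using kp by (simp add: field_simps)
    moreover have "0 \<le> s / real k" using s kp by simp
    moreover have "real k * (s / real k) = s" using kp by simp
    ultimately show ?thesis using mult[of "s / real k" k] by metis
  qed
  show ?thesis
  proof (cases "0 \<le> s")
    case False
    then obtain g where "limitin (topol K) (euler v (- s)) g sequentially" using pos[of "- s"] by auto
    from euler_limit_minus[OF v this] show ?thesis by auto
  qed (rule pos)
qed

definition flow :: "'e \<Rightarrow> real \<Rightarrow> 'g" where
  "flow v s = (THE g. limitin (topol K) (euler v s) g sequentially)"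

lemma flow_eqI:
  assumes "limitin (topol K) (euler v s) g sequentially" shows "flow v s = g"
  unfolding flow_def
  by (rule the_equality, rule assms) (use limitin_Hausdorff_unique[OF _ assms _ hausdorff] in auto)

lemma flow_limit: "v \<in> V \<Longrightarrow> limitin (topol K) (euler v s) (flow v s) sequentially"
  using euler_limit_exists flow_eqI by metis

lemma flow_carrier: "v \<in> V \<Longrightarrow> flow v s \<in> carrier K"
  using limitin_topspace[OF flow_limit] by (simp add: topspace_eq)

lemma flow_add: "v \<in> V \<Longrightarrow> flow v (s + t) = flow v s \<otimes> flow v t"
  by (intro flow_eqI euler_limit_add flow_limit)

lemma flow_minus: "v \<in> V \<Longrightarrow> flow v (- s) = inv (flow v s)"
  by (intro flow_eqI euler_limit_minus flow_limit)

lemma flow_small: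
  assumes v: "v \<in> V" and s: "0 \<le> s" "s * norm v \<le> mrad / 8"
  shows "flow v s \<in> fst c" "norm (lg (flow v s)) \<le> 2 * (s * norm v)"
    "norm (lg (flow v s) - s *\<^sub>R v) \<le> 2 * mC * (s * norm v)\<^sup>2"
    "(\<lambda>n. lpow (dyad v n) (steps s n)) \<longlonglongrightarrow> lg (flow v s)"
proof -
  obtain z where z: "z \<in> V" "norm z \<le> 2 * (s * norm v)"
    "norm (z - s *\<^sub>R v) \<le> 2 * mC * (s * norm v)\<^sup>2"
    "(\<lambda>n. lpow (dyad v n) (steps s n)) \<longlonglongrightarrow> z"
    "limitin (topol K) (euler v s) (psi z) sequentially"
    by (rule euler_limit_small[OF assms]) blast
  have nz: "norm z < rad" using z(2) s mrad_le mrad_pos by linarith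
  have fl: "flow v s = psi z" using flow_eqI z(5) by blast
  have lgz: "lg (flow v s) = z" by (simp add: fl lg_psi z(1) nz)
  show "flow v s \<in> fst c" unfolding fl by (rule psi_chart[OF z(1) nz])
  show "norm (lg (flow v s)) \<le> 2 * (s * norm v)"
    "norm (lg (flow v s) - s *\<^sub>R v) \<le> 2 * mC * (s * norm v)\<^sup>2"
    "(\<lambda>n. lpow (dyad v n) (steps s n)) \<longlonglongrightarrow> lg (flow v s)"
    unfolding lgz by (rule z)+
qed

lemma flow_0: "v \<in> V \<Longrightarrow> flow v 0 = \<one>"
  using flow_add[of v 0 0] flow_carrier[of v 0] by simp

lemma flow_nbhd:
  assumes v: "v \<in> V" and N: "openin (topol K) N" "\<one> \<in> N"
  obtains d where "d > 0" "\<And>s. \<bar>s\<bar> < d \<Longrightarrow> flow v s \<in> N"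
proof -
  obtain M where M: "openin (topol K) M" "\<one> \<in> M" "\<And>g. g \<in> M \<Longrightarrow> g \<in> N \<and> inv g \<in> N"
    using inv_nbhd[OF N] by metis
  obtain e where e: "e > 0" "e \<le> rad" "\<And>x. x \<in> V \<Longrightarrow> norm x < e \<Longrightarrow> psi x \<in> M"
    using psi_nbhd[OF M(1,2)] by metis
  obtain d where d: "d > 0" "\<And>s. 0 \<le> s \<Longrightarrow> s \<le> d \<Longrightarrow> s * norm v \<le> min (e / 4) (mrad / 8)"
    using scaled_small[of "min (e / 4) (mrad / 8)" v] e(1) mrad_pos by (metis min_less_iff_conj zero_less_divide_iff zero_less_numeral)
  have pos: "flow v s \<in> M" if "0 \<le> s" "s < d" for s
  proof -
    have b: "s * norm v \<le> e / 4" "s * norm v \<le> mrad / 8" using d(2)[of s] that by auto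
    have "psi (lg (flow v s)) \<in> M"
      using flow_small[OF v that(1) b(2)] b e by (intro e(3) lg_V) auto
    then show ?thesis using psi_lg flow_small(1)[OF v that(1) b(2)] by simp
  qed
  have "flow v s \<in> N" if "\<bar>s\<bar> < d" for s
  proof (cases "0 \<le> s")
    case True then show ?thesis using pos M that by auto
  next
    case False
    then have "flow v (- s) \<in> M" using pos[of "- s"] that by auto
    then have "inv (flow v (- s)) \<in> N" using M by blast
    then show ?thesis using flow_minus[OF v, of "- s"] by simp
  qed
  then show ?thesis using that d(1) by blast
qed

lemma left_translate_continuous:
  assumes "g \<in> carrier K" shows "continuous_map (topol K) (topol K) (\<lambda>h. g \<otimes> h)"
proof -
  have "continuous_map (topol K) (prod_topology (topol K) (topol K)) (\<lambda>h. (g, h))"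
    using assms by (simp add: continuous_map_pairwise o_def topspace_eq)
  from continuous_map_compose[OF this mult_continuous] show ?thesis by (simp add: o_def)
qed

lemma right_translate_continuous:
  assumes "g \<in> carrier K" shows "continuous_map (topol K) (topol K) (\<lambda>h. h \<otimes> g)"
proof -
  have "continuous_map (topol K) (prod_topology (topol K) (topol K)) (\<lambda>h. (h, g))"
    using assms by (simp add: continuous_map_pairwise o_def topspace_eq)
  from continuous_map_compose[OF this mult_continuous] show ?thesis by (simp add: o_def)
qed

lemma left_translate_open:
  assumes "openin (topol K) N" "g \<in> carrier K"
  shows "openin (topol K) {h \<in> carrier K. g \<otimes> h \<in> N}"
  using openin_continuous_map_preimage[OF left_translate_continuous[OF assms(2)] assms(1)]
  by (simp add: topspace_eq)

lemma flow_continuous: assumes v: "v \<in> V" shows "continuous_map euclideanreal (topol K) (flow v)"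
  unfolding continuous_map_def
proof (intro conjI allI impI)
  fix N assume N: "openin (topol K) N"
  have "open {s. flow v s \<in> N}"
    unfolding open_dist
  proof (intro ballI)
    fix s assume "s \<in> {s. flow v s \<in> N}"
    then have s: "flow v s \<in> N" by simp
    have "openin (topol K) {h \<in> carrier K. flow v s \<otimes> h \<in> N}"
      using left_translate_open[OF N flow_carrier[OF v]] .
    then obtain d where d: "d > 0" "\<And>t. \<bar>t\<bar> < d \<Longrightarrow> flow v t \<in> {h \<in> carrier K. flow v s \<otimes> h \<in> N}"
      by (rule flow_nbhd[OF v]) (use s flow_carrier[OF v] in auto)
    show "\<exists>e>0. \<forall>y. dist y s < e \<longrightarrow> y \<in> {s. flow v s \<in> N}"
    proof (intro exI[of _ d] conjI allI impI)
      fix y assume "dist y s < d"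
      then have "flow v s \<otimes> flow v (y - s) \<in> N" using d(2)[of "y - s"] by (auto simp: dist_real_def)
      then show "y \<in> {s. flow v s \<in> N}" using flow_add[OF v, of s "y - s"] by simp
    qed (rule d(1))
  qed
  then show "openin euclidean {x \<in> topspace euclidean. flow v x \<in> N}" by simp
qed (use flow_carrier[OF v] in \<open>auto simp: topspace_eq\<close>)

text \<open>For positive times this is the quadratic estimate of \<open>flow_small\<close>. Negative
  times are reached through the inverse, at the price of a second quadratic error.\<close>

lemma flow_derivative:
  assumes v: "v \<in> V" shows "((\<lambda>s. lg (flow v s)) has_vector_derivative v) (at 0)"
proof -
  have "openin (topol K) {g \<in> fst c. lg g \<in> ball 0 mrad}" by (intro openin_lg_preimage) simp
  then obtain d1 where d1: "d1 > 0" "\<And>s. \<bar>s\<bar> < d1 \<Longrightarrow> flow v s \<in> {g \<in> fst c. lg g \<in> ball 0 mrad}"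
    by (rule flow_nbhd[OF v]) (use one_in_chart mrad_pos in auto)
  obtain d2 where d2: "d2 > 0" "\<And>s. 0 \<le> s \<Longrightarrow> s \<le> d2 \<Longrightarrow> s * norm v \<le> mrad / 8"
    using scaled_small[of "mrad / 8" v] mrad_pos by auto
  define d where "d = min d1 d2"
  \<comment> \<open>10 = 2 * 2^2 + 2: the inversion error is taken at a point of norm at most 2 * t
    * norm v, and the forward error is added to it.\<close>
  define A where "A = 10 * mC * (norm v)\<^sup>2"
  have pos: "norm (lg (flow v s) - s *\<^sub>R v) \<le> 2 * mC * (norm v)\<^sup>2 * s\<^sup>2" if "0 \<le> s" "s < d" for s
    using flow_small(3)[OF v that(1) d2(2)] that by (simp add: d_def power_mult_distrib algebra_simps)
  have A: "norm (lg (flow v s) - s *\<^sub>R v) \<le> A * s\<^sup>2" if s: "\<bar>s\<bar> < d" for s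
  proof (cases "0 \<le> s")
    case True
    have "2 * mC * (norm v)\<^sup>2 * s\<^sup>2 \<le> A * s\<^sup>2"
      unfolding A_def using mC_nonneg by (intro mult_right_mono) auto
    then show ?thesis using pos[of s] True s by simp
  next
    case False
    define t where "t = - s"
    have t: "0 \<le> t" "t < d" "t \<le> d2" using False s by (auto simp: t_def d_def)
    define x where "x = lg (flow v t)"
    have inr: "flow v t \<in> fst c" "norm x < mrad" "flow v s \<in> fst c" "norm (lg (flow v s)) < mrad"
      using d1(2)[of t] d1(2)[of s] t s by (auto simp: x_def d_def)
    have px: "psi x = flow v t" using inr psi_lg by (simp add: x_def)
    have "flow v s = inv (psi x)" using flow_minus[OF v, of t] by (simp add: px t_def)
    then have 1: "norm (lg (flow v s) + x) \<le> 2 * mC * (norm x)\<^sup>2"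
      using lg_inv_approx[of x] inr lg_V by (simp add: x_def)
    have "norm x \<le> 2 * (t * norm v)" using flow_small(2)[OF v t(1) d2(2)] t by (simp add: x_def)
    then have "(norm x)\<^sup>2 \<le> (2 * (t * norm v))\<^sup>2" by (intro power_mono) auto
    then have "2 * mC * (norm x)\<^sup>2 \<le> 2 * mC * (2 * (t * norm v))\<^sup>2"
      using mC_nonneg by (intro mult_left_mono) auto
    moreover have "norm (x - t *\<^sub>R v) \<le> 2 * mC * (norm v)\<^sup>2 * t\<^sup>2" using pos t by (simp add: x_def)
    moreover have "norm (lg (flow v s) - s *\<^sub>R v) \<le> norm (lg (flow v s) + x) + norm (x - t *\<^sub>R v)"
    proof -
      have "lg (flow v s) - s *\<^sub>R v = (lg (flow v s) + x) - (x - t *\<^sub>R v)" by (simp add: t_def)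
      then show ?thesis by (metis norm_triangle_ineq4)
    qed
    ultimately have "norm (lg (flow v s) - s *\<^sub>R v) \<le> 2 * mC * (2 * (t * norm v))\<^sup>2 + 2 * mC * (norm v)\<^sup>2 * t\<^sup>2"
      using 1 by linarith
    also have "\<dots> = A * s\<^sup>2" by (simp add: A_def t_def power_mult_distrib algebra_simps)
    finally show ?thesis .
  qed
  have dpos: "d > 0" using d1 d2 by (simp add: d_def)
  show ?thesis
    unfolding has_vector_derivative_def has_derivative_at
  proof (intro conjI)
    show "bounded_linear (\<lambda>h. h *\<^sub>R v)" by (rule bounded_linear_scaleR_left)
    show "(\<lambda>h. norm (lg (flow v (0 + h)) - lg (flow v 0) - h *\<^sub>R v) / norm h) \<midarrow>0\<rightarrow> 0"
    proof (rule Lim_null_comparison[where g = "\<lambda>h. A * \<bar>h\<bar>"])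
      have "eventually (\<lambda>h::real. \<bar>h\<bar> < d) (at 0)"
        using dpos by (auto simp: eventually_at intro!: exI[of _ d])
      then show "\<forall>\<^sub>F h in at 0. norm (norm (lg (flow v (0 + h)) - lg (flow v 0) - h *\<^sub>R v) / norm h) \<le> A * \<bar>h\<bar>"
      proof eventually_elim
        case (elim h)
        have "norm (lg (flow v h) - h *\<^sub>R v) / \<bar>h\<bar> \<le> A * h\<^sup>2 / \<bar>h\<bar>"
          using A[OF elim] by (intro divide_right_mono) auto
        also have "\<dots> = A * \<bar>h\<bar>" by (cases "h = 0") (auto simp: power2_eq_square abs_if)
        finally show ?case by (simp add: flow_0[OF v])
      qed
      show "(\<lambda>h::real. A * \<bar>h\<bar>) \<midarrow>0\<rightarrow> 0" by (auto intro!: tendsto_eq_intros)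
    qed
  qed
qed

lemma flow_one_parameter_subgroup: "v \<in> V \<Longrightarrow> one_parameter_subgroup K c v (flow v)"
  unfolding one_parameter_subgroup_def
proof (intro conjI allI)
  assume v: "v \<in> V"
  have "((\<lambda>s. lg (flow v s) + snd c \<one>) has_vector_derivative v) (at 0)"
    using flow_derivative[OF v] by (auto intro!: derivative_eq_intros)
  then show "((\<lambda>s. snd c (flow v s)) has_vector_derivative v) (at 0)" by (simp add: lg_def)
qed (auto simp: flow_add flow_continuous)

section \<open>Uniqueness of one-parameter subgroups and the exponential map\<close>

abbreviation E :: "'e \<Rightarrow> 'g" where "E \<equiv> lie_exp K c"

lemma ops_add: "one_parameter_subgroup K c v \<gamma> \<Longrightarrow> \<gamma> (s + t) = \<gamma> s \<otimes> \<gamma> t"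
  by (simp add: one_parameter_subgroup_def)

lemma ops_carrier: "one_parameter_subgroup K c v \<gamma> \<Longrightarrow> \<gamma> s \<in> carrier K"
  by (auto simp: one_parameter_subgroup_def continuous_map_def topspace_eq)

lemma ops_0: "one_parameter_subgroup K c v \<gamma> \<Longrightarrow> \<gamma> 0 = \<one>"
  using ops_add[of v \<gamma> 0 0] ops_carrier[of v \<gamma> 0] by simp

lemma ops_mult: "one_parameter_subgroup K c v \<gamma> \<Longrightarrow> \<gamma> (real k * s) = \<gamma> s [^] k"
proof (induction k)
  case (Suc k)
  have "\<gamma> (real (Suc k) * s) = \<gamma> (real k * s + s)" by (simp add: algebra_simps)
  then show ?case using Suc by (simp add: ops_add)
qed (simp add: ops_0)

lemma ops_minus: "one_parameter_subgroup K c v \<gamma> \<Longrightarrow> \<gamma> (- s) = inv (\<gamma> s)"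
  using ops_add[of v \<gamma> "- s" s] ops_carrier[of v \<gamma>] ops_0[of v \<gamma>] inv_equality by simp

lemma has_vector_derivative_lg:
  "((\<lambda>s. snd c (\<gamma> s)) has_vector_derivative v) F \<longleftrightarrow> ((\<lambda>s. lg (\<gamma> s)) has_vector_derivative v) F"
  by (simp add: lg_def has_vector_derivative_diff_const)

lemma ops_derivative: "one_parameter_subgroup K c v \<gamma> \<Longrightarrow> ((\<lambda>s. lg (\<gamma> s)) has_vector_derivative v) (at 0)"
  by (simp add: one_parameter_subgroup_def has_vector_derivative_lg)

lemma ops_nbhd:
  assumes "one_parameter_subgroup K c v \<gamma>" "openin (topol K) N" "\<one> \<in> N"
  obtains d where "d > 0" "\<And>s. \<bar>s\<bar> < d \<Longrightarrow> \<gamma> s \<in> N"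
proof -
  have "continuous_map euclideanreal (topol K) \<gamma>" using assms(1) by (simp add: one_parameter_subgroup_def)
  then have "open {s. \<gamma> s \<in> N}"
    using openin_continuous_map_preimage[OF _ assms(2)] by fastforce
  moreover have "0 \<in> {s. \<gamma> s \<in> N}" using ops_0[OF assms(1)] assms(3) by simp
  ultimately obtain d where "d > 0" "ball 0 d \<subseteq> {s. \<gamma> s \<in> N}" using open_contains_ball by blast
  then show ?thesis using that by (auto simp: subset_iff)
qed

lemma ops_linear_approx:
  assumes ops: "one_parameter_subgroup K c v \<gamma>" and e: "e > 0"
  obtains d where "d > 0"
    "\<And>s. \<bar>s\<bar> < d \<Longrightarrow> \<gamma> s \<in> fst c \<and> norm (lg (\<gamma> s) - s *\<^sub>R v) \<le> e * \<bar>s\<bar>"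
proof -
  obtain d1 where d1: "d1 > 0" "\<And>s. \<bar>s\<bar> < d1 \<Longrightarrow> \<gamma> s \<in> fst c"
    using ops_nbhd[OF ops atlasD(1)[OF c_atlas] one_in_chart] by metis
  obtain d2 where d2: "d2 > 0" "\<And>s. norm (s - 0) < d2 \<Longrightarrow>
      norm (lg (\<gamma> s) - lg (\<gamma> 0) - (s - 0) *\<^sub>R v) \<le> e * norm (s - 0)"
    using ops_derivative[OF ops] e unfolding has_vector_derivative_def has_derivative_at_alt by blast
  show ?thesis
    by (rule that[of "min d1 d2"]) (use d1 d2 ops_0[OF ops] in auto)
qed

text \<open>At a short time t = s / k both subgroups have coordinate t * v up to e * t. Raising to
  the k-th power multiplies their distance by at most 3k, so at time s they differ by at most 6 * s
  * e, and \<open>e\<close> is arbitrary.\<close>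

lemma ops_unique_small:
  assumes v: "v \<in> V" and ops: "one_parameter_subgroup K c v \<gamma>" "one_parameter_subgroup K c v \<delta>"
    and s: "0 \<le> s" "s * (norm v + 1) \<le> mrad / 4"
  shows "\<gamma> s = \<delta> s"
proof -
  have *: "\<gamma> s \<in> fst c \<and> \<delta> s \<in> fst c \<and> norm (lg (\<gamma> s) - lg (\<delta> s)) \<le> 6 * s * e" if e: "0 < e" "e < 1" for e
  proof -
    obtain d1 where d1: "d1 > 0" "\<And>t. \<bar>t\<bar> < d1 \<Longrightarrow> \<gamma> t \<in> fst c \<and> norm (lg (\<gamma> t) - t *\<^sub>R v) \<le> e * \<bar>t\<bar>"
      using ops_linear_approx[OF ops(1) e(1)] by metis
    obtain d2 where d2: "d2 > 0" "\<And>t. \<bar>t\<bar> < d2 \<Longrightarrow> \<delta> t \<in> fst c \<and> norm (lg (\<delta> t) - t *\<^sub>R v) \<le> e * \<bar>t\<bar>"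
      using ops_linear_approx[OF ops(2) e(1)] by metis
    obtain k :: nat where k: "s / min d1 d2 < real k" using reals_Archimedean2 by blast
    have kp: "real k > 0" using k s d1 d2 divide_nonneg_pos[of s "min d1 d2"] by linarith
    define t where "t = s / real k"
    have "s < min d1 d2 * real k" using k d1 d2 by (simp add: pos_divide_less_eq mult.commute)
    then have "t < min d1 d2" unfolding t_def pos_divide_less_eq[OF kp] .
    then have t: "0 \<le> t" "t < d1" "t < d2" "real k * t = s"
      using kp s by simp_all (simp_all add: t_def)
    have est: "psi x [^] k \<in> fst c \<and> \<eta> s = psi x [^] k \<and> x \<in> V \<and> real k * norm x \<le> mrad / 4 \<and> lg (\<eta> s) = lpow x k"
      if \<eta>: "one_parameter_subgroup K c v \<eta>" "\<eta> t \<in> fst c" "norm (lg (\<eta> t) - t *\<^sub>R v) \<le> e * \<bar>t\<bar>" and x: "x = lg (\<eta> t)" for \<eta> x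
    proof -
      have "norm x \<le> norm (lg (\<eta> t) - t *\<^sub>R v) + norm (t *\<^sub>R v)"
        unfolding x using norm_triangle_sub[of "lg (\<eta> t)" "t *\<^sub>R v"] by simp
      also have "\<dots> \<le> 1 * t + t * norm v" using \<eta>(3) e t mult_right_mono[of e 1 t] by simp
      finally have "real k * norm x \<le> real k * (1 * t + t * norm v)" by (intro mult_left_mono) auto
      also have "\<dots> = real k * t * (norm v + 1)" by (simp add: algebra_simps)
      finally have sm: "real k * norm x \<le> mrad / 4" using s t by simp
      have xV: "x \<in> V" using \<eta>(2) lg_V x by simp
      have "\<eta> s = psi x [^] k" using ops_mult[OF \<eta>(1), of k t] t x psi_lg[OF \<eta>(2)] by simp
      then show ?thesis using lpow_chart[OF xV sm] sm xV by (simp add: lpow_def)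
    qed
    define x where "x = lg (\<gamma> t)"
    define y where "y = lg (\<delta> t)"
    have x: "psi x [^] k \<in> fst c \<and> \<gamma> s = psi x [^] k \<and> x \<in> V \<and> real k * norm x \<le> mrad / 4 \<and> lg (\<gamma> s) = lpow x k"
      using d1(2)[of t] t by (intro est[OF ops(1)]) (auto simp: x_def)
    have y: "psi y [^] k \<in> fst c \<and> \<delta> s = psi y [^] k \<and> y \<in> V \<and> real k * norm y \<le> mrad / 4 \<and> lg (\<delta> s) = lpow y k"
      using d2(2)[of t] t by (intro est[OF ops(2)]) (auto simp: y_def)
    have "norm (lg (\<gamma> s) - lg (\<delta> s)) \<le> 3 * real k * norm (x - y)"
    proof -
      have "lg (\<gamma> s) = lpow x k" "lg (\<delta> s) = lpow y k" using x y by blast+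
      moreover have "norm (lpow x k - lpow y k) \<le> 3 * real k * norm (x - y)"
        by (rule lpow_diff) (use x y in blast)+
      ultimately show ?thesis by (simp only:)
    qed
    also have "\<dots> \<le> 3 * real k * (e * t + e * t)"
    proof (rule mult_left_mono)
      have "norm (x - y) \<le> norm (x - t *\<^sub>R v) + norm (y - t *\<^sub>R v)"
        using norm_triangle_ineq4[of "x - t *\<^sub>R v" "y - t *\<^sub>R v"] by simp
      also have "\<dots> \<le> e * t + e * t"
        using d1(2)[of t] d2(2)[of t] t by (auto simp: x_def y_def intro!: add_mono)
      finally show "norm (x - y) \<le> e * t + e * t" .
    qed simp
    also have "\<dots> = 6 * (real k * t) * e" by (simp add: algebra_simps)
    also have "\<dots> = 6 * s * e" unfolding t(4) ..
    finally have "norm (lg (\<gamma> s) - lg (\<delta> s)) \<le> 6 * s * e" .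
    then show ?thesis using x y by auto
  qed
  have "norm (lg (\<gamma> s) - lg (\<delta> s)) \<le> 0"
  proof (rule field_le_epsilon)
    fix r :: real assume r: "r > 0"
    define e where "e = min (1/2) (r / (6 * s + 1))"
    have e: "0 < e" "e < 1" using r s by (auto simp: e_def)
    have "6 * s * e \<le> (6 * s + 1) * (r / (6 * s + 1))"
      using s e r by (intro mult_mono) (auto simp: e_def)
    also have "\<dots> = r" using s by simp
    finally show "norm (lg (\<gamma> s) - lg (\<delta> s)) \<le> 0 + r" using *[OF e] by simp
  qed
  then show ?thesis using *[of "1/2"] lg_inj[of "\<gamma> s" "\<delta> s"] by simp
qed

lemma ops_unique:
  assumes v: "v \<in> V" and ops: "one_parameter_subgroup K c v \<gamma>" "one_parameter_subgroup K c v \<delta>"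
  shows "\<gamma> s = \<delta> s"
proof -
  have pos: "\<gamma> s = \<delta> s" if s: "0 \<le> s" for s
  proof -
    obtain k :: nat where k: "s * (norm v + 1) * 4 / mrad < real k" using reals_Archimedean2 by blast
    have "0 \<le> s * (norm v + 1) * 4 / mrad" using s mrad_pos by simp
    then have kp: "real k > 0" using k by linarith
    have "\<gamma> (s / real k) = \<delta> (s / real k)"
      by (rule ops_unique_small[OF v ops]) (use k kp s mrad_pos in \<open>auto simp: field_simps\<close>)
    then have "\<gamma> (real k * (s / real k)) = \<delta> (real k * (s / real k))" by (simp only: ops_mult[OF ops(1)] ops_mult[OF ops(2)])
    then show ?thesis using kp by simp
  qed
  show ?thesis
  proof (cases "0 \<le> s")
    case False
    then have "inv (\<gamma> (- s)) = inv (\<delta> (- s))" using pos[of "- s"] by simp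
    then show ?thesis using ops_minus[OF ops(1), of "- s"] ops_minus[OF ops(2), of "- s"] by simp
  qed (rule pos)
qed

text \<open>Discharges the definite description in \<open>lie_exp_def\<close>: \<open>flow v\<close>
  provides existence and \<open>ops_unique\<close> uniqueness.\<close>

lemma lie_exp_eq_flow: "v \<in> V \<Longrightarrow> E v = flow v 1"
  unfolding lie_exp_def
  by (subst the_equality[of "one_parameter_subgroup K c v" "flow v"])
    (auto intro: flow_one_parameter_subgroup ext ops_unique)

lemma ops_scale:
  assumes "one_parameter_subgroup K c v \<gamma>"
  shows "one_parameter_subgroup K c (r *\<^sub>R v) (\<lambda>s. \<gamma> (r * s))"
  unfolding one_parameter_subgroup_def
proof (intro conjI allI)
  have "continuous_map euclideanreal (topol K) \<gamma>" using assms by (simp add: one_parameter_subgroup_def)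
  then have "continuous_map euclideanreal (topol K) (\<gamma> \<circ> (\<lambda>s. r * s))"
    by (rule continuous_map_compose[rotated]) (simp add: continuous_on_mult_left)
  then show "continuous_map euclideanreal (topol K) (\<lambda>s. \<gamma> (r * s))" by (simp add: o_def)
  have "((snd c \<circ> \<gamma>) \<circ> (\<lambda>s. r * s) has_vector_derivative r *\<^sub>R v) (at 0)"
    by (rule vector_diff_chain_at)
      (use assms in \<open>auto simp: one_parameter_subgroup_def o_def intro!: derivative_eq_intros\<close>)
  then show "((\<lambda>s. snd c (\<gamma> (r * s))) has_vector_derivative r *\<^sub>R v) (at 0)" by (simp add: o_def)
qed (simp add: distrib_left ops_add[OF assms])

lemma ops_eq_lie_exp:
  assumes v: "v \<in> V" and ops: "one_parameter_subgroup K c v \<gamma>"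
  shows "\<gamma> s = E (s *\<^sub>R v)"
proof -
  have sv: "s *\<^sub>R v \<in> V" using V_scale[OF v] .
  have "flow (s *\<^sub>R v) 1 = \<gamma> (s * 1)"
    using ops_unique[OF sv flow_one_parameter_subgroup[OF sv] ops_scale[OF ops]] .
  then show ?thesis by (simp add: lie_exp_eq_flow[OF sv])
qed

lemma flow_eq_lie_exp: "v \<in> V \<Longrightarrow> flow v s = E (s *\<^sub>R v)"
  by (rule ops_eq_lie_exp[OF _ flow_one_parameter_subgroup])

lemma lie_exp_ops: "v \<in> V \<Longrightarrow> one_parameter_subgroup K c v (\<lambda>s. E (s *\<^sub>R v))"
proof -
  assume v: "v \<in> V"
  have "flow v = (\<lambda>s. E (s *\<^sub>R v))" using flow_eq_lie_exp[OF v] by (rule ext)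
  then show ?thesis using flow_one_parameter_subgroup[OF v] by simp
qed

lemma lie_exp_carrier: "v \<in> V \<Longrightarrow> E v \<in> carrier K"
  by (simp add: lie_exp_eq_flow flow_carrier)

lemma lie_exp_add: "v \<in> V \<Longrightarrow> E ((s + t) *\<^sub>R v) = E (s *\<^sub>R v) \<otimes> E (t *\<^sub>R v)"
  using ops_add[OF lie_exp_ops] .

lemma lie_exp_0: "E 0 = \<one>"
  using ops_0[OF lie_exp_ops[of 0]] V_0 by simp

lemma lie_exp_minus: "v \<in> V \<Longrightarrow> E (- v) = inv (E v)"
  using ops_minus[OF lie_exp_ops[of v], of 1] by simp

lemma lie_exp_mult: "v \<in> V \<Longrightarrow> E (real k *\<^sub>R v) = E v [^] k"
  using ops_mult[OF lie_exp_ops[of v], of k 1] by simp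

lemma ops_vector_unique:
  assumes "one_parameter_subgroup K c v \<gamma>" "one_parameter_subgroup K c w \<gamma>"
  shows "v = w"
  using vector_derivative_unique_at[OF ops_derivative[OF assms(1)] ops_derivative[OF assms(2)]] .

lemma lie_exp_small:
  assumes "v \<in> V" "norm v \<le> mrad / 8"
  shows "E v \<in> fst c" "norm (lg (E v)) \<le> 2 * norm v" "norm (lg (E v) - v) \<le> 2 * mC * (norm v)\<^sup>2"
    "(\<lambda>n. lpow (dyad v n) (2 ^ n)) \<longlonglongrightarrow> lg (E v)"
  using flow_small[OF assms(1), of 1] assms by (simp_all add: lie_exp_eq_flow steps_def nat_power_eq)

text \<open>At level n the approximations are 2^n-th powers of points at distance norm (v - w) /
  2^n, so \<open>lpow_diff\<close> gives the constant 3 independently of n.\<close>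

lemma lie_exp_lipschitz:
  assumes v: "v \<in> V" "norm v \<le> mrad / 8" and w: "w \<in> V" "norm w \<le> mrad / 8"
  shows "norm (lg (E v) - lg (E w)) \<le> 3 * norm (v - w)"
proof (rule tendsto_upperbound[OF tendsto_norm[OF tendsto_diff[OF lie_exp_small(4)[OF v] lie_exp_small(4)[OF w]]]])
  have "norm (lpow (dyad v n) (2 ^ n) - lpow (dyad w n) (2 ^ n)) \<le> 3 * norm (v - w)" for n
  proof -
    have "norm (lpow (dyad v n) (2 ^ n) - lpow (dyad w n) (2 ^ n)) \<le> 3 * real (2 ^ n) * norm (dyad v n - dyad w n)"
      by (rule lpow_diff) (use v w mrad_pos in \<open>auto simp: dyad_V norm_dyad\<close>)
    also have "dyad v n - dyad w n = dyad (v - w) n" by (simp add: dyad_def scaleR_diff_right)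
    finally show ?thesis by (simp add: norm_dyad)
  qed
  then show "\<forall>\<^sub>F n in sequentially. norm (lpow (dyad v n) (2 ^ n) - lpow (dyad w n) (2 ^ n)) \<le> 3 * norm (v - w)"
    by simp
qed simp

section \<open>The adjoint representation and the bracket\<close>

definition conj_map :: "'g \<Rightarrow> 'e \<Rightarrow> 'e" where "conj_map g x = lg (g \<otimes> psi x \<otimes> inv g)"

lemma conj_nbhd:
  assumes g: "g \<in> carrier K" and N: "openin (topol K) N" "g \<in> N" and M: "openin (topol K) M" "\<one> \<in> M"
  obtains d where "d > 0" "d \<le> rad" "\<And>x. x \<in> V \<Longrightarrow> norm x < d \<Longrightarrow> g \<otimes> psi x \<in> N \<and> g \<otimes> psi x \<otimes> inv g \<in> M"
proof -
  obtain A B where A: "openin (topol K) A" "g \<in> A" "\<And>a. a \<in> A \<Longrightarrow> a \<otimes> inv g \<in> M"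
    using mult_nbhd[OF M(1) g inv_closed[OF g]] g M(2) by (metis r_inv)
  have "openin (topol K) {h \<in> carrier K. g \<otimes> h \<in> A \<inter> N}"
    by (rule left_translate_open) (use A N g in auto)
  moreover have "\<one> \<in> {h \<in> carrier K. g \<otimes> h \<in> A \<inter> N}" using A N g by simp
  ultimately obtain d where "d > 0" "d \<le> rad" "\<And>x. x \<in> V \<Longrightarrow> norm x < d \<Longrightarrow> psi x \<in> {h \<in> carrier K. g \<otimes> h \<in> A \<inter> N}"
    by (rule psi_nbhd) blast
  then show ?thesis using A(3) that by blast
qed

text \<open>The element g may lie outside the chart \<open>c\<close>, so conjugation is split in
  two: x goes to g * psi x in a chart \<open>a\<close> around g, and right multiplication by the
  inverse of g, read in a chart \<open>b\<close> around that inverse, leads back to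
  \<open>c\<close>.\<close>

lemma conj_map_differentiable:
  assumes g: "g \<in> carrier K"
  obtains D where "(conj_map g has_derivative D) (at 0 within V)"
proof -
  obtain a where a: "a \<in> atlas K" "g \<in> fst a" using chart_exists g by metis
  obtain b where b: "b \<in> atlas K" "inv g \<in> fst b" using chart_exists g by (metis inv_closed)
  obtain d where d: "d > 0" "d \<le> rad"
    "\<And>x. x \<in> V \<Longrightarrow> norm x < d \<Longrightarrow> g \<otimes> psi x \<in> fst a \<and> g \<otimes> psi x \<otimes> inv g \<in> fst c"
    using conj_nbhd[OF g atlasD(1)[OF a(1)] a(2) atlasD(1)[OF c_atlas] one_in_chart] by metis
  define S1 where "S1 = {(x, y). x \<in> snd a ` fst a \<and> y \<in> snd c ` fst c \<and> chart_inv a x \<otimes> chart_inv c y \<in> fst a}"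
  define S2 where "S2 = {(x, y). x \<in> snd a ` fst a \<and> y \<in> snd b ` fst b \<and> chart_inv a x \<otimes> chart_inv b y \<in> fst c}"
  have sm1: "smooth_map_on S1 (\<lambda>(x, y). snd a (chart_inv a x \<otimes> chart_inv c y))"
    using lie a(1) c_atlas unfolding lie_group_def S1_def by blast
  have sm2: "smooth_map_on S2 (\<lambda>(x, y). snd c (chart_inv a x \<otimes> chart_inv b y))"
    using lie a(1) b(1) c_atlas unfolding lie_group_def S2_def by blast
  define W where "W = V \<inter> ball 0 d"
  have W0: "0 \<in> W" using d V_0 by (simp add: W_def)
  define i1 where "i1 x = (snd a g, snd c \<one> + x)" for x
  define f1 where "f1 x = snd a (g \<otimes> psi x)" for x
  define i2 where "i2 x = (f1 x, snd b (inv g))" for x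
  have i1: "i1 ` W \<subseteq> S1"
    using d a rad_chart unfolding W_def i1_def S1_def by (auto simp: chart_inv_eq psi_def[symmetric])
  have i2: "i2 ` W \<subseteq> S2"
    using d a b g unfolding W_def i2_def f1_def S2_def by (auto simp: chart_inv_eq)
  obtain D1 where "((\<lambda>(x, y). snd a (chart_inv a x \<otimes> chart_inv c y)) has_derivative D1) (at (i1 0) within S1)"
    using smooth_map_on_has_derivative[OF sm1] i1 W0 by blast
  then have D1: "((\<lambda>(x, y). snd a (chart_inv a x \<otimes> chart_inv c y)) has_derivative D1) (at (i1 0) within i1 ` W)"
    using i1 has_derivative_subset by blast
  have "(i1 has_derivative (\<lambda>v. (0, v))) (at 0 within W)"
    unfolding i1_def by (auto intro!: derivative_eq_intros)
  from has_derivative_in_compose[OF this D1]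
  have f1: "(f1 has_derivative (\<lambda>v. D1 (0, v))) (at 0 within W)"
    unfolding i1_def f1_def psi_def by (simp add: chart_inv_eq a)
  obtain D2 where "((\<lambda>(x, y). snd c (chart_inv a x \<otimes> chart_inv b y)) has_derivative D2) (at (i2 0) within S2)"
    using smooth_map_on_has_derivative[OF sm2] i2 W0 by blast
  then have D2: "((\<lambda>(x, y). snd c (chart_inv a x \<otimes> chart_inv b y)) has_derivative D2) (at (i2 0) within i2 ` W)"
    using i2 has_derivative_subset by blast
  have "(i2 has_derivative (\<lambda>v. (D1 (0, v), 0))) (at 0 within W)"
    unfolding i2_def by (auto intro!: derivative_eq_intros f1)
  from has_derivative_in_compose[OF this D2]
  have "((\<lambda>x. (case i2 x of (x, y) \<Rightarrow> snd c (chart_inv a x \<otimes> chart_inv b y)) - snd c \<one>) has_derivative (\<lambda>v. D2 (D1 (0, v), 0))) (at 0 within W)"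
    by (auto intro!: derivative_eq_intros)
  then have "(conj_map g has_derivative (\<lambda>v. D2 (D1 (0, v), 0))) (at 0 within W)"
  proof (rule has_derivative_transform[rotated 2])
    fix x assume "x \<in> W"
    then have "chart_inv a (f1 x) = g \<otimes> psi x" using d a by (simp add: f1_def W_def chart_inv_eq)
    then show "conj_map g x = (case i2 x of (x, y) \<Rightarrow> snd c (chart_inv a x \<otimes> chart_inv b y)) - snd c \<one>"
      by (simp add: i2_def conj_map_def lg_def chart_inv_eq b)
  qed (rule W0)
  then have "(conj_map g has_derivative (\<lambda>v. D2 (D1 (0, v), 0))) (at 0 within V)"
    using at_within_nhd[of "0::'e" "ball 0 d" V W] d(1) by (simp add: W_def Int_ac)
  then show ?thesis by (rule that)
qed

text \<open>\<open>Ad\<close> is defined along straight lines in coordinates. By the chain rule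
  every curve through the identity with the same velocity gives the same derivative, in particular a
  one-parameter subgroup.\<close>

lemma Ad_curve_D:
  fixes \<gamma> :: "real \<Rightarrow> 'g"
  assumes g: "g \<in> carrier K" and D: "(conj_map g has_derivative D) (at 0 within V)"
    and \<gamma>: "d > 0" "\<And>s. \<bar>s\<bar> < d \<Longrightarrow> \<gamma> s \<in> fst c" "\<gamma> 0 = \<one>" "((\<lambda>s. lg (\<gamma> s)) has_vector_derivative v) (at 0)"
  shows "((\<lambda>s. lg (g \<otimes> \<gamma> s \<otimes> inv g)) has_vector_derivative D v) (at 0)"
proof -
  define S where "S = ball (0::real) d"
  have "((\<lambda>s. lg (\<gamma> s)) has_derivative (\<lambda>h. h *\<^sub>R v)) (at 0 within S)"
    using \<gamma>(4) by (auto simp: has_vector_derivative_def intro: has_derivative_at_withinI)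
  moreover have "(\<lambda>s. lg (\<gamma> s)) ` S \<subseteq> V" using \<gamma>(2) lg_V by (auto simp: S_def)
  then have "(conj_map g has_derivative D) (at (lg (\<gamma> 0)) within (\<lambda>s. lg (\<gamma> s)) ` S)"
    using D \<gamma>(3) has_derivative_subset by simp
  ultimately have "((\<lambda>s. conj_map g (lg (\<gamma> s))) has_derivative (\<lambda>h. D (h *\<^sub>R v))) (at 0 within S)"
    by (rule has_derivative_in_compose)
  then have "((\<lambda>s. lg (g \<otimes> \<gamma> s \<otimes> inv g)) has_derivative (\<lambda>h. D (h *\<^sub>R v))) (at 0 within S)"
    by (rule has_derivative_transform[rotated 2]) (use \<gamma>(1,2) in \<open>auto simp: S_def conj_map_def psi_lg\<close>)
  moreover have "D (h *\<^sub>R v) = h *\<^sub>R D v" for h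
    using has_derivative_linear[OF D] by (rule linear_scale)
  moreover have "at (0::real) within S = at 0"
    by (rule at_within_open) (simp_all add: S_def \<gamma>(1))
  ultimately show ?thesis unfolding has_vector_derivative_def by simp
qed

lemma Ad_derivative:
  assumes g: "g \<in> carrier K"
  obtains D where "bounded_linear D" "(conj_map g has_derivative D) (at 0 within V)"
    "\<And>v. v \<in> V \<Longrightarrow> Ad K c g v = D v"
proof -
  obtain D where D: "(conj_map g has_derivative D) (at 0 within V)" using conj_map_differentiable[OF g] .
  show ?thesis
  proof (rule that[OF has_derivative_bounded_linear[OF D] D])
    fix v assume v: "v \<in> V"
    obtain d where d: "d > 0" "\<And>s. 0 \<le> s \<Longrightarrow> s \<le> d \<Longrightarrow> s * norm v \<le> rad / 2"
      using scaled_small[of "rad / 2" v] rad_pos by auto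
    have sm: "norm (s *\<^sub>R v) < rad" if "\<bar>s\<bar> < d" for s
      using d(2)[of "\<bar>s\<bar>"] that rad_pos by simp
    have "((\<lambda>s. s *\<^sub>R v) has_vector_derivative v) (at 0)" by (auto intro!: derivative_eq_intros)
    then have "((\<lambda>s. lg (psi (s *\<^sub>R v))) has_vector_derivative v) (at 0)"
      by (rule has_vector_derivative_transform_within_open[where S = "ball 0 d"])
        (use d sm v V_scale in \<open>auto simp: lg_psi\<close>)
    then have "((\<lambda>s. lg (g \<otimes> psi (s *\<^sub>R v) \<otimes> inv g)) has_vector_derivative D v) (at 0)"
      by (intro Ad_curve_D[OF g D d(1)] psi_chart sm V_scale[OF v]) auto
    then have "((\<lambda>s. snd c (g \<otimes> psi (s *\<^sub>R v) \<otimes> inv g)) has_vector_derivative D v) (at 0)"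
      by (simp add: has_vector_derivative_lg)
    then show "Ad K c g v = D v" unfolding Ad_def psi_def by (rule vector_derivative_at)
  qed
qed

lemma Ad_add: "g \<in> carrier K \<Longrightarrow> v \<in> V \<Longrightarrow> w \<in> V \<Longrightarrow> Ad K c g (v + w) = Ad K c g v + Ad K c g w"
  by (rule Ad_derivative[of g]) (auto simp: V_add linear_add bounded_linear.linear)

lemma Ad_scale: "g \<in> carrier K \<Longrightarrow> v \<in> V \<Longrightarrow> Ad K c g (r *\<^sub>R v) = r *\<^sub>R Ad K c g v"
  by (rule Ad_derivative[of g]) (auto simp: V_scale linear_scale bounded_linear.linear)

lemma Ad_zero: "g \<in> carrier K \<Longrightarrow> Ad K c g 0 = 0"
  using Ad_scale[of g 0 0] V_0 by simp

lemma Ad_minus: "g \<in> carrier K \<Longrightarrow> v \<in> V \<Longrightarrow> Ad K c g (- v) = - Ad K c g v"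
  using Ad_scale[of g v "-1"] by simp

lemma conj_continuous:
  assumes "g \<in> carrier K" shows "continuous_map (topol K) (topol K) (\<lambda>h. g \<otimes> h \<otimes> inv g)"
  using continuous_map_compose[OF left_translate_continuous[OF assms] right_translate_continuous[OF inv_closed[OF assms]]]
  by (simp add: o_def)

lemma Ad_curve:
  assumes g: "g \<in> carrier K" and v: "v \<in> V"
    and \<gamma>: "d > 0" "\<And>s. \<bar>s\<bar> < d \<Longrightarrow> \<gamma> s \<in> fst c" "\<gamma> 0 = \<one>" "((\<lambda>s. lg (\<gamma> s)) has_vector_derivative v) (at 0)"
  shows "((\<lambda>s. lg (g \<otimes> \<gamma> s \<otimes> inv g)) has_vector_derivative Ad K c g v) (at 0)"
proof -
  obtain D where D: "(conj_map g has_derivative D) (at 0 within V)" "\<And>v. v \<in> V \<Longrightarrow> Ad K c g v = D v"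
    using Ad_derivative[OF g] by blast
  show ?thesis unfolding D(2)[OF v] by (rule Ad_curve_D[OF g D(1) \<gamma>])
qed

lemma ops_V: assumes ops: "one_parameter_subgroup K c v \<gamma>" shows "v \<in> V"
proof -
  obtain d where d: "d > 0" "\<And>s. \<bar>s\<bar> < d \<Longrightarrow> \<gamma> s \<in> fst c"
    by (rule ops_nbhd[OF ops atlasD(1)[OF c_atlas] one_in_chart]) blast
  show ?thesis
    by (rule derivative_in_subspace[OF subspace_V ops_derivative[OF ops] d(1)]) (use d lg_V in auto)
qed

text \<open>Reduces identities for \<open>Ad\<close> to identities in the group: by
  \<open>ops_vector_unique\<close>, two velocities of the same one-parameter subgroup
  coincide.\<close>

lemma ops_conj:
  assumes g: "g \<in> carrier K" and ops: "one_parameter_subgroup K c v \<gamma>"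
  shows "one_parameter_subgroup K c (Ad K c g v) (\<lambda>s. g \<otimes> \<gamma> s \<otimes> inv g)"
  unfolding one_parameter_subgroup_def
proof (intro conjI allI)
  have "continuous_map euclideanreal (topol K) \<gamma>" using ops by (simp add: one_parameter_subgroup_def)
  from continuous_map_compose[OF this conj_continuous[OF g]]
  show "continuous_map euclideanreal (topol K) (\<lambda>s. g \<otimes> \<gamma> s \<otimes> inv g)" by (simp add: o_def)
  fix s t
  show "g \<otimes> \<gamma> (s + t) \<otimes> inv g = g \<otimes> \<gamma> s \<otimes> inv g \<otimes> (g \<otimes> \<gamma> t \<otimes> inv g)"
    using g ops_carrier[OF ops] unfolding ops_add[OF ops]
    by (simp add: m_assoc inv_solve_left') (simp add: m_assoc[symmetric])
next
  obtain d where d: "d > 0" "\<And>s. \<bar>s\<bar> < d \<Longrightarrow> \<gamma> s \<in> fst c"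
    by (rule ops_nbhd[OF ops atlasD(1)[OF c_atlas] one_in_chart]) blast
  show "((\<lambda>s. snd c (g \<otimes> \<gamma> s \<otimes> inv g)) has_vector_derivative Ad K c g v) (at 0)"
    unfolding has_vector_derivative_lg
    by (rule Ad_curve[OF g ops_V[OF ops] d ops_0[OF ops] ops_derivative[OF ops]])
qed

lemma Ad_V: "g \<in> carrier K \<Longrightarrow> v \<in> V \<Longrightarrow> Ad K c g v \<in> V"
  using ops_V[OF ops_conj[OF _ lie_exp_ops]] .

lemma conj_lie_exp:
  assumes "g \<in> carrier K" "v \<in> V" shows "g \<otimes> E v \<otimes> inv g = E (Ad K c g v)"
  using ops_eq_lie_exp[OF Ad_V[OF assms] ops_conj[OF assms(1) lie_exp_ops[OF assms(2)]], of 1] by simp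

lemma Ad_mult:
  assumes g: "g \<in> carrier K" and h: "h \<in> carrier K" and v: "v \<in> V"
  shows "Ad K c (g \<otimes> h) v = Ad K c g (Ad K c h v)"
proof (rule ops_vector_unique)
  show "one_parameter_subgroup K c (Ad K c (g \<otimes> h) v) (\<lambda>s. (g \<otimes> h) \<otimes> E (s *\<^sub>R v) \<otimes> inv (g \<otimes> h))"
    by (rule ops_conj) (use g h lie_exp_ops[OF v] in auto)
  have "(g \<otimes> h) \<otimes> E (s *\<^sub>R v) \<otimes> inv (g \<otimes> h) = g \<otimes> (h \<otimes> E (s *\<^sub>R v) \<otimes> inv h) \<otimes> inv g" for s
    using g h ops_carrier[OF lie_exp_ops[OF v]] by (simp add: m_assoc inv_mult_group)
  then show "one_parameter_subgroup K c (Ad K c g (Ad K c h v)) (\<lambda>s. (g \<otimes> h) \<otimes> E (s *\<^sub>R v) \<otimes> inv (g \<otimes> h))"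
    using ops_conj[OF g ops_conj[OF h lie_exp_ops[OF v]]] by simp
qed

lemma Ad_one: assumes v: "v \<in> V" shows "Ad K c \<one> v = v"
proof (rule ops_vector_unique)
  have "one_parameter_subgroup K c (Ad K c \<one> v) (\<lambda>s. \<one> \<otimes> E (s *\<^sub>R v) \<otimes> inv \<one>)"
    by (rule ops_conj) (use lie_exp_ops[OF v] in auto)
  then show "one_parameter_subgroup K c (Ad K c \<one> v) (\<lambda>s. E (s *\<^sub>R v))"
    using ops_carrier[OF lie_exp_ops[OF v]] by simp
qed (rule lie_exp_ops[OF v])

lemma Ad_inv_Ad: "g \<in> carrier K \<Longrightarrow> v \<in> V \<Longrightarrow> Ad K c (inv g) (Ad K c g v) = v"
  using Ad_mult[of "inv g" g v] Ad_one by simp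

lemma Ad_Ad_inv: "g \<in> carrier K \<Longrightarrow> v \<in> V \<Longrightarrow> Ad K c g (Ad K c (inv g) v) = v"
  using Ad_mult[of g "inv g" v] Ad_one by simp

lemma Ad_has_vector_derivative:
  assumes g: "g \<in> carrier K" and f: "(f has_vector_derivative v) (at t)" and fV: "\<And>s. f s \<in> V"
  shows "((\<lambda>s. Ad K c g (f s)) has_vector_derivative Ad K c g v) (at t)"
proof -
  obtain D where D: "bounded_linear D" "\<And>v. v \<in> V \<Longrightarrow> Ad K c g v = D v"
    using Ad_derivative[OF g] by blast
  have "v \<in> V" by (rule derivative_in_subspace[OF subspace_V f zero_less_one]) (rule fV)
  then show ?thesis
    using bounded_linear.has_vector_derivative[OF D(1) f] by (simp add: D(2) fV)
qed

text \<open>Differentiating \<open>g h = (g h g\<^sup>-\<^sup>1) g\<close> in \<open>h\<close> at the identity expresses \<open>Ad g\<close>, for \<open>g\<close> near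
  the identity, by the two partial derivatives of the multiplication.\<close>

lemma Ad_psi_derivative:
  assumes v: "v \<in> V"
  obtains \<beta> where "((\<lambda>x. Ad K c (psi x) v) has_derivative \<beta>) (at 0 within V)"
proof -
  obtain r F D B where r: "r > 0" "r \<le> rad" and B: "B \<ge> 0" and
    F: "\<And>x y. x \<in> V \<Longrightarrow> y \<in> V \<Longrightarrow> norm x < r \<Longrightarrow> norm y < r \<Longrightarrow>
       psi x \<otimes> psi y \<in> fst c \<and> F (x, y) = lmul x y" and
    D: "\<And>z. norm z < 2 * r \<Longrightarrow> (F has_derivative D z) (at z)" and
    lip: "\<And>z z' v. norm z < 2 * r \<Longrightarrow> norm z' < 2 * r \<Longrightarrow> norm (D z v - D z' v) \<le> B * norm (z - z') * norm v" and
    D2: "\<And>v. (\<lambda>z. D z v) differentiable (at (0 :: 'e \<times> 'e))"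
    by (rule lmul_extension) blast
  define Q where "Q x w = D (x, 0) (0, w)" for x w
  define P where "P x w = D (0, x) (w, 0)" for x w
  have V0: "0 \<in> V" using V_0 .
  have key: "Q x w = P x (Ad K c (psi x) w)" if x: "x \<in> V" "norm x < r" and w: "w \<in> V" for x w
  proof -
    define g where "g = psi x"
    have g: "g \<in> carrier K" using psi_carrier x r by (simp add: g_def)
    define \<gamma> where "\<gamma> s = E (s *\<^sub>R w)" for s
    define \<delta> where "\<delta> s = g \<otimes> \<gamma> s \<otimes> inv g" for s
    have ops: "one_parameter_subgroup K c w \<gamma>" "one_parameter_subgroup K c (Ad K c g w) \<delta>"
      using lie_exp_ops[OF w] ops_conj[OF g lie_exp_ops[OF w]] unfolding \<delta>_def \<gamma>_def by auto
    define N where "N = {g \<in> fst c. lg g \<in> ball 0 r}"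
    have N: "openin (topol K) N" "\<one> \<in> N"
      unfolding N_def using r one_in_chart openin_lg_preimage[OF open_ball, of 0 r] by simp_all
    obtain d1 where d1: "d1 > 0" "\<And>s. \<bar>s\<bar> < d1 \<Longrightarrow> \<gamma> s \<in> N" by (rule ops_nbhd[OF ops(1) N]) blast
    obtain d2 where d2: "d2 > 0" "\<And>s. \<bar>s\<bar> < d2 \<Longrightarrow> \<delta> s \<in> N" by (rule ops_nbhd[OF ops(2) N]) blast
    have eq: "F (x, lg (\<gamma> s)) = F (lg (\<delta> s), x)" if s: "\<bar>s\<bar> < min d1 d2" for s
    proof -
      have N': "\<gamma> s \<in> fst c" "norm (lg (\<gamma> s)) < r" "\<delta> s \<in> fst c" "norm (lg (\<delta> s)) < r"
        using d1(2)[of s] d2(2)[of s] s by (auto simp: N_def)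
      have "F (x, lg (\<gamma> s)) = lg (g \<otimes> \<gamma> s)"
        using F[OF x(1) lg_V[OF N'(1)] x(2) N'(2)] by (simp add: lmul_def psi_lg N' g_def)
      moreover have "F (lg (\<delta> s), x) = lg (\<delta> s \<otimes> g)"
        using F[OF lg_V[OF N'(3)] x(1) N'(4) x(2)] by (simp add: lmul_def psi_lg N' g_def)
      moreover have "\<delta> s \<otimes> g = g \<otimes> \<gamma> s"
        using g chart_carrier[OF N'(1)] by (simp add: \<delta>_def m_assoc)
      ultimately show ?thesis by simp
    qed
    have z: "\<gamma> 0 = \<one>" "\<delta> 0 = \<one>" using ops_0 ops by blast+
    have "((\<lambda>s. F (x, lg (\<gamma> s))) has_derivative (\<lambda>h. D (x, 0) (0, h *\<^sub>R w))) (at 0)"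
      by (rule has_derivative_compose[where g = F and f = "\<lambda>s. (x, lg (\<gamma> s))"])
        (use ops_derivative[OF ops(1)] D[of "(x, 0)"] x r in
          \<open>auto simp: z has_vector_derivative_def norm_Pair intro!: derivative_eq_intros\<close>)
    moreover have "((\<lambda>s. F (lg (\<delta> s), x)) has_derivative (\<lambda>h. D (0, x) (h *\<^sub>R Ad K c g w, 0))) (at 0)"
      by (rule has_derivative_compose[where g = F and f = "\<lambda>s. (lg (\<delta> s), x)"])
        (use ops_derivative[OF ops(2)] D[of "(0, x)"] x r in
          \<open>auto simp: z has_vector_derivative_def norm_Pair intro!: derivative_eq_intros\<close>)
    then have "((\<lambda>s. F (x, lg (\<gamma> s))) has_derivative (\<lambda>h. D (0, x) (h *\<^sub>R Ad K c g w, 0))) (at 0)"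
      by (rule has_derivative_transform_within_open[where s = "ball 0 (min d1 d2)"])
        (use d1 d2 eq in auto)
    ultimately have "(\<lambda>h. D (x, 0) (0, h *\<^sub>R w)) = (\<lambda>h. D (0, x) (h *\<^sub>R Ad K c g w, 0))"
      by (rule has_derivative_unique)
    from fun_cong[OF this, of 1] show ?thesis by (simp add: Q_def P_def g_def)
  qed
  have small: "eventually (\<lambda>s. norm (s *\<^sub>R w) < r) (at 0)" for w :: 'e
  proof -
    have "((\<lambda>s. norm (s *\<^sub>R w)) \<longlongrightarrow> norm (0 *\<^sub>R w)) (at (0::real))" by (intro tendsto_intros)
    then show ?thesis using order_tendstoD(2)[of _ _ _ r] r by simp
  qed
  have F0: "F (0, x) = x" "F (x, 0) = x" if "x \<in> V" "norm x < r" for x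
    using F[OF V0 that(1)] F[OF that(1) V0] that r lmul_0_left[of x] lmul_0_right[of x] by simp_all
  have part0: "D 0 (0, w) = w \<and> D 0 (w, 0) = w" if w: "w \<in> V" for w
  proof
    have s: "s *\<^sub>R w \<in> V" for s using V_scale[OF w] .
    have w0: "((\<lambda>s. s *\<^sub>R w) has_derivative (\<lambda>h. h *\<^sub>R w)) (at 0)" by (auto intro!: derivative_eq_intros)
    have "((\<lambda>s. F (0, s *\<^sub>R w)) has_derivative (\<lambda>h. D 0 (0, h *\<^sub>R w))) (at 0)"
      by (rule has_derivative_compose[where g = F and f = "\<lambda>s. (0, s *\<^sub>R w)"])
        (use D[of 0] r in \<open>auto simp: zero_prod_def intro!: derivative_eq_intros\<close>)
    moreover have "((\<lambda>s. F (0, s *\<^sub>R w)) has_derivative (\<lambda>h. h *\<^sub>R w)) (at 0)"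
      by (rule has_derivative_transform_eventually[OF w0])
        (use small[of w] F0(1)[OF s] F0(1)[OF V0] r in \<open>auto elim!: eventually_mono\<close>)
    ultimately have "(\<lambda>h. D 0 (0, h *\<^sub>R w)) = (\<lambda>h. h *\<^sub>R w)" by (rule has_derivative_unique)
    from fun_cong[OF this, of 1] show "D 0 (0, w) = w" by simp
    have "((\<lambda>s. F (s *\<^sub>R w, 0)) has_derivative (\<lambda>h. D 0 (h *\<^sub>R w, 0))) (at 0)"
      by (rule has_derivative_compose[where g = F and f = "\<lambda>s. (s *\<^sub>R w, 0)"])
        (use D[of 0] r in \<open>auto simp: zero_prod_def intro!: derivative_eq_intros\<close>)
    moreover have "((\<lambda>s. F (s *\<^sub>R w, 0)) has_derivative (\<lambda>h. h *\<^sub>R w)) (at 0)"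
      by (rule has_derivative_transform_eventually[OF w0])
        (use small[of w] F0(2)[OF s] F0(2)[OF V0] r in \<open>auto elim!: eventually_mono\<close>)
    ultimately have "(\<lambda>h. D 0 (h *\<^sub>R w, 0)) = (\<lambda>h. h *\<^sub>R w)" by (rule has_derivative_unique)
    from fun_cong[OF this, of 1] show "D 0 (w, 0) = w" by simp
  qed
  have Qb: "norm (Q x w - w) \<le> B * norm x * norm w" if "norm x < r" "w \<in> V" for x w
    using lip[of "(x, 0)" 0 "(0, w)"] that r part0 by (simp add: Q_def norm_Pair)
  have Pb: "norm (P x w - w) \<le> B * norm x * norm w" if "norm x < r" "w \<in> V" for x w
    using lip[of "(0, x)" 0 "(w, 0)"] that r part0 by (simp add: P_def norm_Pair)
  have Plin: "P x (w - w') = P x w - P x w'" if "norm x < r" for x w w'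
  proof -
    have "linear (D (0, x))" using D[of "(0, x)"] that r has_derivative_linear by (auto simp: norm_Pair)
    from linear_diff[OF this, of "(w, 0)" "(w', 0)"] show ?thesis by (simp add: P_def)
  qed
  \<comment> \<open>Put u = Ad (psi x) v, so that Q x v = P x u by \<open>key\<close>. As P and Q
    are close to the identity, u = v + (Q x v - P x v) to first order. Rather than inverting P x,
    the remainder is rewritten as the defect of P x on u - v, up to sign, and bounded
    directly.\<close>
  define R where "R x = Ad K c (psi x) v - v - (Q x v - P x v)" for x
  \<comment> \<open>Forces \<open>B * norm x \<le> 1/2\<close>. Absorption then gives norm u \<le> 3
    * norm v, and from this norm (u - v) \<le> 4 * B * norm x * norm v; one more factor B * norm x
    makes the remainder quadratic.\<close>
  define d where "d = min r (1 / (2 * (B + 1)))"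
  have dp: "d > 0" using r B by (simp add: d_def)
  have Rb: "norm (R x) \<le> (4 * B\<^sup>2 * norm v) * (norm x)\<^sup>2" if x: "x \<in> V" "norm x < d" for x
  proof -
    have xr: "norm x < r" using x by (simp add: d_def)
    define u where "u = Ad K c (psi x) v"
    have u: "u \<in> V" using Ad_V psi_carrier x xr r v by (simp add: u_def)
    have k: "Q x v = P x u" using key[OF x(1) xr v] by (simp add: u_def)
    have "B * norm x \<le> (B + 1) * (1 / (2 * (B + 1)))"
      using x B by (intro mult_mono) (auto simp: d_def)
    also have "\<dots> = 1/2" using B by simp
    finally have Bx: "B * norm x \<le> 1/2" .
    have "B * norm x * norm u \<le> 1/2 * norm u" "B * norm x * norm v \<le> 1/2 * norm v"
      by (rule mult_right_mono[OF Bx norm_ge_zero])+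
    moreover have "norm u \<le> norm (P x u) + norm (P x u - u)"
      using norm_triangle_ineq4[of "P x u" "P x u - u"] by simp
    moreover have "norm (P x u) \<le> norm v + norm (Q x v - v)"
      using norm_triangle_sub[of "Q x v" v] k by simp
    ultimately have un: "norm u \<le> 3 * norm v"
      using Qb[OF xr v] Pb[OF xr u] by linarith
    have "norm (u - v) \<le> norm (Q x v - v) + norm (P x u - u)"
      using norm_triangle_ineq4[of "Q x v - v" "P x u - u"] k by simp
    also have "\<dots> \<le> B * norm x * norm v + B * norm x * norm u" using Qb[OF xr v] Pb[OF xr u] by linarith
    also have "B * norm x * norm u \<le> B * norm x * (3 * norm v)" using un B by (intro mult_left_mono) auto
    finally have uv: "norm (u - v) \<le> 4 * (B * norm x) * norm v" by (simp add: algebra_simps)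
    have "R x = - (P x (u - v) - (u - v))"
      unfolding Plin[OF xr] by (simp add: R_def k u_def[symmetric])
    then have "norm (R x) \<le> B * norm x * norm (u - v)"
      using Pb[OF xr V_diff[OF u v]] by (simp only: norm_minus_cancel)
    also have "\<dots> \<le> B * norm x * (4 * (B * norm x) * norm v)" using uv B by (intro mult_left_mono) auto
    finally show ?thesis by (simp add: power2_eq_square algebra_simps)
  qed
  have "(R has_derivative (\<lambda>_. 0)) (at 0 within V)"
    by (rule has_derivative_zero_quadratic[OF dp Rb V0])
  moreover obtain L1 where L1: "((\<lambda>z. D z (0, v)) has_derivative L1) (at 0)"
    using D2 unfolding differentiable_def by blast
  moreover obtain L2 where L2: "((\<lambda>z. D z (v, 0)) has_derivative L2) (at 0)"
    using D2 unfolding differentiable_def by blast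
  moreover have "((\<lambda>x. Q x v) has_derivative (\<lambda>w. L1 (w, 0))) (at 0 within V)"
    unfolding Q_def
    by (rule has_derivative_compose[where g = "\<lambda>z. D z (0, v)" and f = "\<lambda>x. (x, 0)"])
      (use L1 in \<open>auto simp: zero_prod_def intro!: derivative_eq_intros\<close>)
  moreover have "((\<lambda>x. P x v) has_derivative (\<lambda>w. L2 (0, w))) (at 0 within V)"
    unfolding P_def
    by (rule has_derivative_compose[where g = "\<lambda>z. D z (v, 0)" and f = "\<lambda>x. (0, x)"])
      (use L2 in \<open>auto simp: zero_prod_def intro!: derivative_eq_intros\<close>)
  ultimately have "((\<lambda>x. R x + v + (Q x v - P x v)) has_derivative (\<lambda>w. 0 + 0 + (L1 (w, 0) - L2 (0, w)))) (at 0 within V)"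
    by (intro has_derivative_add has_derivative_diff has_derivative_const) auto
  then have "((\<lambda>x. Ad K c (psi x) v) has_derivative (\<lambda>w. 0 + 0 + (L1 (w, 0) - L2 (0, w)))) (at 0 within V)"
    by (simp add: R_def)
  then show ?thesis by (rule that)
qed

section \<open>The Lie bracket as the derivative of the adjoint action\<close>

definition bracket :: "'e \<Rightarrow> 'e \<Rightarrow> 'e" where
  "bracket X Y = vector_derivative (\<lambda>s. Ad K c (E (s *\<^sub>R X)) Y) (at 0)"

lemma E_scale_carrier: "X \<in> V \<Longrightarrow> E (s *\<^sub>R X) \<in> carrier K"
  using lie_exp_carrier[OF V_scale] .

text \<open>Linearity in X cannot be read off the definition, since \<open>E\<close> is not
  additive. It holds because one total derivative of x to Ad (psi x) Y at 0 serves every direction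
  X, by the chain rule along s to E (s X).\<close>

lemma bracket_linear_exists:
  assumes Y: "Y \<in> V"
  obtains \<beta> where "linear \<beta>" "\<And>X. X \<in> V \<Longrightarrow> ((\<lambda>s. Ad K c (E (s *\<^sub>R X)) Y) has_vector_derivative \<beta> X) (at 0)"
proof -
  obtain \<beta> where \<beta>: "((\<lambda>x. Ad K c (psi x) Y) has_derivative \<beta>) (at 0 within V)"
    using Ad_psi_derivative[OF Y] .
  show ?thesis
  proof (rule that[OF has_derivative_linear[OF \<beta>]])
    fix X assume X: "X \<in> V"
    note ops = lie_exp_ops[OF X]
    obtain d where d: "d > 0" "\<And>s. \<bar>s\<bar> < d \<Longrightarrow> E (s *\<^sub>R X) \<in> fst c"
      by (rule ops_nbhd[OF ops atlasD(1)[OF c_atlas] one_in_chart]) blast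
    define S where "S = ball (0::real) d"
    have "((\<lambda>s. lg (E (s *\<^sub>R X))) has_derivative (\<lambda>h. h *\<^sub>R X)) (at 0 within S)"
      using ops_derivative[OF ops] by (auto simp: has_vector_derivative_def intro: has_derivative_at_withinI)
    moreover have "(\<lambda>s. lg (E (s *\<^sub>R X))) ` S \<subseteq> V" using d(2) lg_V by (auto simp: S_def)
    then have "((\<lambda>x. Ad K c (psi x) Y) has_derivative \<beta>) (at (lg (E (0 *\<^sub>R X))) within (\<lambda>s. lg (E (s *\<^sub>R X))) ` S)"
      using \<beta> has_derivative_subset by (simp add: lie_exp_0)
    ultimately have "((\<lambda>s. Ad K c (psi (lg (E (s *\<^sub>R X)))) Y) has_derivative (\<lambda>h. \<beta> (h *\<^sub>R X))) (at 0 within S)"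
      by (rule has_derivative_in_compose)
    then have "((\<lambda>s. Ad K c (E (s *\<^sub>R X)) Y) has_derivative (\<lambda>h. \<beta> (h *\<^sub>R X))) (at 0 within S)"
      by (rule has_derivative_transform[rotated 2]) (use d in \<open>auto simp: S_def psi_lg\<close>)
    moreover have "\<beta> (h *\<^sub>R X) = h *\<^sub>R \<beta> X" for h
      using has_derivative_linear[OF \<beta>] by (rule linear_scale)
    moreover have "at (0::real) within S = at 0"
      by (rule at_within_open) (simp_all add: S_def d(1))
    ultimately show "((\<lambda>s. Ad K c (E (s *\<^sub>R X)) Y) has_vector_derivative \<beta> X) (at 0)"
      unfolding has_vector_derivative_def by simp
  qed
qed

lemma bracket_derivative_0:
  assumes "X \<in> V" "Y \<in> V"
  shows "((\<lambda>s. Ad K c (E (s *\<^sub>R X)) Y) has_vector_derivative bracket X Y) (at 0)"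
proof -
  obtain \<beta> where "((\<lambda>s. Ad K c (E (s *\<^sub>R X)) Y) has_vector_derivative \<beta> X) (at 0)"
    using bracket_linear_exists[OF assms(2)] assms(1) by blast
  then show ?thesis unfolding bracket_def using vector_derivative_at by metis
qed

lemma bracket_eqI:
  assumes "((\<lambda>s. Ad K c (E (s *\<^sub>R X)) Y) has_vector_derivative Z) (at 0)" shows "bracket X Y = Z"
  unfolding bracket_def using vector_derivative_at[OF assms] .

lemma bracket_add_left:
  assumes "X \<in> V" "X' \<in> V" "Y \<in> V" shows "bracket (X + X') Y = bracket X Y + bracket X' Y"
proof -
  obtain \<beta> where \<beta>: "linear \<beta>" "\<And>X. X \<in> V \<Longrightarrow> ((\<lambda>s. Ad K c (E (s *\<^sub>R X)) Y) has_vector_derivative \<beta> X) (at 0)"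
    using bracket_linear_exists[OF assms(3)] by blast
  show ?thesis using bracket_eqI[OF \<beta>(2)] assms linear_add[OF \<beta>(1)] V_add by simp
qed

lemma bracket_scale_left:
  assumes "X \<in> V" "Y \<in> V" shows "bracket (r *\<^sub>R X) Y = r *\<^sub>R bracket X Y"
proof -
  obtain \<beta> where \<beta>: "linear \<beta>" "\<And>X. X \<in> V \<Longrightarrow> ((\<lambda>s. Ad K c (E (s *\<^sub>R X)) Y) has_vector_derivative \<beta> X) (at 0)"
    using bracket_linear_exists[OF assms(2)] by blast
  show ?thesis using bracket_eqI[OF \<beta>(2)] assms linear_scale[OF \<beta>(1)] V_scale by simp
qed

lemma bracket_add_right:
  assumes "X \<in> V" "Y \<in> V" "Y' \<in> V" shows "bracket X (Y + Y') = bracket X Y + bracket X Y'"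
proof (rule bracket_eqI)
  have "((\<lambda>s. Ad K c (E (s *\<^sub>R X)) Y + Ad K c (E (s *\<^sub>R X)) Y') has_vector_derivative bracket X Y + bracket X Y') (at 0)"
    by (intro has_vector_derivative_add bracket_derivative_0 assms)
  then show "((\<lambda>s. Ad K c (E (s *\<^sub>R X)) (Y + Y')) has_vector_derivative bracket X Y + bracket X Y') (at 0)"
    using assms by (simp add: Ad_add E_scale_carrier)
qed

lemma bracket_scale_right:
  assumes "X \<in> V" "Y \<in> V" shows "bracket X (r *\<^sub>R Y) = r *\<^sub>R bracket X Y"
proof (rule bracket_eqI)
  have "((\<lambda>s. r *\<^sub>R Ad K c (E (s *\<^sub>R X)) Y) has_vector_derivative r *\<^sub>R bracket X Y) (at 0)"
    by (intro bounded_linear.has_vector_derivative[OF bounded_linear_scaleR_right] bracket_derivative_0 assms)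
  then show "((\<lambda>s. Ad K c (E (s *\<^sub>R X)) (r *\<^sub>R Y)) has_vector_derivative r *\<^sub>R bracket X Y) (at 0)"
    using assms by (simp add: Ad_scale E_scale_carrier)
qed

lemma bracket_V: "X \<in> V \<Longrightarrow> Y \<in> V \<Longrightarrow> bracket X Y \<in> V"
  by (rule derivative_in_subspace[OF subspace_V bracket_derivative_0 zero_less_one])
    (auto intro: Ad_V E_scale_carrier)

lemma Ad_commute:
  assumes g: "g \<in> carrier K" and v: "v \<in> V" and comm: "\<And>s. g \<otimes> E (s *\<^sub>R v) = E (s *\<^sub>R v) \<otimes> g"
  shows "Ad K c g v = v"
proof (rule ops_vector_unique[OF ops_conj[OF g lie_exp_ops[OF v]]])
  have "g \<otimes> E (s *\<^sub>R v) \<otimes> inv g = E (s *\<^sub>R v)" for s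
    unfolding comm using g E_scale_carrier[OF v] by (simp add: m_assoc)
  then show "one_parameter_subgroup K c v (\<lambda>s. g \<otimes> E (s *\<^sub>R v) \<otimes> inv g)"
    using lie_exp_ops[OF v] by simp
qed

lemma commute_Ad:
  assumes g: "g \<in> carrier K" and v: "v \<in> V" and "Ad K c g v = v"
  shows "g \<otimes> E (s *\<^sub>R v) = E (s *\<^sub>R v) \<otimes> g"
proof -
  have sv: "s *\<^sub>R v \<in> V" using V_scale[OF v] .
  have "g \<otimes> E (s *\<^sub>R v) \<otimes> inv g = E (s *\<^sub>R v)"
    using conj_lie_exp[OF g sv] assms by (simp add: Ad_scale)
  then have "g \<otimes> E (s *\<^sub>R v) \<otimes> inv g \<otimes> g = E (s *\<^sub>R v) \<otimes> g" by simp
  then show ?thesis using g E_scale_carrier[OF v] by (simp add: m_assoc)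
qed

lemma Ad_lie_exp_self:
  assumes "v \<in> V" shows "Ad K c (E (t *\<^sub>R v)) v = v"
proof (rule Ad_commute[OF E_scale_carrier[OF assms] assms])
  fix s
  show "E (t *\<^sub>R v) \<otimes> E (s *\<^sub>R v) = E (s *\<^sub>R v) \<otimes> E (t *\<^sub>R v)"
    using lie_exp_add[OF assms, of t s] lie_exp_add[OF assms, of s t] by (simp add: add.commute)
qed

lemma bracket_self: "X \<in> V \<Longrightarrow> bracket X X = 0"
  by (rule bracket_eqI) (simp add: Ad_lie_exp_self)

text \<open>Polarisation of \<open>bracket_self\<close>.\<close>

lemma bracket_anticommute:
  assumes "X \<in> V" "Y \<in> V" shows "bracket X Y = - bracket Y X"
proof -
  have "bracket (X + Y) (X + Y) = 0" using assms V_add bracket_self by simp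
  moreover have "bracket (X + Y) (X + Y) = bracket X Y + bracket Y X"
    using assms by (subst bracket_add_left) (simp_all add: bracket_add_right bracket_self V_add)
  ultimately have "bracket X Y + bracket Y X = 0" by simp
  then show ?thesis by (simp add: eq_neg_iff_add_eq_0)
qed

text \<open>The group law transports the derivative from 0 to t. Along exp (s X) the adjoint action
  thus satisfies a linear differential equation, which can be solved by hand when the bracket with X
  preserves a plane.\<close>

lemma bracket_derivative:
  assumes X: "X \<in> V" and Y: "Y \<in> V"
  shows "((\<lambda>s. Ad K c (E (s *\<^sub>R X)) Y) has_vector_derivative Ad K c (E (t *\<^sub>R X)) (bracket X Y)) (at t)"
proof -
  have "((\<lambda>s. Ad K c (E (t *\<^sub>R X)) (Ad K c (E (s *\<^sub>R X)) Y)) has_vector_derivative Ad K c (E (t *\<^sub>R X)) (bracket X Y)) (at 0)"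
    by (rule Ad_has_vector_derivative[OF E_scale_carrier[OF X] bracket_derivative_0[OF X Y]])
      (intro Ad_V E_scale_carrier X Y)
  then have "((\<lambda>s. Ad K c (E ((t + s) *\<^sub>R X)) Y) has_vector_derivative Ad K c (E (t *\<^sub>R X)) (bracket X Y)) (at 0)"
    by (simp add: Ad_mult[symmetric] E_scale_carrier X Y lie_exp_add)
  then have "((\<lambda>s. Ad K c (E (s *\<^sub>R X)) Y) \<circ> (\<lambda>s. t + s) has_vector_derivative Ad K c (E (t *\<^sub>R X)) (bracket X Y)) (at 0)"
    by (simp add: o_def)
  then have "(((\<lambda>s. Ad K c (E (s *\<^sub>R X)) Y) \<circ> (\<lambda>s. t + s)) \<circ> (\<lambda>s. s - t) has_vector_derivative 1 *\<^sub>R Ad K c (E (t *\<^sub>R X)) (bracket X Y)) (at t)"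
    by (intro vector_diff_chain_at) (auto intro!: derivative_eq_intros)
  then show ?thesis by (simp add: o_def)
qed

lemma Ad_bracket:
  assumes g: "g \<in> carrier K" and X: "X \<in> V" and Y: "Y \<in> V"
  shows "Ad K c g (bracket X Y) = bracket (Ad K c g X) (Ad K c g Y)"
proof (rule bracket_eqI[symmetric])
  have "((\<lambda>s. Ad K c g (Ad K c (E (s *\<^sub>R X)) Y)) has_vector_derivative Ad K c g (bracket X Y)) (at 0)"
    by (rule Ad_has_vector_derivative[OF g bracket_derivative_0[OF X Y]]) (intro Ad_V E_scale_carrier X Y)
  moreover have "Ad K c g (Ad K c (E (s *\<^sub>R X)) Y) = Ad K c (E (s *\<^sub>R Ad K c g X)) (Ad K c g Y)" for s
  proof -
    have "E (s *\<^sub>R Ad K c g X) \<otimes> g = g \<otimes> E (s *\<^sub>R X)"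
      using conj_lie_exp[OF g V_scale[OF X, of s]] g E_scale_carrier[OF X, of s]
      by (metis Ad_scale X inv_closed m_assoc m_closed l_inv r_one)
    then show ?thesis
      using g X Y E_scale_carrier Ad_V by (metis Ad_mult)
  qed
  ultimately show "((\<lambda>s. Ad K c (E (s *\<^sub>R Ad K c g X)) (Ad K c g Y)) has_vector_derivative Ad K c g (bracket X Y)) (at 0)"
    by simp
qed

end

section \<open>Maximal tori\<close>

locale lie_torus = lie_chart K c
  for K :: "('g, 'e::euclidean_space) lie_data" (structure) and c +
  fixes T :: "'g set"
  assumes compact_K: "compact_space (topol K)" and max_torus: "maximal_torus K T"
begin

abbreviation "\<tau> \<equiv> torus_dual K c T"

lemma torus: "torus_in K T" and torus_maximal: "torus_in K T' \<Longrightarrow> T \<subseteq> T' \<Longrightarrow> T' = T"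
  using max_torus by (auto simp: maximal_torus_def)

lemma T_subgroup: "subgroup T K" and T_compact: "compactin (topol K) T"
  and T_connected: "connectedin (topol K) T"
  and T_comm: "s \<in> T \<Longrightarrow> t \<in> T \<Longrightarrow> s \<otimes> t = t \<otimes> s"
  using torus by (auto simp: torus_in_def)

lemma T_carrier: "t \<in> T \<Longrightarrow> t \<in> carrier K"
  using subgroup.mem_carrier[OF T_subgroup] .

lemma T_closed: "closedin (topol K) T"
  using compactin_imp_closedin[OF hausdorff T_compact] .

lemma T_mult: "s \<in> T \<Longrightarrow> t \<in> T \<Longrightarrow> s \<otimes> t \<in> T" and T_inv: "s \<in> T \<Longrightarrow> inv s \<in> T" and T_one: "\<one> \<in> T"
  using T_subgroup subgroup.m_closed subgroup.m_inv_closed subgroup.one_closed by metis+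

lemma T_pow: "t \<in> T \<Longrightarrow> t [^] (k::nat) \<in> T"
  by (induction k) (auto simp: T_one T_mult)

lemma torus_dual_V: "v \<in> \<tau> \<Longrightarrow> v \<in> V" and torus_dual_fixed: "v \<in> \<tau> \<Longrightarrow> t \<in> T \<Longrightarrow> Ad K c t v = v"
  by (auto simp: torus_dual_def)

lemma subspace_torus_dual: "subspace \<tau>"
proof (rule subspaceI)
  have "Ad K c t 0 = 0" if "t \<in> T" for t
    using Ad_scale[OF T_carrier[OF that], of 0 0] V_0 by simp
  then show "0 \<in> \<tau>" using V_0 by (auto simp: torus_dual_def)
qed (auto simp: torus_dual_def Ad_add Ad_scale T_carrier intro: V_add V_scale)

lemmas torus_dual_0 = subspace_0[OF subspace_torus_dual]
  and torus_dual_scale = subspace_scale[OF subspace_torus_dual]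
  and torus_dual_add = subspace_add[OF subspace_torus_dual]
  and torus_dual_diff = subspace_diff[OF subspace_torus_dual]
  and torus_dual_neg = subspace_neg[OF subspace_torus_dual]

text \<open>The closure is compact because the whole group is, and commutation passes to limits in
  one variable at a time, the group being Hausdorff.\<close>

lemma torus_closure:
  assumes S: "subgroup S K" "connectedin (topol K) S" and comm: "\<And>s t. s \<in> S \<Longrightarrow> t \<in> S \<Longrightarrow> s \<otimes> t = t \<otimes> s"
  shows "torus_in K (topol K closure_of S)"
  unfolding torus_in_def
proof (intro conjI ballI)
  have Sc: "S \<subseteq> carrier K" using S(1) subgroup.subset by blast
  have sub: "S \<subseteq> topol K closure_of S" using closure_of_subset[of S] Sc by (simp add: topspace_eq)
  have cc: "topol K closure_of S \<subseteq> carrier K" using closure_of_subset_topspace topspace_eq by metis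
  show "subgroup (topol K closure_of S) K"
  proof (rule subgroupI)
    show "topol K closure_of S \<noteq> {}" using sub subgroup.one_closed[OF S(1)] by blast
    fix a assume a: "a \<in> topol K closure_of S"
    have "(\<lambda>g. inv g) ` (topol K closure_of S) \<subseteq> topol K closure_of ((\<lambda>g. inv g) ` S)"
      by (rule continuous_map_image_closure_subset[OF inv_continuous])
    also have "\<dots> \<subseteq> topol K closure_of S"
      by (rule closure_of_mono) (use subgroup.m_inv_closed[OF S(1)] in auto)
    finally show "inv a \<in> topol K closure_of S" using a by auto
    fix b assume b: "b \<in> topol K closure_of S"
    have "(\<lambda>(g, h). g \<otimes> h) ` (prod_topology (topol K) (topol K) closure_of (S \<times> S))
        \<subseteq> topol K closure_of ((\<lambda>(g, h). g \<otimes> h) ` (S \<times> S))"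
      by (rule continuous_map_image_closure_subset[OF mult_continuous])
    also have "\<dots> \<subseteq> topol K closure_of S"
      by (rule closure_of_mono) (use subgroup.m_closed[OF S(1)] in auto)
    finally show "a \<otimes> b \<in> topol K closure_of S" using a b by (auto simp: closure_of_Times)
  qed (rule cc)
  show "compactin (topol K) (topol K closure_of S)"
    by (rule closedin_compact_space[OF compact_K closedin_closure_of])
  show "connectedin (topol K) (topol K closure_of S)"
    by (rule connectedin_closure_of[OF S(2)])
  fix s t assume s: "s \<in> topol K closure_of S" and t: "t \<in> topol K closure_of S"
  have 1: "a \<otimes> t = t \<otimes> a" if a: "a \<in> S" for a
    by (rule forall_in_closure_of_eq[OF t hausdorff left_translate_continuous right_translate_continuous])
      (use a Sc comm in auto)
  show "s \<otimes> t = t \<otimes> s"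
    by (rule forall_in_closure_of_eq[OF s hausdorff right_translate_continuous left_translate_continuous])
      (use t cc 1 in auto)
qed

text \<open>If \<open>v\<close> is fixed by \<open>T\<close>, then \<open>T\<close> and \<open>exp (\<real>v)\<close> generate an abelian connected subgroup, whose
  closure is a torus and hence equals \<open>T\<close>.\<close>

lemma lie_exp_torus_dual:
  assumes v: "v \<in> \<tau>" shows "E (s *\<^sub>R v) \<in> T"
proof -
  have vV: "v \<in> V" using torus_dual_V[OF v] .
  define f where "f = (\<lambda>(t, s). t \<otimes> E (s *\<^sub>R v))"
  define S where "S = f ` (T \<times> UNIV)"
  have comm: "t \<otimes> E (s *\<^sub>R v) = E (s *\<^sub>R v) \<otimes> t" if "t \<in> T" for t s
    using commute_Ad[OF T_carrier[OF that] vV torus_dual_fixed[OF v that]] .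
  have Ec: "E (s *\<^sub>R v) \<in> carrier K" for s using E_scale_carrier[OF vV] .
  have mult: "t \<otimes> E (s *\<^sub>R v) \<otimes> (t' \<otimes> E (s' *\<^sub>R v)) = (t \<otimes> t') \<otimes> E ((s + s') *\<^sub>R v)"
    if "t \<in> T" "t' \<in> T" for t t' s s'
  proof -
    have "t \<otimes> E (s *\<^sub>R v) \<otimes> (t' \<otimes> E (s' *\<^sub>R v)) = t \<otimes> (E (s *\<^sub>R v) \<otimes> t') \<otimes> E (s' *\<^sub>R v)"
      using that T_carrier Ec by (simp add: m_assoc)
    also have "\<dots> = t \<otimes> (t' \<otimes> E (s *\<^sub>R v)) \<otimes> E (s' *\<^sub>R v)" using comm[OF that(2)] by simp
    also have "\<dots> = (t \<otimes> t') \<otimes> (E (s *\<^sub>R v) \<otimes> E (s' *\<^sub>R v))"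
      using that T_carrier Ec by (simp add: m_assoc)
    finally show ?thesis by (simp only: lie_exp_add[OF vV])
  qed
  have "torus_in K (topol K closure_of S)"
  proof (rule torus_closure)
    show "subgroup S K"
    proof (rule subgroupI)
      show "S \<subseteq> carrier K" using T_carrier Ec by (auto simp: S_def f_def)
      show "S \<noteq> {}" using T_one by (auto simp: S_def)
      fix a assume "a \<in> S"
      then obtain t s where a: "t \<in> T" "a = t \<otimes> E (s *\<^sub>R v)" by (auto simp: S_def f_def)
      have "inv a = inv (E (s *\<^sub>R v)) \<otimes> inv t" using a T_carrier Ec by (simp add: inv_mult_group)
      also have "inv (E (s *\<^sub>R v)) = E ((- s) *\<^sub>R v)"
        using ops_minus[OF lie_exp_ops[OF vV], of s] by simp
      also have "E ((- s) *\<^sub>R v) \<otimes> inv t = inv t \<otimes> E ((- s) *\<^sub>R v)"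
        using comm[OF T_inv[OF a(1)], of "- s"] by simp
      finally show "inv a \<in> S" using T_inv[OF a(1)] unfolding S_def f_def by (auto intro!: image_eqI[of _ _ "(inv t, - s)"])
      fix b assume "b \<in> S"
      then obtain t' s' where b: "t' \<in> T" "b = t' \<otimes> E (s' *\<^sub>R v)" by (auto simp: S_def f_def)
      have "a \<otimes> b = f (t \<otimes> t', s + s')" unfolding a(2) b(2) f_def using mult[OF a(1) b(1)] by simp
      then show "a \<otimes> b \<in> S" using T_mult[OF a(1) b(1)] unfolding S_def by auto
    qed
    have "continuous_map (prod_topology (topol K) euclideanreal) (prod_topology (topol K) (topol K)) (\<lambda>(t, s). (t, E (s *\<^sub>R v)))"
    proof -
      have "continuous_map euclideanreal (topol K) (\<lambda>s. E (s *\<^sub>R v))"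
        using lie_exp_ops[OF vV] by (simp add: one_parameter_subgroup_def)
      from continuous_map_compose[OF continuous_map_snd this]
      show ?thesis by (auto simp: continuous_map_pairwise o_def case_prod_beta continuous_map_fst)
    qed
    from continuous_map_compose[OF this mult_continuous]
    have "continuous_map (prod_topology (topol K) euclideanreal) (topol K) f"
      unfolding f_def by (simp add: o_def case_prod_unfold)
    then show "connectedin (topol K) S" unfolding S_def
      by (rule connectedin_continuous_map_image) (use T_connected in \<open>auto simp: connectedin_Times\<close>)
    fix a b assume "a \<in> S" "b \<in> S"
    then obtain t s t' s' where "t \<in> T" "a = t \<otimes> E (s *\<^sub>R v)" "t' \<in> T" "b = t' \<otimes> E (s' *\<^sub>R v)"
      by (auto simp: S_def f_def)
    then show "a \<otimes> b = b \<otimes> a" using mult[of t t' s s'] mult[of t' t s' s] T_comm[of t t'] by (simp add: add.commute)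
  qed
  moreover have Sc: "S \<subseteq> topol K closure_of S"
    by (rule closure_of_subset) (use T_carrier Ec in \<open>auto simp: S_def f_def topspace_eq\<close>)
  moreover have "T \<subseteq> S"
  proof
    fix t assume "t \<in> T"
    then have "t = f (t, 0)" using T_carrier by (simp add: f_def lie_exp_0)
    then show "t \<in> S" using \<open>t \<in> T\<close> by (auto simp: S_def)
  qed
  ultimately have "topol K closure_of S = T" using torus_maximal by blast
  moreover have "E (s *\<^sub>R v) \<in> S"
    using T_one Ec unfolding S_def f_def by (auto intro!: image_eqI[of _ _ "(\<one>, s)"])
  ultimately show ?thesis using Sc by blast
qed

text \<open>Maximality of \<open>T\<close> gives one direction and commutativity of \<open>T\<close>
  the other. Hence the invariants of \<open>T\<close> are exactly Lie(T), and \<tau> plays both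
  roles from here on.\<close>

lemma torus_dual_iff: "v \<in> \<tau> \<longleftrightarrow> v \<in> V \<and> (\<forall>s. E (s *\<^sub>R v) \<in> T)"
proof
  assume v: "v \<in> V \<and> (\<forall>s. E (s *\<^sub>R v) \<in> T)"
  then show "v \<in> \<tau>"
    by (auto simp: torus_dual_def intro!: Ad_commute T_carrier T_comm)
qed (auto simp: lie_exp_torus_dual torus_dual_V)

lemma lie_subalgebra_eq: "lie_subalgebra_of K c T = \<tau>"
  using torus_dual_iff by (auto simp: lie_subalgebra_of_def)

lemma lie_exp_in_T: "v \<in> \<tau> \<Longrightarrow> E v \<in> T"
  using lie_exp_torus_dual[of v 1] by simp

section \<open>The exponential map of the torus is locally onto\<close>

lemma ops_product_derivative:
  assumes \<gamma>: "one_parameter_subgroup K c v \<gamma>" and \<delta>: "one_parameter_subgroup K c w \<delta>"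
  shows "((\<lambda>s. lg (\<gamma> s \<otimes> \<delta> s)) has_vector_derivative v + w) (at 0)"
proof -
  obtain d1 where d1: "d1 > 0" "\<And>s. \<bar>s\<bar> < d1 \<Longrightarrow> \<gamma> s \<in> fst c \<and> norm (lg (\<gamma> s) - s *\<^sub>R v) \<le> 1 * \<bar>s\<bar>"
    by (rule ops_linear_approx[OF \<gamma> zero_less_one]) blast
  obtain d2 where d2: "d2 > 0" "\<And>s. \<bar>s\<bar> < d2 \<Longrightarrow> \<delta> s \<in> fst c \<and> norm (lg (\<delta> s) - s *\<^sub>R w) \<le> 1 * \<bar>s\<bar>"
    by (rule ops_linear_approx[OF \<delta> zero_less_one]) blast
  have N: "openin (topol K) {g \<in> fst c. lg g \<in> ball 0 mrad}" "\<one> \<in> {g \<in> fst c. lg g \<in> ball 0 mrad}"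
    using openin_lg_preimage[OF open_ball, of 0 mrad] one_in_chart mrad_pos by auto
  obtain d3 where d3: "d3 > 0" "\<And>s. \<bar>s\<bar> < d3 \<Longrightarrow> \<gamma> s \<in> {g \<in> fst c. lg g \<in> ball 0 mrad}"
    by (rule ops_nbhd[OF \<gamma> N]) blast
  obtain d4 where d4: "d4 > 0" "\<And>s. \<bar>s\<bar> < d4 \<Longrightarrow> \<delta> s \<in> {g \<in> fst c. lg g \<in> ball 0 mrad}"
    by (rule ops_nbhd[OF \<delta> N]) blast
  define d where "d = min (min d1 d2) (min d3 d4)"
  define R where "R s = lg (\<gamma> s \<otimes> \<delta> s) - lg (\<gamma> s) - lg (\<delta> s)" for s
  have bound: "norm (R s) \<le> (mC * (norm v + 1) * (norm w + 1)) * (norm s)\<^sup>2" if s: "norm s < d" for s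
  proof -
    have in_c: "\<gamma> s \<in> fst c" "\<delta> s \<in> fst c" "norm (lg (\<gamma> s)) < mrad" "norm (lg (\<delta> s)) < mrad"
      using d3(2)[of s] d4(2)[of s] s by (auto simp: d_def)
    have "R s = lmul (lg (\<gamma> s)) (lg (\<delta> s)) - lg (\<gamma> s) - lg (\<delta> s)"
      by (simp add: R_def lmul_def psi_lg in_c)
    then have "norm (R s) \<le> mC * norm (lg (\<gamma> s)) * norm (lg (\<delta> s))"
      using lmul_approx[of "lg (\<gamma> s)" "lg (\<delta> s)"] in_c lg_V by simp
    moreover have g: "norm (lg (\<gamma> s)) \<le> (norm v + 1) * \<bar>s\<bar>"
      using d1(2)[of s] s norm_triangle_sub[of "lg (\<gamma> s)" "s *\<^sub>R v"] by (auto simp: d_def algebra_simps)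
    moreover have "norm (lg (\<delta> s)) \<le> (norm w + 1) * \<bar>s\<bar>"
      using d2(2)[of s] s norm_triangle_sub[of "lg (\<delta> s)" "s *\<^sub>R w"] by (auto simp: d_def algebra_simps)
    ultimately have "norm (R s) \<le> mC * ((norm v + 1) * \<bar>s\<bar>) * ((norm w + 1) * \<bar>s\<bar>)"
      using mC_nonneg by (meson mult_mono mult_left_mono mult_nonneg_nonneg norm_ge_zero order_trans)
    then show ?thesis by (simp add: power2_eq_square algebra_simps)
  qed
  have "(R has_derivative (\<lambda>_. 0)) (at 0)"
    by (rule has_derivative_zero_quadratic[where d = d]) (use bound d1 d2 d3 d4 in \<open>auto simp: d_def\<close>)
  then have "(R has_vector_derivative 0) (at 0)" by (simp add: has_vector_derivative_def)
  then have "((\<lambda>s. R s + lg (\<gamma> s) + lg (\<delta> s)) has_vector_derivative 0 + v + w) (at 0)"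
    by (intro has_vector_derivative_add ops_derivative[OF \<gamma>] ops_derivative[OF \<delta>])
  then show ?thesis by (simp add: R_def)
qed

text \<open>As the factors commute, the product of the two one-parameter subgroups is again one, and
  to first order multiplication in coordinates is addition, so its velocity is v + w.\<close>

lemma lie_exp_add_torus:
  assumes v: "v \<in> \<tau>" and w: "w \<in> \<tau>" shows "E (v + w) = E v \<otimes> E w"
proof -
  have V: "v \<in> V" "w \<in> V" using v w torus_dual_V by auto
  define \<gamma> where "\<gamma> s = E (s *\<^sub>R v) \<otimes> E (s *\<^sub>R w)" for s
  have c1: "continuous_map euclideanreal (topol K) (\<lambda>s. E (s *\<^sub>R v))" "continuous_map euclideanreal (topol K) (\<lambda>s. E (s *\<^sub>R w))"
    using lie_exp_ops V by (auto simp: one_parameter_subgroup_def)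
  have "continuous_map euclideanreal (prod_topology (topol K) (topol K)) (\<lambda>s. (E (s *\<^sub>R v), E (s *\<^sub>R w)))"
    using c1 by (simp add: continuous_map_pairwise o_def)
  from continuous_map_compose[OF this mult_continuous]
  have cont: "continuous_map euclideanreal (topol K) \<gamma>" unfolding \<gamma>_def by (simp add: o_def)
  have "one_parameter_subgroup K c (v + w) \<gamma>"
    unfolding one_parameter_subgroup_def
  proof (intro conjI allI cont)
    fix s t
    have "E (t *\<^sub>R v) \<otimes> E (s *\<^sub>R w) = E (s *\<^sub>R w) \<otimes> E (t *\<^sub>R v)"
      using T_comm lie_exp_torus_dual v w by simp
    moreover have "E (s *\<^sub>R v) \<in> carrier K" "E (t *\<^sub>R v) \<in> carrier K" "E (s *\<^sub>R w) \<in> carrier K" "E (t *\<^sub>R w) \<in> carrier K"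
      using E_scale_carrier V by auto
    ultimately show "\<gamma> (s + t) = \<gamma> s \<otimes> \<gamma> t"
      unfolding \<gamma>_def lie_exp_add[OF V(1)] lie_exp_add[OF V(2)] by (metis m_assoc m_closed)
    show "((\<lambda>s. snd c (\<gamma> s)) has_vector_derivative v + w) (at 0)"
      unfolding has_vector_derivative_lg \<gamma>_def
      by (rule ops_product_derivative[OF lie_exp_ops[OF V(1)] lie_exp_ops[OF V(2)]])
  qed
  from ops_eq_lie_exp[OF V_add[OF V] this, of 1] show ?thesis by (simp add: \<gamma>_def)
qed

text \<open>Closed subgroup theorem for \<open>T\<close>. If \<open>g \<in> T\<close> near the identity is not in \<open>exp \<tau>\<close>, minimise
  the distance of \<open>exp (-h) g\<close> from the identity over \<open>h \<in> \<tau>\<close>. The minimisers \<open>x\<close> approach the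
  identity in a direction \<open>w\<close>, and \<open>exp (s w)\<close> is a limit of powers of minimisers, so that
  \<open>w \<in> \<tau>\<close>; then moving \<open>h\<close> in the direction \<open>w\<close> contradicts minimality.\<close>

lemma minimal_remainder:
  assumes g: "g \<in> T" "g \<in> fst c" "norm (lg g) < mrad / 128" and notin: "g \<notin> E ` \<tau>"
  obtains x where "x \<in> V" "x \<noteq> 0" "norm x \<le> norm (lg g)" "psi x \<in> T"
    "\<And>u. u \<in> \<tau> \<Longrightarrow> norm u \<le> mrad / 16 \<Longrightarrow> norm x \<le> norm (lmul (lg (E (- u))) x)"
proof -
  \<comment> \<open>The radius up to which \<open>lie_exp_small\<close> and
    \<open>lie_exp_lipschitz\<close> apply.\<close>
  define R where "R = mrad / 8"
  have R: "R > 0" using mrad_pos by (simp add: R_def)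
  define B where "B = \<tau> \<inter> cball 0 R"
  define y where "y = lg g"
  have y: "y \<in> V" "norm y < mrad" "psi y = g" using g lg_V mrad_pos psi_lg by (auto simp: y_def)
  define f where "f h = lmul (lg (E (- h))) y" for h
  have B: "- h \<in> V" "norm (- h) \<le> mrad / 8" "h \<in> V" "- h \<in> \<tau>" if "h \<in> B" for h
    using that torus_dual_V torus_dual_neg by (auto simp: B_def R_def)
  have lE: "E h \<in> fst c" "lg (E h) \<in> V" "norm (lg (E h)) < mrad" if "h \<in> V" "norm h \<le> mrad / 8" for h
    using lie_exp_small(1,2)[OF that] lg_V that mrad_pos by auto
  have compB: "compact B" unfolding B_def
    by (intro closed_Int_compact closed_subspace[OF subspace_torus_dual] compact_cball)
  have zB: "0 \<in> B" using torus_dual_0 R by (simp add: B_def)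
  \<comment> \<open>Gives the continuity that a minimiser on the compact set \<open>B\<close>
    requires. The constant is 2 for the left factor of a product times 3 for the
    exponential.\<close>
  have "6-lipschitz_on B f"
  proof (rule lipschitz_onI)
    fix h h' assume h: "h \<in> B" "h' \<in> B"
    define a where "a = lg (E (- h))"
    define a' where "a' = lg (E (- h'))"
    have "norm (f h - f h' - (a - a')) \<le> mC * norm y * norm (a - a')"
      unfolding f_def a_def a'_def by (rule lmul_left) (use lE B h y in auto)
    also have "\<dots> \<le> 1 * norm (a - a')"
    proof (rule mult_right_mono)
      have "mC * norm y \<le> mC * mrad" using y mC_nonneg by (intro mult_left_mono) auto
      then show "mC * norm y \<le> 1" using mC_mrad by simp
    qed simp
    finally have "norm (f h - f h') \<le> 2 * norm (a - a')"
      using norm_triangle_sub[of "f h - f h'" "a - a'"] by simp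
    moreover have "norm (a - a') \<le> 3 * norm (h - h')"
      using lie_exp_lipschitz[OF B(1,2)[OF h(1)] B(1,2)[OF h(2)]]
      by (simp add: a_def a'_def norm_minus_commute)
    ultimately show "dist (f h) (f h') \<le> 6 * dist h h'" by (simp add: dist_norm)
  qed simp
  then have "continuous_on B (\<lambda>h. norm (f h))"
    by (intro continuous_on_norm lipschitz_on_continuous_on)
  then obtain h where h: "h \<in> B" and min: "\<And>h'. h' \<in> B \<Longrightarrow> norm (f h) \<le> norm (f h')"
    using continuous_attains_inf[OF compB] zB by blast
  define x where "x = f h"
  define b where "b = lg (E (- h))"
  have b: "b \<in> V" "norm b < mrad" "psi b = E (- h)"
    using lE[OF B(1,2)[OF h]] psi_lg by (auto simp: b_def)
  have xV: "x \<in> V" and px: "psi x = E (- h) \<otimes> g"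
    using lmul_V[OF b(1) y(1) b(2) y(2)] psi_lmul[OF b(1) y(1) b(2) y(2)] b(3) y(3)
    by (simp_all add: x_def f_def b_def)
  have "f 0 = y" using lmul_0_left[OF y(1)] y(2) mrad_le by (simp add: f_def lie_exp_0)
  then have xy: "norm x \<le> norm y" using min[OF zB] by (simp add: x_def)
  have gc: "g \<in> carrier K" using T_carrier[OF g(1)] .
  have hT: "h \<in> \<tau>" "h \<in> V" "norm h \<le> mrad / 8" using h torus_dual_V by (auto simp: B_def R_def)
  have EhE: "E h \<otimes> psi x = g"
    unfolding px using lie_exp_carrier[OF hT(2)] gc by (simp add: lie_exp_minus[OF hT(2)] m_assoc[symmetric])
  have pxT: "psi x \<in> T" unfolding px by (intro T_mult g lie_exp_in_T B h)
  have xr: "norm x < mrad" using xy y by simp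
  have x0: "x \<noteq> 0"
  proof
    assume "x = 0"
    then have "g = E h" using EhE lie_exp_carrier[OF hT(2)] by simp
    then show False using notin hT by blast
  qed
  \<comment> \<open>The minimiser has to lie well inside \<open>B\<close>, so that h + u stays in
    \<open>B\<close>. From exp h * psi x = g with x and y both small, norm a \<le> 4 * norm y and
    norm h \<le> 2 * norm a. Thus norm h \<le> 8 * mrad / 128 = mrad / 16, half the radius of
    \<open>B\<close>; this is the origin of the 128 in the hypothesis.\<close>
  define a where "a = lg (E h)"
  note Eh = lE[OF hT(2,3)]
  have a: "a \<in> V" "norm a < mrad" "psi a = E h" using Eh psi_lg by (auto simp: a_def)
  have "lmul a x = y" by (simp add: lmul_def a(3) EhE y_def)
  then have "norm (y - a - x) \<le> mC * norm a * norm x" using lmul_approx[OF a(1) xV a(2) xr] by simp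
  also have "\<dots> = mC * norm x * norm a" by simp
  also have "\<dots> \<le> 1/8 * norm a"
    using xy g mrad_pos by (intro mult_right_mono mC_le) (auto simp: y_def)
  finally have "norm (y - a - x) \<le> 1/8 * norm a" .
  moreover have "norm a \<le> norm y + norm x + norm (y - a - x)"
    by norm
  ultimately have "norm a \<le> 4 * norm y" using xy norm_ge_zero[of y] by linarith
  moreover have "norm h \<le> 2 * norm a"
  proof -
    have "norm (a - h) \<le> 2 * mC * (norm h)\<^sup>2" using lie_exp_small(3)[OF hT(2,3)] by (simp add: a_def)
    also have "\<dots> = 2 * (mC * norm h) * norm h" by (simp add: power2_eq_square)
    also have "\<dots> \<le> 2 * (1/8) * norm h"
      using hT mrad_pos by (intro mult_right_mono mult_left_mono mC_le) auto
    finally show ?thesis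
      using norm_triangle_sub[of h a] norm_ge_zero[of a] norm_minus_commute[of h a] by linarith
  qed
  ultimately have hs: "norm h \<le> mrad / 16" using g(3) by (simp add: y_def)
  show ?thesis
  proof (rule that[OF xV x0 _ pxT])
    show "norm x \<le> norm (lg g)" using xy by (simp add: y_def)
    fix u assume u: "u \<in> \<tau>" "norm u \<le> mrad / 16"
    have uV: "u \<in> V" "- u \<in> V" "- u \<in> \<tau>"
      using u torus_dual_V V_neg torus_dual_neg by auto
    have "h + u \<in> B"
      using u hT hs torus_dual_add norm_triangle_ineq[of h u] by (auto simp: B_def R_def)
    then have "norm x \<le> norm (f (h + u))" using min by (simp add: x_def)
    also have "f (h + u) = lmul (lg (E (- u))) x"
    proof -
      note hu = lE[OF B(1,2)[OF \<open>h + u \<in> B\<close>]]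
      have Eu: "E (- u) \<in> fst c" using lE[of "- u"] uV u mrad_pos by simp
      have "- (h + u) = - u + - h" by simp
      then have e: "E (- (h + u)) = E (- u) \<otimes> E (- h)"
        using lie_exp_add_torus[OF uV(3) B(4)[OF h]] by (simp only:)
      have "lmul (lg (E (- u))) x = lg (E (- u) \<otimes> (E (- h) \<otimes> g))"
        by (simp add: lmul_def psi_lg Eu px)
      also have "E (- u) \<otimes> (E (- h) \<otimes> g) = E (- (h + u)) \<otimes> g"
        unfolding e using lie_exp_carrier[OF uV(2)] lie_exp_carrier[OF B(1)[OF h]] gc by (simp add: m_assoc)
      finally show ?thesis using hu(1) y(3) by (simp add: f_def lmul_def psi_lg)
    qed
    finally show "norm x \<le> norm (lmul (lg (E (- u))) x)" .
  qed
qed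

lemma torus_dualI_small:
  assumes w: "w \<in> V" and s0: "s0 > 0" and T: "\<And>s. 0 \<le> s \<Longrightarrow> s \<le> s0 \<Longrightarrow> E (s *\<^sub>R w) \<in> T"
  shows "w \<in> \<tau>"
proof -
  have pos: "E (s *\<^sub>R w) \<in> T" if s: "0 \<le> s" for s
  proof -
    obtain k :: nat where k: "s / s0 < real k" using reals_Archimedean2 by blast
    have kp: "real k > 0" using k s s0 divide_nonneg_pos[of s s0] by linarith
    have "s < real k * s0" using k unfolding pos_divide_less_eq[OF s0] .
    then have "s / real k \<le> s0" using kp by (simp add: pos_divide_le_eq mult.commute)
    moreover have "0 \<le> s / real k" using s kp by simp
    ultimately have "E ((s / real k) *\<^sub>R w) [^] k \<in> T" using T T_pow by blast
    also have "E ((s / real k) *\<^sub>R w) [^] k = E (s *\<^sub>R w)"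
      using lie_exp_mult[OF V_scale[OF w], of k "s / real k"] kp by simp
    finally show ?thesis .
  qed
  have "E (s *\<^sub>R w) \<in> T" for s
  proof (cases "0 \<le> s")
    case False
    then have "inv (E ((- s) *\<^sub>R w)) \<in> T" using pos[of "- s"] T_inv by simp
    then show ?thesis using lie_exp_minus[OF V_scale[OF w], of "- s"] by simp
  qed (rule pos)
  then show ?thesis using w torus_dual_iff by blast
qed

text \<open>Choose k n as the integer part of s / norm (x n), so that k n * x n tends to s w. The
  powers of \<open>psi (x n)\<close> lie in \<open>T\<close>. They differ from exp (k n * x n) by
  O(norm (x n)) only, because \<open>psi\<close> and the exponential agree up to second order and
  \<open>lpow_diff\<close> multiplies that error by k n. Since \<open>T\<close> is closed, exp (s w)
  is in \<open>T\<close>.\<close>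

lemma limit_direction_in_torus_dual:
  assumes x: "\<And>n. x n \<in> V" "\<And>n. x n \<noteq> 0" "\<And>n. psi (x n) \<in> T" and lim: "x \<longlonglongrightarrow> 0"
    and dir: "(\<lambda>n. (1 / norm (x n)) *\<^sub>R x n) \<longlonglongrightarrow> w"
  shows "w \<in> \<tau>"
proof -
  have w: "w \<in> V"
    by (rule closed_sequentially[OF closed_subspace[OF subspace_V] _ dir]) (use x V_scale in auto)
  have nw: "norm w = 1"
  proof -
    have "(\<lambda>n. norm ((1 / norm (x n)) *\<^sub>R x n)) \<longlonglongrightarrow> norm w" by (rule tendsto_norm[OF dir])
    moreover have "norm ((1 / norm (x n)) *\<^sub>R x n) = 1" for n using x(2)[of n] by simp
    ultimately show ?thesis using LIMSEQ_unique[OF tendsto_const] by fastforce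
  qed
  have "E (s *\<^sub>R w) \<in> T" if s: "0 \<le> s" "s \<le> mrad / 8" for s
  proof -
    define k where "k n = nat \<lfloor>s / norm (x n)\<rfloor>" for n
    have kn: "real (k n) * norm (x n) \<le> s" "s - norm (x n) \<le> real (k n) * norm (x n)" for n
    proof -
      have p: "norm (x n) > 0" using x(2)[of n] by simp
      have "0 \<le> s / norm (x n)" using s by simp
      then have r: "real (k n) = of_int \<lfloor>s / norm (x n)\<rfloor>" by (simp add: k_def)
      have "real (k n) \<le> s / norm (x n)" unfolding r by linarith
      then show "real (k n) * norm (x n) \<le> s" unfolding pos_le_divide_eq[OF p] .
      have "s / norm (x n) \<le> real (k n) + 1" unfolding r by linarith
      then show "s - norm (x n) \<le> real (k n) * norm (x n)"
        unfolding pos_divide_le_eq[OF p] by (simp add: algebra_simps)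
    qed
    have nx: "(\<lambda>n. norm (x n)) \<longlonglongrightarrow> 0" using tendsto_norm[OF lim] by simp
    have "(\<lambda>n. real (k n) * norm (x n)) \<longlonglongrightarrow> s"
    proof (rule tendsto_sandwich[where h = "\<lambda>_. s"])
      show "(\<lambda>n. s - norm (x n)) \<longlonglongrightarrow> s" using tendsto_diff[OF tendsto_const nx, of s] by simp
    qed (use kn in \<open>auto intro: always_eventually\<close>)
    from tendsto_scaleR[OF this dir] have kx: "(\<lambda>n. real (k n) *\<^sub>R x n) \<longlonglongrightarrow> s *\<^sub>R w"
      using x(2) by simp
    have kxs: "norm (real (k n) *\<^sub>R x n) \<le> mrad / 8" for n using kn(1)[of n] s by simp
    have sw: "s *\<^sub>R w \<in> V" "norm (s *\<^sub>R w) \<le> mrad / 8"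
      using V_scale[OF w] nw s by auto
    have kV: "real (k n) *\<^sub>R x n \<in> V" for n using V_scale[OF x(1)] .
    have sm: "real (k n) * norm (x n) \<le> mrad / 4" for n using kn(1)[of n] s mrad_pos by linarith
    have "(\<lambda>n. lpow (x n) (k n) - lg (E (s *\<^sub>R w))) \<longlonglongrightarrow> 0"
    proof (rule Lim_null_comparison)
      have "eventually (\<lambda>n. norm (x n) < mrad / 8) sequentially"
        using order_tendstoD(2)[OF nx, of "mrad / 8"] mrad_pos by simp
      then show "\<forall>\<^sub>F n in sequentially. norm (lpow (x n) (k n) - lg (E (s *\<^sub>R w)))
          \<le> 6 * mC * s * norm (x n) + 3 * norm (real (k n) *\<^sub>R x n - s *\<^sub>R w)"
      proof eventually_elim
        case (elim n)
        define y where "y = lg (E (x n))"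
        note Ex = lie_exp_small[OF x(1) less_imp_le[OF elim]]
        have y: "y \<in> V" "psi y = E (x n)" using Ex lg_V psi_lg by (auto simp: y_def)
        have "real (k n) * norm y \<le> real (k n) * (2 * norm (x n))"
          using Ex(2) by (intro mult_left_mono) (auto simp: y_def)
        then have ks: "real (k n) * norm y \<le> mrad / 4" using kn(1)[of n] s by simp
        have "norm (lpow (x n) (k n) - lpow y (k n)) \<le> 3 * real (k n) * norm (x n - y)"
          by (rule lpow_diff[OF x(1) y(1) sm ks])
        also have "\<dots> \<le> 3 * real (k n) * (2 * mC * (norm (x n))\<^sup>2)"
          using Ex(3) by (intro mult_left_mono) (auto simp: y_def norm_minus_commute)
        also have "\<dots> = 6 * mC * (real (k n) * norm (x n)) * norm (x n)" by (simp add: power2_eq_square)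
        also have "\<dots> \<le> 6 * mC * s * norm (x n)"
          using kn(1)[of n] mC_nonneg by (intro mult_right_mono mult_left_mono) auto
        finally have 1: "norm (lpow (x n) (k n) - lpow y (k n)) \<le> 6 * mC * s * norm (x n)" .
        have "lpow y (k n) = lg (E (real (k n) *\<^sub>R x n))"
          by (simp add: lpow_def y(2) lie_exp_mult[OF x(1)])
        then have 2: "norm (lpow y (k n) - lg (E (s *\<^sub>R w))) \<le> 3 * norm (real (k n) *\<^sub>R x n - s *\<^sub>R w)"
          using lie_exp_lipschitz[OF kV kxs sw] by simp
        have "norm (lpow (x n) (k n) - lg (E (s *\<^sub>R w)))
            \<le> norm (lpow (x n) (k n) - lpow y (k n)) + norm (lpow y (k n) - lg (E (s *\<^sub>R w)))"
          by norm
        then show ?case using 1 2 by linarith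
      qed
      have "(\<lambda>n. norm (real (k n) *\<^sub>R x n - s *\<^sub>R w)) \<longlonglongrightarrow> 0"
        using tendsto_norm[OF tendsto_diff[OF kx tendsto_const[of "s *\<^sub>R w"]]] by simp
      then have "(\<lambda>n. 6 * mC * s * norm (x n) + 3 * norm (real (k n) *\<^sub>R x n - s *\<^sub>R w)) \<longlonglongrightarrow> 6 * mC * s * 0 + 3 * 0"
        by (intro tendsto_intros nx)
      then show "(\<lambda>n. 6 * mC * s * norm (x n) + 3 * norm (real (k n) *\<^sub>R x n - s *\<^sub>R w)) \<longlonglongrightarrow> 0"
        by simp
    qed
    then have L: "(\<lambda>n. lpow (x n) (k n)) \<longlonglongrightarrow> lg (E (s *\<^sub>R w))" by (rule LIM_zero_cancel)
    note Es = lie_exp_small[OF sw]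
    have "limitin (topol K) (\<lambda>n. psi (lpow (x n) (k n))) (psi (lg (E (s *\<^sub>R w)))) sequentially"
    proof (rule limitin_psi[OF L lg_V[OF Es(1)]])
      show "norm (lg (E (s *\<^sub>R w))) < rad" using Es(2) sw(2) mrad_le mrad_pos by linarith
    qed (use lpow_V[OF x(1) sm] in simp)
    then have "limitin (topol K) (\<lambda>n. psi (x n) [^] k n) (E (s *\<^sub>R w)) sequentially"
      by (simp add: psi_lpow[OF x(1) sm] psi_lg[OF Es(1)])
    then show ?thesis
      by (rule limitin_closedin[OF _ T_closed]) (use T_pow x(3) in auto)
  qed
  then show ?thesis using torus_dualI_small[OF w, of "mrad / 8"] mrad_pos by simp
qed

lemma torus_local_exp:
  obtains d where "d > 0" "\<And>g. g \<in> T \<Longrightarrow> g \<in> fst c \<Longrightarrow> norm (lg g) < d \<Longrightarrow> g \<in> E ` \<tau>"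
proof (rule ccontr)
  assume "\<not> thesis"
  then have no: "\<And>d. d > 0 \<Longrightarrow> \<exists>g. g \<in> T \<and> g \<in> fst c \<and> norm (lg g) < d \<and> g \<notin> E ` \<tau>"
    using that by blast
  have "\<exists>x. x \<in> V \<and> x \<noteq> 0 \<and> norm x < (mrad / 128) * (1 / real (Suc n)) \<and> psi x \<in> T \<and>
      (\<forall>u\<in>\<tau>. norm u \<le> mrad / 16 \<longrightarrow> norm x \<le> norm (lmul (lg (E (- u))) x))" for n
  proof -
    have "(mrad / 128) * (1 / real (Suc n)) > 0" using mrad_pos by simp
    from no[OF this] obtain g where g: "g \<in> T" "g \<in> fst c" "norm (lg g) < (mrad / 128) * (1 / real (Suc n))" "g \<notin> E ` \<tau>"
      by blast
    have "(mrad / 128) * (1 / real (Suc n)) \<le> (mrad / 128) * 1"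
      using mrad_pos by (intro mult_left_mono) auto
    then have "norm (lg g) < mrad / 128" using g by linarith
    then obtain x where x: "x \<in> V" "x \<noteq> 0" "norm x \<le> norm (lg g)" "psi x \<in> T"
      "\<And>u. u \<in> \<tau> \<Longrightarrow> norm u \<le> mrad / 16 \<Longrightarrow> norm x \<le> norm (lmul (lg (E (- u))) x)"
      by (rule minimal_remainder[OF g(1,2) _ g(4)]) blast
    have "norm x < (mrad / 128) * (1 / real (Suc n))" using x(3) g(3) by linarith
    then show ?thesis using x by blast
  qed
  then obtain x where x: "\<And>n. x n \<in> V" "\<And>n. x n \<noteq> 0" "\<And>n. norm (x n) < (mrad / 128) * (1 / real (Suc n))"
    "\<And>n. psi (x n) \<in> T" "\<And>n u. u \<in> \<tau> \<Longrightarrow> norm u \<le> mrad / 16 \<Longrightarrow> norm (x n) \<le> norm (lmul (lg (E (- u))) (x n))"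
    by metis
  have xlim: "x \<longlonglongrightarrow> 0"
  proof (rule Lim_null_comparison)
    show "\<forall>\<^sub>F n in sequentially. norm (x n) \<le> (mrad / 128) * (1 / real (Suc n))"
      using x(3) by (intro always_eventually allI less_imp_le)
    have "(\<lambda>n. (mrad / 128) * (1 / real (Suc n))) \<longlonglongrightarrow> (mrad / 128) * 0"
      by (intro tendsto_mult_left LIMSEQ_Suc[OF lim_1_over_n])
    then show "(\<lambda>n. (mrad / 128) * (1 / real (Suc n))) \<longlonglongrightarrow> 0" by simp
  qed
  have "\<forall>n. (1 / norm (x n)) *\<^sub>R x n \<in> sphere 0 1" using x(2) by simp
  then obtain w r where r: "strict_mono (r :: nat \<Rightarrow> nat)"
    and w: "((\<lambda>n. (1 / norm (x n)) *\<^sub>R x n) \<circ> r) \<longlonglongrightarrow> w"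
    using compact_sphere[of "0::'e" 1] unfolding compact_def by meson
  define z where "z n = x (r n)" for n
  have zlim: "z \<longlonglongrightarrow> 0" using LIMSEQ_subseq_LIMSEQ[OF xlim r] unfolding z_def o_def .
  have zw: "(\<lambda>n. (1 / norm (z n)) *\<^sub>R z n) \<longlonglongrightarrow> w" using w by (simp add: z_def o_def)
  have wt: "w \<in> \<tau>"
    by (rule limit_direction_in_torus_dual[OF _ _ _ zlim zw]) (use x in \<open>auto simp: z_def\<close>)
  have nw: "norm w = 1"
  proof -
    have "(\<lambda>n. norm ((1 / norm (z n)) *\<^sub>R z n)) \<longlonglongrightarrow> norm w" by (rule tendsto_norm[OF zw])
    moreover have "norm ((1 / norm (z n)) *\<^sub>R z n) = 1" for n using x(2) by (simp add: z_def)
    ultimately show ?thesis using LIMSEQ_unique[OF tendsto_const] by fastforce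
  qed
  have nz: "(\<lambda>n. norm (z n)) \<longlonglongrightarrow> 0" using tendsto_norm[OF zlim] by simp
  \<comment> \<open>Scale w to the length of z n and call it u. Multiplication by exp (-u) changes
    the coordinate z n into z n - u up to second order, and by minimality the result is no shorter
    than z n. Division by norm (z n) gives this inequality, whose right-hand side tends to
    0.\<close>
  have bound: "1 \<le> norm ((1 / norm (z n)) *\<^sub>R z n - w) + 4 * mC * norm (z n)" for n
  proof -
    define u where "u = norm (z n) *\<^sub>R w"
    have zV: "z n \<in> V" and z0: "norm (z n) > 0" and zs: "norm (z n) < mrad / 128"
    proof -
      have "(mrad / 128) * (1 / real (Suc (r n))) \<le> (mrad / 128) * 1"
        using mrad_pos by (intro mult_left_mono) auto
      then show "norm (z n) < mrad / 128" using x(3)[of "r n"] unfolding z_def by linarith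
    qed (use x in \<open>auto simp: z_def\<close>)
    have u: "u \<in> \<tau>" "norm u = norm (z n)" "- u \<in> V"
      using torus_dual_scale[OF wt] nw torus_dual_V V_neg by (auto simp: u_def)
    have us: "norm (- u) \<le> mrad / 8" using u zs mrad_pos by simp
    note Eu = lie_exp_small[OF u(3) us]
    define a where "a = lg (E (- u))"
    have a: "a \<in> V" "norm a < mrad" "norm a \<le> 2 * norm (z n)" "norm (a + u) \<le> 2 * mC * (norm (z n))\<^sup>2"
      using Eu lg_V u zs mrad_pos by (auto simp: a_def)
    have "norm (z n) \<le> norm (lmul a (z n))"
      unfolding a_def z_def by (rule x(5)[OF u(1)]) (use u zs mrad_pos in simp)
    also have "\<dots> \<le> norm (z n - u) + norm (a + u) + norm (lmul a (z n) - a - z n)"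
    proof -
      have "lmul a (z n) = (z n - u) + (a + u) + (lmul a (z n) - a - z n)" by simp
      moreover have "norm (p + q + l) \<le> norm p + norm q + norm l" for p q l :: 'e by norm
      ultimately show ?thesis by metis
    qed
    also have "norm (lmul a (z n) - a - z n) \<le> mC * norm a * norm (z n)"
      using lmul_approx[OF a(1) zV a(2)] zs mrad_pos by simp
    also have "mC * norm a * norm (z n) \<le> mC * (2 * norm (z n)) * norm (z n)"
      using a(3) mC_nonneg by (intro mult_right_mono mult_left_mono) auto
    finally have "norm (z n) \<le> norm (z n - u) + 2 * mC * (norm (z n))\<^sup>2 + mC * (2 * norm (z n)) * norm (z n)"
      using a(4) by linarith
    also have "norm (z n - u) = norm (z n) * norm ((1 / norm (z n)) *\<^sub>R z n - w)"
    proof -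
      have "z n - u = norm (z n) *\<^sub>R ((1 / norm (z n)) *\<^sub>R z n - w)"
        using z0 by (simp add: u_def scaleR_diff_right)
      then show ?thesis by (metis norm_scaleR abs_norm_cancel)
    qed
    finally have "norm (z n) * 1 \<le> norm (z n) * (norm ((1 / norm (z n)) *\<^sub>R z n - w) + 4 * mC * norm (z n))"
      by (simp add: power2_eq_square algebra_simps)
    then show ?thesis using z0 mult_le_cancel_left_pos by blast
  qed
  have "(\<lambda>n. norm ((1 / norm (z n)) *\<^sub>R z n - w)) \<longlonglongrightarrow> 0"
    using tendsto_norm[OF tendsto_diff[OF zw tendsto_const[of w]]] by simp
  then have "(\<lambda>n. norm ((1 / norm (z n)) *\<^sub>R z n - w) + 4 * mC * norm (z n)) \<longlonglongrightarrow> 0 + 4 * mC * 0"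
    by (intro tendsto_intros nz)
  then have "1 \<le> 0 + 4 * mC * 0"
    by (rule tendsto_lowerbound) (use bound in auto)
  then show False by simp
qed

text \<open>A connected group is generated by any neighbourhood of the identity: \<open>Q\<close> is
  constant on the intersection of \<open>T\<close> with each translate of \<open>N\<close>, so the
  points where it holds and those where it fails would disconnect \<open>T\<close>.\<close>

lemma torus_generated:
  assumes N: "openin (topol K) N" "\<one> \<in> N" and Q: "\<And>g. g \<in> T \<Longrightarrow> g \<in> N \<Longrightarrow> Q g"
    and mult: "\<And>s t. s \<in> T \<Longrightarrow> t \<in> T \<Longrightarrow> Q s \<Longrightarrow> Q t \<Longrightarrow> Q (s \<otimes> t)"
    and inv: "\<And>t. t \<in> T \<Longrightarrow> Q t \<Longrightarrow> Q (inv t)"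
    and t: "t \<in> T"
  shows "Q t"
proof (rule ccontr)
  assume nQ: "\<not> Q t"
  define W where "W g = {h \<in> carrier K. inv g \<otimes> h \<in> N}" for g
  have Wo: "openin (topol K) (W g)" if "g \<in> T" for g
    unfolding W_def using left_translate_open[OF N(1) inv_closed[OF T_carrier[OF that]]] .
  have Wg: "g \<in> W g" if "g \<in> T" for g using T_carrier[OF that] N by (simp add: W_def)
  have Qiff: "Q h \<longleftrightarrow> Q g" if "g \<in> T" "h \<in> T" "h \<in> W g" for g h
  proof -
    have n: "inv g \<otimes> h \<in> T" "Q (inv g \<otimes> h)" using that T_mult T_inv Q by (auto simp: W_def)
    have h: "h = g \<otimes> (inv g \<otimes> h)" and g: "g = h \<otimes> inv (inv g \<otimes> h)"
      using that T_carrier by (simp_all add: m_assoc[symmetric] inv_mult_group)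
    show ?thesis using mult[OF that(1) n(1) _ n(2)] mult[OF that(2) T_inv[OF n(1)] _ inv[OF n]] h g by metis
  qed
  define A where "A = (\<Union>g\<in>{g\<in>T. Q g}. W g)"
  define B where "B = (\<Union>g\<in>{g\<in>T. \<not> Q g}. W g)"
  have "openin (topol K) A" "openin (topol K) B" unfolding A_def B_def using Wo by auto
  moreover have "T \<subseteq> A \<union> B" unfolding A_def B_def using Wg by blast
  moreover have "A \<inter> B \<inter> T = {}" unfolding A_def B_def using Qiff by blast
  moreover have "t \<in> B \<inter> T" using t nQ Wg unfolding B_def by blast
  moreover have "\<one> \<in> A \<inter> T" using T_one Q N Wg unfolding A_def by blast
  ultimately show False using T_connected unfolding connectedin by blast
qed

text \<open>Roots are tested on exp \<tau> only, while \<tau> is defined by invariance under all of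
  \<open>T\<close>. Near the identity \<open>T\<close> consists of exponentials, and these generate
  \<open>T\<close>. In other words, the centralizer of Lie(T) is Lie(T).\<close>

lemma torus_dualI:
  assumes W: "W \<in> V" and fix_W: "\<And>H. H \<in> \<tau> \<Longrightarrow> Ad K c (E H) W = W"
  shows "W \<in> \<tau>"
proof -
  obtain d where d: "d > 0" "\<And>g. g \<in> T \<Longrightarrow> g \<in> fst c \<Longrightarrow> norm (lg g) < d \<Longrightarrow> g \<in> E ` \<tau>"
    using torus_local_exp by blast
  have "Ad K c t W = W" if "t \<in> T" for t
  proof (rule torus_generated[where Q = "\<lambda>t. Ad K c t W = W", OF _ _ _ _ _ that])
    show "openin (topol K) {g \<in> fst c. lg g \<in> ball 0 d}" by (rule openin_lg_preimage) simp
    show "\<one> \<in> {g \<in> fst c. lg g \<in> ball 0 d}" using one_in_chart d by simp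
    show "Ad K c g W = W" if "g \<in> T" "g \<in> {g \<in> fst c. lg g \<in> ball 0 d}" for g
      using d(2)[of g] that fix_W by auto
    show "Ad K c (s \<otimes> t) W = W" if "s \<in> T" "t \<in> T" "Ad K c s W = W" "Ad K c t W = W" for s t
      using that Ad_mult[OF T_carrier T_carrier W] by simp
    show "Ad K c (inv t) W = W" if "t \<in> T" "Ad K c t W = W" for t
      using that Ad_inv_Ad[OF T_carrier W] by metis
  qed
  then show ?thesis using W by (simp add: torus_dual_def)
qed

end

section \<open>Roots\<close>

locale lie_roots = lie_torus K c T
  for K :: "('g, 'e::euclidean_space) lie_data" (structure) and c and T +
  fixes ip :: "'e \<Rightarrow> 'e \<Rightarrow> real"
  assumes inv_ip: "invariant_inner_product K c ip"
begin

sublocale ip: subspace_ip "model K" ip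
  using inv_ip subspace_V unfolding invariant_inner_product_def by unfold_locales auto

lemma ip_Ad: "g \<in> carrier K \<Longrightarrow> x \<in> V \<Longrightarrow> y \<in> V \<Longrightarrow> ip (Ad K c g x) (Ad K c g y) = ip x y"
  using inv_ip by (simp add: invariant_inner_product_def)

text \<open>\<open>ip\<close> is bilinear on the model space only and arbitrary elsewhere; composing
  with a projection produces a bounded linear functional on the ambient space.\<close>

lemma ip_has_vector_derivative:
  assumes f: "(f has_vector_derivative f') (at t)" and fV: "\<And>s. f s \<in> V" and H: "H \<in> V"
  shows "((\<lambda>s. ip (f s) H) has_vector_derivative ip f' H) (at t)"
proof -
  obtain p where p: "bounded_linear p" "\<And>x. x \<in> V \<Longrightarrow> p x = x" "\<And>x. p x \<in> V"
    using linear_projection_exists[OF subspace_V] by metis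
  have "linear (\<lambda>x. ip (p x) H)"
    using p(3) H bounded_linear.linear[OF p(1)]
    by (intro linearI) (simp_all add: linear_add linear_scale ip.ip_add_left ip.ip_scale_left)
  then have "bounded_linear (\<lambda>x. ip (p x) H)" by (simp add: linear_conv_bounded_linear)
  from bounded_linear.has_vector_derivative[OF this f]
  have "((\<lambda>s. ip (p (f s)) H) has_vector_derivative ip (p f') H) (at t)" .
  moreover have "f' \<in> V" by (rule derivative_in_subspace[OF subspace_V f zero_less_one]) (rule fV)
  ultimately show ?thesis using p(2) fV by simp
qed

text \<open>The derivative at 0 of the invariance of \<open>ip\<close> under exp (s X), with the
  group element moved to the other argument as exp (-s X).\<close>

lemma ip_bracket:
  assumes X: "X \<in> V" and Y: "Y \<in> V" and H: "H \<in> V"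
  shows "ip (bracket X Y) H = - ip Y (bracket X H)"
proof -
  have mX: "- X \<in> V" using V_neg[OF X] .
  have Ec: "E (s *\<^sub>R X) \<in> carrier K" "E (s *\<^sub>R (- X)) \<in> carrier K" for s
    by (rule E_scale_carrier[OF X], rule E_scale_carrier[OF mX])
  have inv: "E (s *\<^sub>R (- X)) = inv (E (s *\<^sub>R X))" for s
    using ops_minus[OF lie_exp_ops[OF X], of s] by simp
  have "((\<lambda>s. ip (Ad K c (E (s *\<^sub>R X)) Y) H) has_vector_derivative ip (bracket X Y) H) (at 0)"
    by (rule ip_has_vector_derivative[OF bracket_derivative_0[OF X Y] _ H]) (intro Ad_V Ec Y)
  moreover have "((\<lambda>s. ip (Ad K c (E (s *\<^sub>R (- X))) H) Y) has_vector_derivative ip (bracket (- X) H) Y) (at 0)"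
    by (rule ip_has_vector_derivative[OF bracket_derivative_0[OF mX H] _ Y]) (intro Ad_V Ec H)
  moreover have "ip (Ad K c (E (s *\<^sub>R X)) Y) H = ip (Ad K c (E (s *\<^sub>R (- X))) H) Y" for s
  proof -
    have "ip (Ad K c (E (s *\<^sub>R X)) Y) H = ip (Ad K c (E (s *\<^sub>R X)) Y) (Ad K c (E (s *\<^sub>R X)) (Ad K c (E (s *\<^sub>R (- X))) H))"
      unfolding inv using Ad_Ad_inv[OF Ec(1) H] by simp
    also have "\<dots> = ip Y (Ad K c (E (s *\<^sub>R (- X))) H)" by (rule ip_Ad[OF Ec(1) Y Ad_V[OF Ec(2) H]])
    finally show ?thesis using ip.ip_sym[OF Y Ad_V[OF Ec(2) H]] by simp
  qed
  ultimately have "ip (bracket X Y) H = ip (bracket (- X) H) Y" using vector_derivative_unique_at by fastforce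
  also have "bracket (- X) H = - bracket X H" using bracket_scale_left[OF X H, of "-1"] by simp
  also have "ip (- bracket X H) Y = - ip Y (bracket X H)"
    using ip.ip_minus_left[OF bracket_V[OF X H] Y] ip.ip_sym[OF bracket_V[OF X H] Y] by simp
  finally show ?thesis .
qed

text \<open>The real form of the eigenvector equation in \<open>roots\<close>: for a complex root
  vector X + iY, multiplication by exp (i (\<alpha>, H)) rotates the pair of its real and imaginary
  parts.\<close>

definition root_vector :: "'e \<Rightarrow> 'e \<Rightarrow> 'e \<Rightarrow> bool" where
  "root_vector \<alpha> X Y \<longleftrightarrow> X \<in> V \<and> Y \<in> V \<and> (X \<noteq> 0 \<or> Y \<noteq> 0) \<and>
     (\<forall>H\<in>\<tau>. Ad K c (E H) X = cos (ip \<alpha> H) *\<^sub>R X - sin (ip \<alpha> H) *\<^sub>R Y \<and>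
            Ad K c (E H) Y = sin (ip \<alpha> H) *\<^sub>R X + cos (ip \<alpha> H) *\<^sub>R Y)"

lemma roots_iff: "\<alpha> \<in> roots K c T ip \<longleftrightarrow> \<alpha> \<in> \<tau> \<and> \<alpha> \<noteq> 0 \<and> (\<exists>X Y. root_vector \<alpha> X Y)"
  unfolding roots_def lie_subalgebra_eq root_vector_def
  by (auto simp: scaleC_pair_def cis_conv_exp[symmetric] zero_prod_def Bex_def)

lemma root_vectorD:
  assumes "root_vector \<alpha> X Y"
  shows "X \<in> V" "Y \<in> V"
    "\<And>H. H \<in> \<tau> \<Longrightarrow> Ad K c (E H) X = cos (ip \<alpha> H) *\<^sub>R X - sin (ip \<alpha> H) *\<^sub>R Y"
    "\<And>H. H \<in> \<tau> \<Longrightarrow> Ad K c (E H) Y = sin (ip \<alpha> H) *\<^sub>R X + cos (ip \<alpha> H) *\<^sub>R Y"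
  using assms by (auto simp: root_vector_def)

lemma root_vector_bracket:
  assumes r: "root_vector \<alpha> X Y" and \<alpha>: "\<alpha> \<in> \<tau>" and H: "H \<in> \<tau>"
  shows "bracket H X = - ip \<alpha> H *\<^sub>R Y" "bracket H Y = ip \<alpha> H *\<^sub>R X"
proof -
  note D = root_vectorD[OF r]
  have ips: "ip \<alpha> (s *\<^sub>R H) = s * ip \<alpha> H" for s
    using ip.ip_scale_right torus_dual_V \<alpha> H by auto
  have sH: "s *\<^sub>R H \<in> \<tau>" for s using torus_dual_scale[OF H] .
  show "bracket H X = - ip \<alpha> H *\<^sub>R Y"
  proof (rule bracket_eqI)
    have "((\<lambda>s. cos (s * ip \<alpha> H) *\<^sub>R X - sin (s * ip \<alpha> H) *\<^sub>R Y) has_vector_derivative - ip \<alpha> H *\<^sub>R Y) (at 0)"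
      by (auto intro!: derivative_eq_intros simp: has_real_derivative_iff_has_vector_derivative[symmetric])
    then show "((\<lambda>s. Ad K c (E (s *\<^sub>R H)) X) has_vector_derivative - ip \<alpha> H *\<^sub>R Y) (at 0)"
      by (simp add: D(3)[OF sH] ips)
  qed
  show "bracket H Y = ip \<alpha> H *\<^sub>R X"
  proof (rule bracket_eqI)
    have "((\<lambda>s. sin (s * ip \<alpha> H) *\<^sub>R X + cos (s * ip \<alpha> H) *\<^sub>R Y) has_vector_derivative ip \<alpha> H *\<^sub>R X) (at 0)"
      by (auto intro!: derivative_eq_intros simp: has_real_derivative_iff_has_vector_derivative[symmetric])
    then show "((\<lambda>s. Ad K c (E (s *\<^sub>R H)) Y) has_vector_derivative ip \<alpha> H *\<^sub>R X) (at 0)"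
      by (simp add: D(4)[OF sH] ips)
  qed
qed

lemma torus_element_with_angle:
  assumes "\<alpha> \<in> \<tau>" "\<alpha> \<noteq> 0"
  obtains H where "H \<in> \<tau>" "ip \<alpha> H = x"
proof (rule that)
  show "(x / ip \<alpha> \<alpha>) *\<^sub>R \<alpha> \<in> \<tau>" using torus_dual_scale[OF assms(1)] .
  show "ip \<alpha> ((x / ip \<alpha> \<alpha>) *\<^sub>R \<alpha>) = x"
    using ip.ip_pos[of \<alpha>] assms torus_dual_V by (simp add: ip.ip_scale_right)
qed

text \<open>A quarter turn carries Y to X, so invariance gives both the same norm, and they do not
  both vanish.\<close>

lemma root_vector_norm_pos:
  assumes r: "root_vector \<alpha> X Y" and \<alpha>: "\<alpha> \<in> \<tau>" "\<alpha> \<noteq> 0"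
  shows "ip Y Y > 0"
proof -
  note D = root_vectorD[OF r]
  obtain H where H: "H \<in> \<tau>" "ip \<alpha> H = pi / 2" using torus_element_with_angle[OF \<alpha>] .
  have Ad: "Ad K c (E H) Y = X" using D(4)[OF H(1)] H(2) by simp
  have "ip X X = ip Y Y"
    using ip_Ad[OF lie_exp_carrier[OF torus_dual_V[OF H(1)]] D(2) D(2)] Ad by simp
  moreover have "ip X X > 0 \<or> ip Y Y > 0" 
    using r ip.ip_pos[OF D(1)] ip.ip_pos[OF D(2)] unfolding root_vector_def by blast
  ultimately show ?thesis by auto
qed

text \<open>exp H rotates the pair X, Y, and an antisymmetric bilinear expression is unchanged by a
  rotation. So the bracket is fixed by exp \<tau> and lies in \<tau> by \<open>torus_dualI\<close>.
  There it is determined by its pairings with \<tau>, which \<open>ip_bracket\<close>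
  computes.\<close>

lemma bracket_root_vector:
  assumes r: "root_vector \<alpha> X Y" and \<alpha>: "\<alpha> \<in> \<tau>"
  shows "bracket X Y = - ip Y Y *\<^sub>R \<alpha>"
proof -
  note D = root_vectorD[OF r]
  define W where "W = bracket X Y"
  have WV: "W \<in> V" using bracket_V D by (simp add: W_def)
  have W: "W \<in> \<tau>"
  proof (rule torus_dualI[OF WV])
    fix H assume H: "H \<in> \<tau>"
    define p where "p = cos (ip \<alpha> H)"
    define q where "q = sin (ip \<alpha> H)"
    have pq: "p * p + q * q = 1" unfolding p_def q_def
      using sin_cos_squared_add2[of "ip \<alpha> H"] by (simp add: power2_eq_square)
    have pqV: "p *\<^sub>R X \<in> V" "(- q) *\<^sub>R Y \<in> V" "q *\<^sub>R X \<in> V" "p *\<^sub>R Y \<in> V"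
      using D V_scale by blast+
    have "Ad K c (E H) W = bracket (Ad K c (E H) X) (Ad K c (E H) Y)"
      unfolding W_def using Ad_bracket lie_exp_carrier torus_dual_V H D by simp
    also have "\<dots> = bracket (p *\<^sub>R X + (- q) *\<^sub>R Y) (q *\<^sub>R X + p *\<^sub>R Y)"
      using D(3)[OF H] D(4)[OF H] by (simp add: p_def q_def)
    also have "\<dots> = p *\<^sub>R (q *\<^sub>R bracket X X + p *\<^sub>R bracket X Y) + (- q) *\<^sub>R (q *\<^sub>R bracket Y X + p *\<^sub>R bracket Y Y)"
      using pqV D V_add
      by (simp add: bracket_add_left bracket_add_right bracket_scale_left bracket_scale_right del: scaleR_minus_left)
        (simp add: algebra_simps)
    also have "\<dots> = (p * p + q * q) *\<^sub>R W"
      using bracket_anticommute[OF D(2,1)] by (simp add: bracket_self D W_def scaleR_add_left)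
    finally show "Ad K c (E H) W = W" unfolding pq by simp
  qed
  have ipW: "ip W H = - (ip \<alpha> H * ip Y Y)" if H: "H \<in> \<tau>" for H
  proof -
    have HV: "H \<in> V" using torus_dual_V[OF H] .
    have "ip W H = - ip Y (bracket X H)" unfolding W_def by (rule ip_bracket[OF D(1,2) HV])
    also have "bracket X H = ip \<alpha> H *\<^sub>R Y"
      using bracket_anticommute[OF D(1) HV] root_vector_bracket(1)[OF r \<alpha> H] by simp
    finally show ?thesis using ip.ip_scale_right[OF D(2) D(2)] by simp
  qed
  \<comment> \<open>By \<open>ipW\<close> this vector is orthogonal to all of \<tau>, hence to
    itself.\<close>
  define Z where "Z = W + ip Y Y *\<^sub>R \<alpha>"
  have Z: "Z \<in> \<tau>" unfolding Z_def
    by (intro torus_dual_add torus_dual_scale W \<alpha>)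
  have "ip Z Z = ip W Z + ip Y Y * ip \<alpha> Z"
    using WV torus_dual_V[OF \<alpha>] torus_dual_V[OF Z] V_scale
    by (subst Z_def) (simp add: ip.ip_add_left ip.ip_scale_left)
  then have "ip Z Z = 0" using ipW[OF Z] by simp
  then have "Z = 0" using ip.ip_self_eq_0 torus_dual_V[OF Z] by blast
  then show ?thesis by (simp add: Z_def W_def eq_neg_iff_add_eq_0)
qed

section \<open>Reflections realised by the adjoint action\<close>

lemma Ad_lie_exp_constant:
  assumes "X \<in> V" "Y \<in> V" "bracket X Y = 0" shows "Ad K c (E (s *\<^sub>R X)) Y = Y"
proof -
  have "Ad K c (E (t *\<^sub>R X)) 0 = 0" for t
    using Ad_zero[OF E_scale_carrier[OF assms(1)]] .
  then have "((\<lambda>s. Ad K c (E (s *\<^sub>R X)) Y) has_vector_derivative 0) (at t)" for t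
    using bracket_derivative[OF assms(1,2), of t] assms(3) by simp
  then have "((\<lambda>s. Ad K c (E (s *\<^sub>R X)) Y) has_derivative (\<lambda>h. 0)) (at t within UNIV)" for t
    by (simp add: has_vector_derivative_def)
  from has_derivative_zero_unique[OF convex_UNIV this, of s 0]
  show ?thesis using assms by (simp add: lie_exp_0 Ad_one)
qed

text \<open>The group element \<open>exp (-(\<pi>/\<omega>) X)\<close> of the \<open>SU(2)\<close> of the root \<open>\<alpha>\<close> reverses \<open>\<alpha>\<close>:
  \<open>cos (\<omega> s) \<alpha> + (a/\<omega>) sin (\<omega> s) Y\<close> is the solution of \<open>u' = [X, u]\<close>, \<open>u(0) = \<alpha>\<close>.\<close>

lemma reflection_by_Ad:
  assumes "\<alpha> \<in> roots K c T ip"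
  obtains g where "g \<in> carrier K" "\<And>H. H \<in> \<tau> \<Longrightarrow> Ad K c g H = ip.reflect \<alpha> H"
proof -
  obtain X Y where \<alpha>: "\<alpha> \<in> \<tau>" "\<alpha> \<noteq> 0" and r: "root_vector \<alpha> X Y"
    using assms unfolding roots_iff by blast
  note D = root_vectorD[OF r]
  have \<alpha>V: "\<alpha> \<in> V" using torus_dual_V[OF \<alpha>(1)] .
  define a where "a = ip \<alpha> \<alpha>"
  define q where "q = ip Y Y"
  have a: "a > 0" using ip.ip_pos[OF \<alpha>V \<alpha>(2)] by (simp add: a_def)
  have q: "q > 0" using root_vector_norm_pos[OF r \<alpha>] by (simp add: q_def)
  \<comment> \<open>The bracket with X sends \<alpha> to a Y and Y to -q \<alpha>, so it generates a
    rotation of their plane with angular speed sqrt (a q).\<close>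
  define \<omega> where "\<omega> = sqrt (a * q)"
  have \<omega>: "\<omega> > 0" "\<omega> * \<omega> = a * q" using a q by (simp_all add: \<omega>_def)
  define X' where "X' = - X"
  have X': "X' \<in> V" using V_neg[OF D(1)] by (simp add: X'_def)
  have neg: "bracket X' Z = - bracket X Z" if "Z \<in> V" for Z
    using bracket_scale_left[OF D(1) that, of "-1"] by (simp add: X'_def)
  have br\<alpha>: "bracket X' \<alpha> = (- a) *\<^sub>R Y"
    using neg[OF \<alpha>V] bracket_anticommute[OF D(1) \<alpha>V] root_vector_bracket(1)[OF r \<alpha>(1) \<alpha>(1)] by (simp add: a_def)
  have brY: "bracket X' Y = q *\<^sub>R \<alpha>"
    using neg[OF D(2)] bracket_root_vector[OF r \<alpha>(1)] by (simp add: q_def)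
  define A where "A Z s = Ad K c (E (s *\<^sub>R X')) Z" for Z s
  have dA\<alpha>: "(A \<alpha> has_vector_derivative (- a) *\<^sub>R A Y t) (at t)" for t
    using bracket_derivative[OF X' \<alpha>V, of t] Ad_scale[OF E_scale_carrier[OF X'] D(2), of t "- a"]
    unfolding A_def br\<alpha> by simp
  have dAY: "(A Y has_vector_derivative q *\<^sub>R A \<alpha> t) (at t)" for t
    using bracket_derivative[OF X' D(2), of t] Ad_scale[OF E_scale_carrier[OF X'] \<alpha>V, of t q]
    unfolding A_def brY by simp
  \<comment> \<open>Takes the place of uniqueness for the differential equation: Ad (exp (-s X)) is
    applied to the explicit solution, and the result is constant. At s = pi / \<omega> the sine term
    vanishes and the cosine is -1.\<close>
  define u where "u s = cos (\<omega> * s) *\<^sub>R A \<alpha> s + (a / \<omega> * sin (\<omega> * s)) *\<^sub>R A Y s" for s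
  have "(u has_vector_derivative 0) (at t)" for t
  proof -
    have 1: "((\<lambda>s. cos (\<omega> * s)) has_real_derivative - sin (\<omega> * t) * \<omega>) (at t)"
      by (auto intro!: derivative_eq_intros)
    have 2: "((\<lambda>s. a / \<omega> * sin (\<omega> * s)) has_real_derivative a / \<omega> * (cos (\<omega> * t) * \<omega>)) (at t)"
      by (auto intro!: derivative_eq_intros)
    have "(u has_vector_derivative
        (cos (\<omega> * t) *\<^sub>R ((- a) *\<^sub>R A Y t) + (- sin (\<omega> * t) * \<omega>) *\<^sub>R A \<alpha> t) +
        ((a / \<omega> * sin (\<omega> * t)) *\<^sub>R (q *\<^sub>R A \<alpha> t) + (a / \<omega> * (cos (\<omega> * t) * \<omega>)) *\<^sub>R A Y t)) (at t)"
      unfolding u_def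
      by (intro has_vector_derivative_add has_vector_derivative_scaleR 1 2 dA\<alpha> dAY)
    also have "(cos (\<omega> * t) *\<^sub>R ((- a) *\<^sub>R A Y t) + (- sin (\<omega> * t) * \<omega>) *\<^sub>R A \<alpha> t) +
        ((a / \<omega> * sin (\<omega> * t)) *\<^sub>R (q *\<^sub>R A \<alpha> t) + (a / \<omega> * (cos (\<omega> * t) * \<omega>)) *\<^sub>R A Y t)
      = (cos (\<omega> * t) * (- a) + a / \<omega> * (cos (\<omega> * t) * \<omega>)) *\<^sub>R A Y t +
        (- sin (\<omega> * t) * \<omega> + a / \<omega> * sin (\<omega> * t) * q) *\<^sub>R A \<alpha> t"
      by (simp only: scaleR_scaleR scaleR_add_left) (simp add: algebra_simps)
    also have "cos (\<omega> * t) * (- a) + a / \<omega> * (cos (\<omega> * t) * \<omega>) = 0" using \<omega>(1) by simp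
    also have "- sin (\<omega> * t) * \<omega> + a / \<omega> * sin (\<omega> * t) * q = 0"
    proof -
      have "a / \<omega> * q = \<omega>" using \<omega> by (simp add: field_simps)
      then show ?thesis by (metis (no_types, opaque_lifting) add.left_inverse mult.commute mult.left_commute mult_minus_left)
    qed
    finally show ?thesis by simp
  qed
  then have "(u has_derivative (\<lambda>h. 0)) (at t within UNIV)" for t
    by (simp add: has_vector_derivative_def)
  from has_derivative_zero_unique[OF convex_UNIV this, of "pi / \<omega>" 0]
  have "u (pi / \<omega>) = u 0" by simp
  moreover have "u 0 = \<alpha>" by (simp add: u_def A_def lie_exp_0 Ad_one \<alpha>V)
  moreover have "u (pi / \<omega>) = - A \<alpha> (pi / \<omega>)" using \<omega>(1) by (simp add: u_def)
  ultimately have rev: "A \<alpha> (pi / \<omega>) = - \<alpha>" by (metis minus_minus)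
  define g where "g = E ((pi / \<omega>) *\<^sub>R X')"
  have g: "g \<in> carrier K" using E_scale_carrier[OF X'] by (simp add: g_def)
  have g\<alpha>: "Ad K c g \<alpha> = - \<alpha>" using rev by (simp add: A_def g_def)
  have fixed: "Ad K c g H = H" if H: "H \<in> \<tau>" "ip \<alpha> H = 0" for H
  proof -
    have HV: "H \<in> V" using torus_dual_V[OF H(1)] .
    have "bracket X' H = 0"
      using neg[OF HV] bracket_anticommute[OF D(1) HV] root_vector_bracket(1)[OF r \<alpha>(1) H(1)] H(2) by simp
    then show ?thesis unfolding g_def by (rule Ad_lie_exp_constant[OF X' HV])
  qed
  show ?thesis
  proof (rule that[OF g])
    fix H assume H: "H \<in> \<tau>"
    have HV: "H \<in> V" using torus_dual_V[OF H] .
    define k where "k = ip H \<alpha> / a"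
    define H0 where "H0 = H - k *\<^sub>R \<alpha>"
    have H0: "H0 \<in> \<tau>" unfolding H0_def
      using torus_dual_diff[OF H torus_dual_scale[OF \<alpha>(1)]] .
    have "ip \<alpha> H0 = 0"
      using a HV \<alpha>V V_scale[OF \<alpha>V] ip.ip_sym[OF \<alpha>V HV]
      by (simp add: H0_def k_def ip.ip_diff_right ip.ip_scale_right a_def)
    then have "Ad K c g H0 = H0" using fixed H0 by blast
    moreover have "H = H0 + k *\<^sub>R \<alpha>" by (simp add: H0_def)
    ultimately have "Ad K c g H = H0 + k *\<^sub>R (- \<alpha>)"
      using Ad_add[OF g torus_dual_V[OF H0] V_scale[OF \<alpha>V]] Ad_scale[OF g \<alpha>V] g\<alpha> by metis
    also have "\<dots> = ip.reflect \<alpha> H"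
      by (simp add: H0_def ip.reflect_def k_def a_def scaleR_add_left[symmetric] algebra_simps)
    finally show "Ad K c g H = ip.reflect \<alpha> H" .
  qed
qed

text \<open>With g inducing the reflection in \<alpha>, conjugation by g turns the exponential of
  the reflected H into exp H. So \<open>Ad g\<close> carries root vectors of \<gamma> to vectors on
  which exp H acts with the angle of \<gamma> on the reflected H. The reflection being self-adjoint,
  this is the angle of the reflected \<gamma> on H.\<close>

lemma reflect_root:
  assumes \<alpha>: "\<alpha> \<in> roots K c T ip" and \<gamma>: "\<gamma> \<in> roots K c T ip"
  shows "ip.reflect \<alpha> \<gamma> \<in> roots K c T ip"
proof -
  have \<alpha>t: "\<alpha> \<in> \<tau>" "\<alpha> \<noteq> 0" "\<alpha> \<in> V" and \<gamma>t: "\<gamma> \<in> \<tau>" "\<gamma> \<noteq> 0" "\<gamma> \<in> V"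
    using \<alpha> \<gamma> torus_dual_V by (auto simp: roots_iff)
  obtain g where g: "g \<in> carrier K" "\<And>H. H \<in> \<tau> \<Longrightarrow> Ad K c g H = ip.reflect \<alpha> H"
    using reflection_by_Ad[OF \<alpha>] by blast
  obtain X Y where r: "root_vector \<gamma> X Y" using \<gamma> unfolding roots_iff by blast
  note D = root_vectorD[OF r]
  have refl: "ip.reflect \<alpha> H \<in> \<tau>" if "H \<in> \<tau>" for H unfolding ip.reflect_def
    using torus_dual_diff[OF that torus_dual_scale[OF \<alpha>t(1)]] .
  have eq: "Ad K c (E H) (Ad K c g Z) = Ad K c g (Ad K c (E (ip.reflect \<alpha> H)) Z)" if H: "H \<in> \<tau>" and Z: "Z \<in> V" for H Z
  proof -
    have rV: "ip.reflect \<alpha> H \<in> V" using refl[OF H] torus_dual_V by blast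
    have "Ad K c g (ip.reflect \<alpha> H) = H"
      using g(2)[OF refl[OF H]] ip.reflect_reflect \<alpha>t torus_dual_V[OF H] by simp
    then have "g \<otimes> E (ip.reflect \<alpha> H) \<otimes> inv g = E H" using conj_lie_exp[OF g(1) rV] by simp
    then have "E H \<otimes> g = g \<otimes> E (ip.reflect \<alpha> H) \<otimes> inv g \<otimes> g" by simp
    also have "\<dots> = g \<otimes> E (ip.reflect \<alpha> H)" using g(1) lie_exp_carrier[OF rV] by (simp add: m_assoc)
    finally show ?thesis
      using Ad_mult[OF lie_exp_carrier[OF torus_dual_V[OF H]] g(1) Z] Ad_mult[OF g(1) lie_exp_carrier[OF rV] Z] by simp
  qed
  have "root_vector (ip.reflect \<alpha> \<gamma>) (Ad K c g X) (Ad K c g Y)"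
    unfolding root_vector_def
  proof (intro conjI ballI)
    show "Ad K c g X \<in> V" "Ad K c g Y \<in> V" using Ad_V[OF g(1)] D by auto
    have "Ad K c (inv g) 0 = 0"
      using Ad_zero[OF inv_closed[OF g(1)]] .
    then have "Z = 0" if "Z \<in> V" "Ad K c g Z = 0" for Z
      using Ad_inv_Ad[OF g(1) that(1)] that(2) by simp
    then show "Ad K c g X \<noteq> 0 \<or> Ad K c g Y \<noteq> 0"
      using r D by (auto simp: root_vector_def)
    fix H assume H: "H \<in> \<tau>"
    have angle: "ip \<gamma> (ip.reflect \<alpha> H) = ip (ip.reflect \<alpha> \<gamma>) H"
      using ip.ip_reflect_adjoint[OF \<alpha>t(3) \<gamma>t(3) torus_dual_V[OF H]] by simp
    have sc: "k *\<^sub>R Z \<in> V" if "Z \<in> V" for k Z using V_scale[OF that] .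
    have sub: "Ad K c g (Z - Z') = Ad K c g Z - Ad K c g Z'" if "Z \<in> V" "Z' \<in> V" for Z Z'
      using Ad_add[OF g(1) that(1) V_neg[OF that(2)]] Ad_minus[OF g(1) that(2)] by simp
    show "Ad K c (E H) (Ad K c g X) = cos (ip (ip.reflect \<alpha> \<gamma>) H) *\<^sub>R Ad K c g X - sin (ip (ip.reflect \<alpha> \<gamma>) H) *\<^sub>R Ad K c g Y"
      unfolding eq[OF H D(1)] D(3)[OF refl[OF H]] angle using D sc by (simp add: sub Ad_scale[OF g(1)])
    show "Ad K c (E H) (Ad K c g Y) = sin (ip (ip.reflect \<alpha> \<gamma>) H) *\<^sub>R Ad K c g X + cos (ip (ip.reflect \<alpha> \<gamma>) H) *\<^sub>R Ad K c g Y"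
      unfolding eq[OF H D(2)] D(4)[OF refl[OF H]] angle using D sc by (simp add: Ad_add[OF g(1)] Ad_scale[OF g(1)])
  qed
  moreover have "ip.reflect \<alpha> \<gamma> \<noteq> 0"
  proof
    assume "ip.reflect \<alpha> \<gamma> = 0"
    then have "\<gamma> = ip.reflect \<alpha> 0" using ip.reflect_reflect[OF \<alpha>t(3) \<gamma>t(3) \<alpha>t(2)] by simp
    then show False using \<gamma>t \<alpha>t by (simp add: ip.reflect_def)
  qed
  ultimately show ?thesis using refl[OF \<gamma>t(1)] unfolding roots_iff by blast
qed

text \<open>Take H on which \<alpha> and \<beta> differ by pi. Then exp H rotates the two pairs by
  angles that differ by a half turn, so invariance equates the sum with its own negative.\<close>

lemma root_vectors_orthogonal:
  assumes \<alpha>: "\<alpha> \<in> \<tau>" "root_vector \<alpha> X Y" and \<beta>: "\<beta> \<in> \<tau>" "root_vector \<beta> X' Y'" and ne: "\<alpha> \<noteq> \<beta>"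
  shows "ip X X' + ip Y Y' = 0"
proof -
  note D = root_vectorD[OF \<alpha>(2)] and D' = root_vectorD[OF \<beta>(2)]
  obtain H where H: "H \<in> \<tau>" "ip (\<alpha> - \<beta>) H = pi"
    using torus_element_with_angle[of "\<alpha> - \<beta>" pi] torus_dual_diff[OF \<alpha>(1) \<beta>(1)] ne by auto
  have HV: "H \<in> V" using torus_dual_V[OF H(1)] .
  have ang: "ip \<alpha> H = ip \<beta> H + pi"
    using H(2) ip.ip_diff_left[OF torus_dual_V[OF \<alpha>(1)] torus_dual_V[OF \<beta>(1)] HV] by simp
  define p where "p = cos (ip \<beta> H)"
  define q where "q = sin (ip \<beta> H)"
  have pq: "p * p + q * q = 1" unfolding p_def q_def
    using sin_cos_squared_add2[of "ip \<beta> H"] by (simp add: power2_eq_square)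
  have e: "Ad K c (E H) X = (- p) *\<^sub>R X + q *\<^sub>R Y" "Ad K c (E H) Y = (- q) *\<^sub>R X + (- p) *\<^sub>R Y"
    "Ad K c (E H) X' = p *\<^sub>R X' + (- q) *\<^sub>R Y'" "Ad K c (E H) Y' = q *\<^sub>R X' + p *\<^sub>R Y'"
    using D(3,4)[OF H(1)] D'(3,4)[OF H(1)] by (simp_all add: ang p_def q_def)
  have "ip X X' + ip Y Y' = ip (Ad K c (E H) X) (Ad K c (E H) X') + ip (Ad K c (E H) Y) (Ad K c (E H) Y')"
    using ip_Ad[OF lie_exp_carrier[OF HV]] D(1,2) D'(1,2) by simp
  also have "\<dots> = - ((p * p + q * q) * ip X X') - (p * p + q * q) * ip Y Y'"
    unfolding e using D(1,2) D'(1,2) V_add V_scale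
    by (simp add: ip.ip_add_left ip.ip_add_right ip.ip_scale_left ip.ip_scale_right algebra_simps
        del: scaleR_minus_left)
  finally show ?thesis unfolding pq by simp
qed

lemma finite_roots: "finite (roots K c T ip)"
proof -
  define R where "R = roots K c T ip"
  \<comment> \<open>The real part of the Hermitian extension of \<open>ip\<close> to the
    complexification. One root vector for each root gives an orthogonal, hence independent, family
    in a finite-dimensional space.\<close>
  define ip2 where "ip2 z w = ip (fst z) (fst w) + ip (snd z) (snd w)" for z w
  interpret ip2: subspace_ip "V \<times> V" ip2
  proof
    show "subspace (V \<times> V)" by (rule subspace_Times[OF subspace_V subspace_V])
    show "ip2 z z > 0" if "z \<in> V \<times> V" "z \<noteq> 0" for z
      using that ip.ip_pos[of "fst z"] ip.ip_pos[of "snd z"] ip.ip_nonneg[of "fst z"] ip.ip_nonneg[of "snd z"]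
      by (cases "fst z = 0") (auto simp: ip2_def prod_eq_iff intro: add_pos_nonneg)
  qed (auto simp: ip2_def ip.ip_sym ip.ip_add_left ip.ip_scale_left algebra_simps)
  have "\<forall>\<alpha>\<in>R. \<exists>z. root_vector \<alpha> (fst z) (snd z)" using roots_iff by (auto simp: R_def)
  then obtain z where z: "\<And>\<alpha>. \<alpha> \<in> R \<Longrightarrow> root_vector \<alpha> (fst (z \<alpha>)) (snd (z \<alpha>))" by metis
  have zV: "z \<alpha> \<in> V \<times> V" "z \<alpha> \<noteq> 0" if "\<alpha> \<in> R" for \<alpha>
    using z[OF that] by (auto simp: root_vector_def mem_Times_iff prod_eq_iff)
  have orth: "ip2 (z \<alpha>) (z \<beta>) = 0" if "\<alpha> \<in> R" "\<beta> \<in> R" "\<alpha> \<noteq> \<beta>" for \<alpha> \<beta>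
    unfolding ip2_def using that
    by (intro root_vectors_orthogonal[OF _ z _ z]) (auto simp: R_def roots_iff)
  have "inj_on z R"
  proof (rule inj_onI, rule ccontr)
    fix \<alpha> \<beta> assume "\<alpha> \<in> R" "\<beta> \<in> R" "z \<alpha> = z \<beta>" "\<alpha> \<noteq> \<beta>"
    then show False using orth[of \<alpha> \<beta>] ip2.ip_pos[OF zV, of \<beta>] by simp
  qed
  moreover have "independent (z ` R)"
  proof (rule ip2.independent_if_orthogonal)
    show "z ` R \<subseteq> V \<times> V" "0 \<notin> z ` R" using zV by (blast, metis imageE)
    show "ip2 x y = 0" if "x \<in> z ` R" "y \<in> z ` R" "x \<noteq> y" for x y
      using that orth by blast
  qed
  then have "finite (z ` R)" by (rule independent_imp_finite)
  ultimately show ?thesis unfolding R_def[symmetric] using finite_image_iff by blast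
qed

end

theorem corollary4p4:
  fixes K :: "('g, 'e::euclidean_space) lie_data"
    and c :: "'g set \<times> ('g \<Rightarrow> 'e)"
    and T :: "'g set"
    and ip :: "'e \<Rightarrow> 'e \<Rightarrow> real"
    and P :: "'e set"
    and lam mu :: 'e
  assumes "compact_connected_lie_group K"
    and "chart_at_one K c"
    and "invariant_inner_product K c ip"
    and "maximal_torus K T"
    and "positive_system K c T ip P"
    and "lam \<in> (\<lambda>\<xi>. half_sum P + \<xi>) ` weyl_chamber K c T ip P"
    and "mu \<in> torus_dual K c T"
  shows "ip_norm ip (lam - mu) \<ge> ip_norm ip (rho_stabilizer ip P mu) \<and>
    (ip_norm ip (lam - mu) = ip_norm ip (rho_stabilizer ip P mu) \<longleftrightarrow>
       mu \<in> weyl_chamber K c T ip P \<and>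
       lam - rho_at ip (roots K c T ip) lam = mu - rho_at ip (roots K c T ip) mu)"
proof -
  interpret lie_roots K c T ip
    using assms(1-4) by unfold_locales (auto simp: compact_connected_lie_group_def)
  obtain h where h: "h \<in> torus_dual K c T" "\<And>\<alpha>. \<alpha> \<in> roots K c T ip \<Longrightarrow> ip \<alpha> h \<noteq> 0"
    and P: "P = {\<alpha> \<in> roots K c T ip. ip \<alpha> h > 0}"
    using assms(5) unfolding positive_system_def lie_subalgebra_eq by blast
  interpret reflection_system "model K" ip "roots K c T ip" P h
    using finite_roots reflect_root h P torus_dual_V
    by unfold_locales (auto simp: roots_iff)
  \<comment> \<open>A coroot is a positive multiple of its root under the identification by
    \<open>ip\<close>, so dominance may be tested on the positive roots themselves.\<close>
  have chamber: "\<xi> \<in> weyl_chamber K c T ip P \<longleftrightarrow> (\<forall>\<beta>\<in>P. ip \<xi> \<beta> \<ge> 0)" if "\<xi> \<in> torus_dual K c T" for \<xi>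
  proof -
    have "ip \<xi> (coroot ip \<beta>) \<ge> 0 \<longleftrightarrow> ip \<xi> \<beta> \<ge> 0" if "\<beta> \<in> P" for \<beta>
      using ip.ip_pos[OF P_V[OF that] P_nonzero[OF that]] torus_dual_V[OF \<open>\<xi> \<in> torus_dual K c T\<close>] P_V[OF that]
      by (simp add: coroot_def ip.ip_scale_right zero_le_divide_iff zero_le_mult_iff)
    then show ?thesis using that by (auto simp: weyl_chamber_def)
  qed
  obtain \<xi> where \<xi>: "\<xi> \<in> weyl_chamber K c T ip P" "lam = half_sum P + \<xi>" using assms(6) by blast
  then have \<xi>t: "\<xi> \<in> torus_dual K c T" by (simp add: weyl_chamber_def)
  have dom: "\<And>\<beta>. \<beta> \<in> P \<Longrightarrow> ip \<xi> \<beta> \<ge> 0" using \<xi>(1) chamber[OF \<xi>t] by blast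
  show ?thesis
    using norm_shifted_dominant_ge[OF torus_dual_V[OF \<xi>t] dom torus_dual_V[OF assms(7)] \<xi>(2)]
    by (simp add: chamber[OF assms(7)])
qed

end
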